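(* Let $\beta$ be an admissible and compatible weight on an additive subgroup $\Xi$ of $\mathbb{R}/\mathbb{Z}$. Let $\mathcal{R}=\mathcal{W}_{\alpha_1,\alpha_2}(\mathcal{A})$ with $\alpha_1,\alpha_2\ge0$, $\alpha_1+\alpha_2=1$, and $\mathcal{A}=APW(\mathbb{Z},\Xi,\beta)$. Suppose that $h_1,h_2:\mathbb{Z}^+\to\mathbb{Z}$ are fractal sequences for $\Xi$ with associated $\tau_1$ and $\tau_2$ in $\mathrm{Hom}(\Xi,\mathbb{T})$, respectively, such that $h(n):=h_2(n)-h_1(n)>0$ and $h(n)\to\infty$ as $n\to\infty$. If $A_1,\dots,A_r\in\mathcal{R}$ and $A=e^{A_1}\cdots e^{A_r}$, then $$\lim_{n\to\infty}\frac{\det\big(P_{h_1(n),h_2(n)}AP_{h_1(n),h_2(n)}\big)}{G^{h_2(n)-h_1(n)}}=\Theta_{A,1}(\tau_1)\,\Theta_{A,2}(\tau_2),$$ where $G=\exp(M(a))$ and $a=D(A_1+\cdots+A_r)$.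
   Context: $\mathbb{Z}^+=\{0,1,2,\dots\}$, $\mathbb{T}=\{t\in\mathbb{C}:|t|=1\}$. For $\xi\in\mathbb{R}/\mathbb{Z}$, $e_\xi\in l^\infty(\mathbb{Z})$ is $e_\xi(k)=e^{2\pi ik\xi}$ and $\|\xi\|_{\mathbb{R}/\mathbb{Z}}=\inf\{|\xi-n|:n\in\mathbb{Z}\}$. $\mathrm{Hom}(\Xi,\mathbb{T})$ is the set of group homomorphisms $\Xi\to\mathbb{T}$. Weights: $\beta:\Xi\to\mathbb{R}^+$ is admissible if $1\le\beta(\xi_1+\xi_2)\le\beta(\xi_1)\beta(\xi_2)$ for all $\xi_1,\xi_2\in\Xi$; it is compatible if $\inf_{\xi\in\Xi,\xi\ne0}\beta(\xi)\|\xi\|_{\mathbb{R}/\mathbb{Z}}>0$ (the infimum over the empty set being $+\infty$). $APW(\mathbb{Z},\Xi,\beta)$ is the set of all $a\in l^\infty(\mathbb{Z})$ of the form $a=\sum_{\xi\in\Xi}a_\xi e_\xi$ (at most countably many $a_\xi\neq0$) with norm $\|a\|_{\Xi,\beta}=\sum_{\xi\in\Xi}\beta(\xi)|a_\xi|<\infty$. For $A=(a_{j,k})\in\mathcal{L}(l^2(\mathbb{Z}))$, the $k$-th diagonal is $D_k(A)=(a_{j,j-k})_{j\in\mathbb{Z}}$, and $D(A)=D_0(A)$. $\mathcal{W}_{\alpha_1,\alpha_2}(\mathcal{A})$ is the set of $A\in\mathcal{L}(l^2(\mathbb{Z}))$ with $D_k(A)\in\mathcal{A}$ for all $k$ and $\|A\|=\sum_{k\in\mathbb{Z}}\alpha(k)\|D_k(A)\|_{\mathcal{A}}<\infty$,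 where $\alpha(k)=(1+k)^{\alpha_1}$ for $k\ge0$ and $\alpha(k)=(1+|k|)^{\alpha_2}$ for $k<0$; it is a unital Banach algebra. With $U_n:(x_k)\mapsto(x_{k-n})$ and $bI$ the multiplication operator $(x_k)\mapsto(b(k)x_k)$, each such $A$ equals $\sum_{n}\sum_{\xi\in\Xi}a^{(n)}_\xi(e_\xi I)U_n$ with $D_n(A)=\sum_\xi a^{(n)}_\xi e_\xi$. A sequence $h:\mathbb{Z}^+\to\mathbb{Z}$ is fractal for $\Xi$ with associated $\tau$ if for each $\xi\in\Xi$ the limit $\tau(\xi):=\lim_{n\to\infty}e^{2\pi ih(n)\xi}$ exists (then $\tau\in\mathrm{Hom}(\Xi,\mathbb{T})$). For $\tau\in\mathrm{Hom}(\Xi,\mathbb{T})$ let $\mathcal{U}^\tau:\mathcal{R}\to\mathcal{R}$, $\sum_n\sum_\xi a^{(n)}_\xi(e_\xi I)U_n\mapsto\sum_n\sum_\xi a^{(n)}_\xi\tau(\xi)(e_\xi I)U_n$. $T(A)=PAP$ is the compression of $A$ to $l^2(\mathbb{Z}^+)$ ($P$ the orthogonal projection of $l^2(\mathbb{Z})$ onto $l^2(\mathbb{Z}^+)$). For $A=e^{A_1}\cdots e^{A_r}$ with $A_i\in\mathcal{R}$ and $a=\sum_{\xi\in\Xi}a_\xi e_\xi=D(A_1+\cdots+A_r)$ put $$\Theta_{A,1}(\tau)=\exp\Big(\sum_{\xi\in\Xi,\xi\ne0}a_\xi\frac{\tau(\xi)}{1-e^{2\pi i\xi}}\Big)\det\big(T(\mathcal{U}^\tau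 A)e^{-T(\mathcal{U}^\tau A_r)}\cdots e^{-T(\mathcal{U}^\tau A_1)}\big),$$ $$\Theta_{A,2}(\tau)=\exp\Big(\sum_{\xi\in\Xi,\xi\ne0}a_\xi\frac{-\tau(\xi)}{1-e^{2\pi i\xi}}\Big)\det\big(e^{T(\mathcal{U}^\tau A_1)}\cdots e^{T(\mathcal{U}^\tau A_r)}T(\mathcal{U}^\tau A^{-1})\big),$$ where the determinants are operator (Fredholm) determinants of operators of the form identity plus trace class on $l^2(\mathbb{Z}^+)$ (these are well defined). $M(a)=\lim_{n\to\infty}\frac1n\sum_{k=0}^{n-1}a(k)$. For integers $n_1<n_2$, $P_{n_1,n_2}$ is the projection on $l^2(\mathbb{Z})$ keeping the coordinates $x_k$ with $n_1\le k<n_2$; $P_{n_1,n_2}AP_{n_1,n_2}$ is identified with a matrix of order $n_2-n_1$. *)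

theory Defs
  imports
    "HOL-Analysis.Bounded_Linear_Function"
    "HOL-Analysis.L2_Norm"
    "HOL-Analysis.Infinite_Sum"
    "HOL-Analysis.Complex_Transcendental"
    "HOL-Combinatorics.Permutations"
    "Jordan_Normal_Form.Determinant"
begin

section \<open>The group of reals modulo one\<close>

quotient_type rmodz = real / "\<lambda>x y :: real. x - y \<in> \<int>"
proof (rule equivpI)
  show "reflp (\<lambda>x y :: real. x - y \<in> \<int>)" by (auto intro: reflpI)
  show "symp (\<lambda>x y :: real. x - y \<in> \<int>)"
    by (rule sympI) (metis Ints_minus minus_diff_eq)
  show "transp (\<lambda>x y :: real. x - y \<in> \<int>)"
    by (rule transpI) (metis Ints_add diff_add_cancel add_diff_eq)
qed

instantiation rmodz :: ab_group_add
begin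

lift_definition zero_rmodz :: rmodz is 0 .

lift_definition plus_rmodz :: "rmodz \<Rightarrow> rmodz \<Rightarrow> rmodz" is "(+)"
  by (drule (1) Ints_add) (simp add: algebra_simps)

lift_definition uminus_rmodz :: "rmodz \<Rightarrow> rmodz" is uminus
  by (metis Ints_minus minus_diff_eq minus_diff_minus)

lift_definition minus_rmodz :: "rmodz \<Rightarrow> rmodz \<Rightarrow> rmodz" is "(-)"
  by (drule (1) Ints_diff) (simp add: algebra_simps)

instance
  by standard (transfer; simp add: algebra_simps)+

end

lift_definition rz_norm :: "rmodz \<Rightarrow> real" is "\<lambda>x. INF n::int. \<bar>x - of_int n\<bar>"
proof -
  fix x y :: real assume "x - y \<in> \<int>"
  then obtain m where m: "x = y + of_int m" by (auto elim!: Ints_cases simp: algebra_simps)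
  have "range (\<lambda>n::int. \<bar>x - of_int n\<bar>) = range (\<lambda>n::int. \<bar>y - of_int n\<bar>)"
  proof safe
    fix n show "\<bar>x - of_int n\<bar> \<in> range (\<lambda>n::int. \<bar>y - of_int n\<bar>)"
      using m by (intro image_eqI[of _ _ "n - m"]) auto
  next
    fix n show "\<bar>y - of_int n\<bar> \<in> range (\<lambda>n::int. \<bar>x - of_int n\<bar>)"
      using m by (intro image_eqI[of _ _ "n + m"]) auto
  qed
  then show "(INF n::int. \<bar>x - of_int n\<bar>) = (INF n::int. \<bar>y - of_int n\<bar>)" by simp
qed

lift_definition echar :: "rmodz \<Rightarrow> int \<Rightarrow> complex" is
  "\<lambda>x k. exp (2 * of_real pi * \<i> * of_int k * of_real x)"
proof -
  fix x y :: real assume "x - y \<in> \<int>"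
  then obtain m where m: "x = y + of_int m" by (auto elim!: Ints_cases simp: algebra_simps)
  show "(\<lambda>k::int. exp (2 * of_real pi * \<i> * of_int k * of_real x)) =
        (\<lambda>k. exp (2 * of_real pi * \<i> * of_int k * of_real y) :: complex)"
  proof (rule ext)
    fix k :: int
    have "2 * of_real pi * \<i> * of_int k * of_real x =
        2 * of_real pi * \<i> * of_int k * of_real y + of_real (of_int (2 * (k * m)) * pi) * \<i>"
      unfolding m by (simp add: algebra_simps)
    then show "exp (2 * of_real pi * \<i> * of_int k * of_real x) =
        (exp (2 * of_real pi * \<i> * of_int k * of_real y) :: complex)"
      unfolding exp_eq by blast
  qed
qed

definition add_subgroup :: "'a::group_add set \<Rightarrow> bool" where
  "add_subgroup \<Xi> \<longleftrightarrow> 0 \<in> \<Xi> \<and> (\<forall>x\<in>\<Xi>. \<forall>y\<in>\<Xi>. x + y \<in> \<Xi>) \<and> (\<forall>x\<in>\<Xi>. - x \<in> \<Xi>)"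

text \<open>A homomorphism on \<^term>\<open>\<Xi>\<close> is a total function that is constrained on \<^term>\<open>\<Xi>\<close> only.\<close>

definition Hom_T :: "rmodz set \<Rightarrow> (rmodz \<Rightarrow> complex) set" where
  "Hom_T \<Xi> = {\<tau>. (\<forall>\<xi>\<in>\<Xi>. cmod (\<tau> \<xi>) = 1) \<and> (\<forall>\<xi>\<in>\<Xi>. \<forall>\<eta>\<in>\<Xi>. \<tau> (\<xi> + \<eta>) = \<tau> \<xi> * \<tau> \<eta>)}"

definition fractal :: "rmodz set \<Rightarrow> (nat \<Rightarrow> int) \<Rightarrow> (rmodz \<Rightarrow> complex) \<Rightarrow> bool" where
  "fractal \<Xi> h \<tau> \<longleftrightarrow> (\<forall>\<xi>\<in>\<Xi>. (\<lambda>n. echar \<xi> (h n)) \<longlonglongrightarrow> \<tau> \<xi>)"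

definition admissible :: "rmodz set \<Rightarrow> (rmodz \<Rightarrow> real) \<Rightarrow> bool" where
  "admissible \<Xi> \<beta> \<longleftrightarrow> (\<forall>\<xi>\<in>\<Xi>. 0 < \<beta> \<xi>) \<and>
     (\<forall>\<xi>\<in>\<Xi>. \<forall>\<eta>\<in>\<Xi>. 1 \<le> \<beta> (\<xi> + \<eta>) \<and> \<beta> (\<xi> + \<eta>) \<le> \<beta> \<xi> * \<beta> \<eta>)"

text \<open>The infimum is taken in \<^typ>\<open>ereal\<close>, so that it is infinite for the trivial subgroup.\<close>

definition compatible :: "rmodz set \<Rightarrow> (rmodz \<Rightarrow> real) \<Rightarrow> bool" where
  "compatible \<Xi> \<beta> \<longleftrightarrow> 0 < (INF \<xi>\<in>\<Xi> - {0}. ereal (\<beta> \<xi> * rz_norm \<xi>))"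


section \<open>Almost periodic sequences\<close>

text \<open>
  \<^term>\<open>apw_expansion \<Xi> \<beta> a c\<close> says that \<^term>\<open>a\<close> is the sum of \<^term>\<open>c \<xi>\<close> times
  \<^term>\<open>echar \<xi>\<close> over \<^term>\<open>\<Xi>\<close>, with finite weighted norm. For an admissible weight the
  coefficients are absolutely summable, so that this pointwise sum is also the sum in the
  supremum norm, and at most countably many coefficients are nonzero. The coefficients are set
  to zero off \<^term>\<open>\<Xi>\<close>, which makes them unique.
\<close>

definition apw_expansion ::
  "rmodz set \<Rightarrow> (rmodz \<Rightarrow> real) \<Rightarrow> (int \<Rightarrow> complex) \<Rightarrow> (rmodz \<Rightarrow> complex) \<Rightarrow> bool" where
  "apw_expansion \<Xi> \<beta> a c \<longleftrightarrow>
     (\<forall>\<xi>. \<xi> \<notin> \<Xi> \<longrightarrow> c \<xi> = 0) \<and>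
     (\<lambda>\<xi>. \<beta> \<xi> * cmod (c \<xi>)) summable_on \<Xi> \<and>
     (\<forall>k. ((\<lambda>\<xi>. c \<xi> * echar \<xi> k) has_sum a k) \<Xi>)"

definition APW :: "rmodz set \<Rightarrow> (rmodz \<Rightarrow> real) \<Rightarrow> (int \<Rightarrow> complex) set" where
  "APW \<Xi> \<beta> = {a. bounded (range a) \<and> (\<exists>c. apw_expansion \<Xi> \<beta> a c)}"

definition apw_coeff ::
  "rmodz set \<Rightarrow> (rmodz \<Rightarrow> real) \<Rightarrow> (int \<Rightarrow> complex) \<Rightarrow> rmodz \<Rightarrow> complex" where
  "apw_coeff \<Xi> \<beta> a = (THE c. apw_expansion \<Xi> \<beta> a c)"

definition apw_norm :: "rmodz set \<Rightarrow> (rmodz \<Rightarrow> real) \<Rightarrow> (int \<Rightarrow> complex) \<Rightarrow> real" where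
  "apw_norm \<Xi> \<beta> a = (\<Sum>\<^sub>\<infinity>\<xi>\<in>\<Xi>. \<beta> \<xi> * cmod (apw_coeff \<Xi> \<beta> a \<xi>))"

definition mean_value :: "(int \<Rightarrow> complex) \<Rightarrow> complex" where
  "mean_value a = lim (\<lambda>n. (\<Sum>k<n. a (int k)) / of_nat n)"


section \<open>Square-summable families\<close>

definition l2_summable :: "('a \<Rightarrow> complex) \<Rightarrow> bool" where
  "l2_summable x \<longleftrightarrow> (\<lambda>i. (cmod (x i))\<^sup>2) summable_on UNIV"

definition l2_norm :: "('a \<Rightarrow> complex) \<Rightarrow> real" where
  "l2_norm x = sqrt (\<Sum>\<^sub>\<infinity>i. (cmod (x i))\<^sup>2)"

lemma l2_boundI:
  assumes "\<And>F. finite F \<Longrightarrow> L2_set (\<lambda>i. cmod (x i)) F \<le> C"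
  shows "l2_summable x" "l2_norm x \<le> C"
proof -
  have C: "0 \<le> C" using assms[of "{}"] by simp
  have *: "(\<Sum>i\<in>F. (cmod (x i))\<^sup>2) \<le> C\<^sup>2" if "finite F" for F
    using assms[OF that] C unfolding L2_set_def
    by (metis real_sqrt_le_iff real_sqrt_abs abs_of_nonneg)
  show s: "l2_summable x"
    unfolding l2_summable_def
    by (rule nonneg_bdd_above_summable_on) (use * in \<open>auto intro!: bdd_aboveI\<close>)
  have "(\<Sum>\<^sub>\<infinity>i. (cmod (x i))\<^sup>2) \<le> C\<^sup>2"
    by (rule infsum_le_finite_sums) (use s * in \<open>auto simp: l2_summable_def\<close>)
  then show "l2_norm x \<le> C"
    unfolding l2_norm_def using C by (simp add: real_le_lsqrt)
qed

lemma l2_finite_le: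
  assumes "l2_summable x" "finite F"
  shows "L2_set (\<lambda>i. cmod (x i)) F \<le> l2_norm x"
  unfolding L2_set_def l2_norm_def
  by (intro real_sqrt_le_mono finite_sum_le_infsum) (use assms in \<open>auto simp: l2_summable_def\<close>)

lemma l2_norm_nonneg: "0 \<le> l2_norm x"
  unfolding l2_norm_def by (simp add: infsum_nonneg)

lemma l2_coord_le:
  assumes "l2_summable x"
  shows "cmod (x i) \<le> l2_norm x"
  using l2_finite_le[OF assms, of "{i}"] by (simp add: L2_set_def)

lemma l2_add:
  assumes "l2_summable x" "l2_summable y"
  shows "l2_summable (\<lambda>i. x i + y i)" "l2_norm (\<lambda>i. x i + y i) \<le> l2_norm x + l2_norm y"
proof -
  have "L2_set (\<lambda>i. cmod (x i + y i)) F \<le> l2_norm x + l2_norm y" if "finite F" for F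
  proof -
    have "L2_set (\<lambda>i. cmod (x i + y i)) F \<le> L2_set (\<lambda>i. cmod (x i) + cmod (y i)) F"
      by (intro L2_set_mono) (auto intro: norm_triangle_ineq)
    also have "\<dots> \<le> L2_set (\<lambda>i. cmod (x i)) F + L2_set (\<lambda>i. cmod (y i)) F"
      by (rule L2_set_triangle_ineq)
    also have "\<dots> \<le> l2_norm x + l2_norm y"
      by (intro add_mono l2_finite_le assms that)
    finally show ?thesis .
  qed
  then show "l2_summable (\<lambda>i. x i + y i)" "l2_norm (\<lambda>i. x i + y i) \<le> l2_norm x + l2_norm y"
    by (auto intro!: l2_boundI)
qed

lemma l2_mult_bounded:
  assumes "l2_summable x" "\<And>i. cmod (b i) \<le> B"
  shows "l2_summable (\<lambda>i. b i * x i)" "l2_norm (\<lambda>i. b i * x i) \<le> B * l2_norm x"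
proof -
  have B: "0 \<le> B" using assms(2) norm_ge_zero order_trans by blast
  have "L2_set (\<lambda>i. cmod (b i * x i)) F \<le> B * l2_norm x" if "finite F" for F
  proof -
    have "L2_set (\<lambda>i. cmod (b i * x i)) F \<le> L2_set (\<lambda>i. B * cmod (x i)) F"
      by (intro L2_set_mono) (auto simp: norm_mult intro!: mult_right_mono assms)
    also have "\<dots> = B * L2_set (\<lambda>i. cmod (x i)) F"
      by (rule L2_set_right_distrib[OF B, symmetric])
    also have "\<dots> \<le> B * l2_norm x"
      by (intro mult_left_mono B l2_finite_le assms that)
    finally show ?thesis .
  qed
  then show "l2_summable (\<lambda>i. b i * x i)" "l2_norm (\<lambda>i. b i * x i) \<le> B * l2_norm x"
    by (auto intro!: l2_boundI)
qed

lemma l2_norm_scale: "l2_norm (\<lambda>i. c * x i) = cmod c * l2_norm x"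
  unfolding l2_norm_def
  by (simp add: norm_mult power_mult_distrib infsum_cmult_right' real_sqrt_mult)

lemma l2_comp_inj:
  assumes "l2_summable x" "inj f"
  shows "l2_summable (\<lambda>i. x (f i))" "l2_norm (\<lambda>i. x (f i)) \<le> l2_norm x"
proof -
  have "L2_set (\<lambda>i. cmod (x (f i))) F \<le> l2_norm x" if "finite F" for F
  proof -
    have "L2_set (\<lambda>i. cmod (x (f i))) F = L2_set (\<lambda>i. cmod (x i)) (f ` F)"
      unfolding L2_set_def using assms(2) by (simp add: sum.reindex inj_on_subset o_def)
    also have "\<dots> \<le> l2_norm x"
      by (intro l2_finite_le assms) (use that in auto)
    finally show ?thesis .
  qed
  then show "l2_summable (\<lambda>i. x (f i))" "l2_norm (\<lambda>i. x (f i)) \<le> l2_norm x"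
    by (auto intro!: l2_boundI)
qed

lemma l2_extend:
  fixes x :: "nat \<Rightarrow> complex"
  assumes "l2_summable x"
  shows "l2_summable (\<lambda>k::int. if k \<ge> 0 then x (nat k) else 0)"
        "l2_norm (\<lambda>k::int. if k \<ge> 0 then x (nat k) else 0) \<le> l2_norm x"
proof -
  have "L2_set (\<lambda>k::int. cmod (if k \<ge> 0 then x (nat k) else 0)) F \<le> l2_norm x"
    if "finite F" for F
  proof -
    have "L2_set (\<lambda>k::int. cmod (if k \<ge> 0 then x (nat k) else 0)) F =
          sqrt (\<Sum>k\<in>F. (if k \<ge> 0 then (cmod (x (nat k)))\<^sup>2 else 0))"
      unfolding L2_set_def by (intro arg_cong[where f = sqrt] sum.cong) auto
    also have "\<dots> = sqrt (\<Sum>k\<in>F \<inter> {k. k \<ge> 0}. (cmod (x (nat k)))\<^sup>2)"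
      using that by (subst sum.inter_restrict) (auto intro!: sum.cong)
    also have "\<dots> = L2_set (\<lambda>k. cmod (x k)) (nat ` (F \<inter> {k. k \<ge> 0}))"
      unfolding L2_set_def by (subst sum.reindex) (auto simp: inj_on_def)
    also have "\<dots> \<le> l2_norm x"
      by (intro l2_finite_le assms) (use that in auto)
    finally show ?thesis .
  qed
  then show "l2_summable (\<lambda>k::int. if k \<ge> 0 then x (nat k) else 0)"
        "l2_norm (\<lambda>k::int. if k \<ge> 0 then x (nat k) else 0) \<le> l2_norm x"
    by (auto intro!: l2_boundI)
qed

lemma l2_zero: "l2_summable (\<lambda>i. 0)" "l2_norm (\<lambda>i. 0) = 0"
  by (simp_all add: l2_summable_def l2_norm_def)

lemma l2_norm_eq_0:
  assumes "l2_summable x"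
  shows "l2_norm x = 0 \<longleftrightarrow> x = (\<lambda>i. 0)"
proof
  assume "l2_norm x = 0"
  then show "x = (\<lambda>i. 0)"
    using l2_coord_le[OF assms] by (intro ext) simp
qed (simp add: l2_zero)

lemma l2_scale: "l2_summable x \<Longrightarrow> l2_summable (\<lambda>i. c * x i)"
  by (rule l2_mult_bounded(1)[where B = "cmod c"]) auto

lemma l2_uminus: "l2_summable x \<Longrightarrow> l2_summable (\<lambda>i. - x i)"
  by (simp add: l2_summable_def)

lemma l2_diff: "l2_summable x \<Longrightarrow> l2_summable y \<Longrightarrow> l2_summable (\<lambda>i. x i - y i)"
  using l2_add(1)[OF _ l2_uminus, of x y] by simp


section \<open>The Hilbert space of square-summable families\<close>

typedef 'a ell2 = "{x :: 'a \<Rightarrow> complex. l2_summable x}"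
  by (rule exI[of _ "\<lambda>_. 0"]) (simp add: l2_zero)

setup_lifting type_definition_ell2

instantiation ell2 :: (type) real_normed_vector
begin

lift_definition zero_ell2 :: "'a ell2" is "\<lambda>_. 0" by (rule l2_zero)
lift_definition plus_ell2 :: "'a ell2 \<Rightarrow> 'a ell2 \<Rightarrow> 'a ell2" is "\<lambda>x y i. x i + y i" by (rule l2_add)
lift_definition uminus_ell2 :: "'a ell2 \<Rightarrow> 'a ell2" is "\<lambda>x i. - x i" by (rule l2_uminus)
lift_definition minus_ell2 :: "'a ell2 \<Rightarrow> 'a ell2 \<Rightarrow> 'a ell2" is "\<lambda>x y i. x i - y i" by (rule l2_diff)
lift_definition scaleR_ell2 :: "real \<Rightarrow> 'a ell2 \<Rightarrow> 'a ell2" is "\<lambda>r x i. of_real r * x i" by (rule l2_scale)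
lift_definition norm_ell2 :: "'a ell2 \<Rightarrow> real" is l2_norm .

definition dist_ell2 :: "'a ell2 \<Rightarrow> 'a ell2 \<Rightarrow> real" where "dist_ell2 x y = norm (x - y)"
definition sgn_ell2 :: "'a ell2 \<Rightarrow> 'a ell2" where "sgn_ell2 x = inverse (norm x) *\<^sub>R x"
definition "(uniformity :: ('a ell2 \<times> 'a ell2) filter) = (INF e\<in>{0<..}. principal {(x, y). dist x y < e})"
definition open_ell2 :: "'a ell2 set \<Rightarrow> bool" where
  "open_ell2 S = (\<forall>x\<in>S. \<forall>\<^sub>F (x', y) in uniformity. x' = x \<longrightarrow> y \<in> S)"

instance
proof
  fix x y z :: "'a ell2" and a b :: real
  show "x + y + z = x + (y + z)" by transfer (simp add: algebra_simps)
  show "x + y = y + x" by transfer (simp add: algebra_simps)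
  show "0 + x = x" by transfer simp
  show "- x + x = 0" by transfer simp
  show "x - y = x + - y" by transfer simp
  show "a *\<^sub>R (x + y) = a *\<^sub>R x + a *\<^sub>R y" by transfer (simp add: algebra_simps)
  show "(a + b) *\<^sub>R x = a *\<^sub>R x + b *\<^sub>R x" by transfer (simp add: algebra_simps)
  show "a *\<^sub>R b *\<^sub>R x = (a * b) *\<^sub>R x" by transfer (simp add: algebra_simps)
  show "1 *\<^sub>R x = x" by transfer simp
  show "dist x y = norm (x - y)" by (rule dist_ell2_def)
  show "sgn x = inverse (norm x) *\<^sub>R x" by (rule sgn_ell2_def)
  show "(uniformity :: ('a ell2 \<times> 'a ell2) filter) = (INF e\<in>{0<..}. principal {(x, y). dist x y < e})"
    by (rule uniformity_ell2_def)
  show "open U = (\<forall>x\<in>U. \<forall>\<^sub>F (x', y) in uniformity. x' = x \<longrightarrow> y \<in> U)" for U :: "'a ell2 set"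
    by (rule open_ell2_def)
  show "norm x = 0 \<longleftrightarrow> x = 0" by transfer (rule l2_norm_eq_0)
  show "norm (x + y) \<le> norm x + norm y" by transfer (rule l2_add)
  show "norm (a *\<^sub>R x) = \<bar>a\<bar> * norm x" by transfer (simp add: l2_norm_scale)
qed

end

instance ell2 :: (type) banach
proof
  fix X :: "nat \<Rightarrow> 'a ell2"
  assume X: "Cauchy X"
  have coord: "cmod (Rep_ell2 x i) \<le> norm x" for x :: "'a ell2" and i
    by transfer (rule l2_coord_le)
  have "Cauchy (\<lambda>n. Rep_ell2 (X n) i)" for i
  proof (rule CauchyI)
    fix e :: real assume "0 < e"
    then obtain M where "\<forall>m\<ge>M. \<forall>n\<ge>M. norm (X m - X n) < e" 
      using CauchyD[OF X \<open>0 < e\<close>] by auto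
    moreover have "norm (Rep_ell2 (X m) i - Rep_ell2 (X n) i) \<le> norm (X m - X n)" for m n
      using coord[of "X m - X n" i] by (simp add: minus_ell2.rep_eq)
    ultimately show "\<exists>M. \<forall>m\<ge>M. \<forall>n\<ge>M. norm (Rep_ell2 (X m) i - Rep_ell2 (X n) i) < e"
      by (meson le_less_trans)
  qed
  then have "\<exists>l. (\<lambda>n. Rep_ell2 (X n) i) \<longlonglongrightarrow> l" for i
    using Cauchy_convergent convergent_def by blast
  then obtain y where y: "\<And>i. (\<lambda>n. Rep_ell2 (X n) i) \<longlonglongrightarrow> y i" by metis
  have bnd: "l2_summable (\<lambda>i. Rep_ell2 (X m) i - y i) \<and> l2_norm (\<lambda>i. Rep_ell2 (X m) i - y i) \<le> e"
    if M: "\<forall>m\<ge>M. \<forall>n\<ge>M. norm (X m - X n) < e" and m: "m \<ge> M" for M m e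
  proof -
    have "L2_set (\<lambda>i. cmod (Rep_ell2 (X m) i - y i)) F \<le> e" if F: "finite F" for F
    proof (rule LIMSEQ_le_const2)
      show "(\<lambda>n. L2_set (\<lambda>i. cmod (Rep_ell2 (X m) i - Rep_ell2 (X n) i)) F)
              \<longlonglongrightarrow> L2_set (\<lambda>i. cmod (Rep_ell2 (X m) i - y i)) F"
        unfolding L2_set_def by (intro tendsto_intros y)
      have "L2_set (\<lambda>i. cmod (Rep_ell2 (X m) i - Rep_ell2 (X n) i)) F \<le> norm (X m - X n)" for n
      proof -
        have "L2_set (\<lambda>i. cmod (Rep_ell2 (X m - X n) i)) F \<le> norm (X m - X n)"
          using F Rep_ell2[of "X m - X n"] by (simp add: norm_ell2.rep_eq l2_finite_le)
        then show ?thesis by (simp add: minus_ell2.rep_eq)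
      qed
      then show "\<exists>N. \<forall>n\<ge>N. L2_set (\<lambda>i. cmod (Rep_ell2 (X m) i - Rep_ell2 (X n) i)) F \<le> e"
        using M m by (meson less_imp_le order_trans)
    qed
    then show ?thesis by (auto intro!: l2_boundI)
  qed
  obtain M1 where M1: "\<forall>m\<ge>M1. \<forall>n\<ge>M1. norm (X m - X n) < 1" 
    using CauchyD[OF X, of 1] by auto
  have y2: "l2_summable y"
    using l2_diff[of "Rep_ell2 (X M1)" "\<lambda>i. Rep_ell2 (X M1) i - y i"]
      bnd[OF M1 order_refl] Rep_ell2[of "X M1"] by simp
  have "X \<longlonglongrightarrow> Abs_ell2 y"
  proof (rule LIMSEQ_I)
    fix e :: real assume "0 < e"
    then obtain M where M: "\<forall>m\<ge>M. \<forall>n\<ge>M. norm (X m - X n) < e / 2"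
      using CauchyD[OF X, of "e / 2"] \<open>0 < e\<close> by auto
    have "norm (X m - Abs_ell2 y) < e" if "m \<ge> M" for m
      using bnd[OF M that] \<open>0 < e\<close> y2
      by (simp add: norm_ell2.rep_eq minus_ell2.rep_eq Abs_ell2_inverse)
    then show "\<exists>no. \<forall>n\<ge>no. norm (X n - Abs_ell2 y) < e" by blast
  qed
  then show "convergent X" by (auto simp: convergent_def)
qed

lift_definition scaleC_ell2 :: "complex \<Rightarrow> 'a ell2 \<Rightarrow> 'a ell2" is "\<lambda>c x i. c * x i"
  by (rule l2_scale)

lift_definition cinner_ell2 :: "'a ell2 \<Rightarrow> 'a ell2 \<Rightarrow> complex" is
  "\<lambda>x y. \<Sum>\<^sub>\<infinity>i. cnj (x i) * y i" .

lift_definition unit_ell2 :: "'a \<Rightarrow> 'a ell2" is "\<lambda>j i. if i = j then 1 else 0"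
proof -
  fix j :: 'a
  have "L2_set (\<lambda>i. cmod (if i = j then 1 else 0)) F \<le> 1" if "finite F" for F
    unfolding L2_set_def using that
    by (simp add: if_distrib[of cmod] if_distrib[of "\<lambda>x. x\<^sup>2"] sum.delta cong: if_cong)
  then show "l2_summable (\<lambda>i. if i = j then 1 else 0)" by (rule l2_boundI)
qed


section \<open>The Banach algebra of bounded operators\<close>

text \<open>\<^typ>\<open>'a ell2 \<Rightarrow>\<^sub>L 'a ell2\<close> consists of the real-linear maps, hence the typedef.\<close>

typedef 'a bop = "{f :: 'a ell2 \<Rightarrow>\<^sub>L 'a ell2. \<forall>c x. f (scaleC_ell2 c x) = scaleC_ell2 c (f x)}"
  by (rule exI[of _ id_blinfun]) simp

setup_lifting type_definition_bop

definition bop_apply :: "'a bop \<Rightarrow> 'a ell2 \<Rightarrow> 'a ell2" where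
  "bop_apply A = blinfun_apply (Rep_bop A)"

instantiation bop :: (type) real_normed_algebra_1
begin

lift_definition zero_bop :: "'a bop" is 0
  by (simp, transfer, simp)
lift_definition one_bop :: "'a bop" is id_blinfun by simp
lift_definition plus_bop :: "'a bop \<Rightarrow> 'a bop \<Rightarrow> 'a bop" is "(+)"
  by (simp add: plus_blinfun.rep_eq, transfer, simp add: algebra_simps)
lift_definition uminus_bop :: "'a bop \<Rightarrow> 'a bop" is uminus
  by (simp add: uminus_blinfun.rep_eq, transfer, simp)
lift_definition minus_bop :: "'a bop \<Rightarrow> 'a bop \<Rightarrow> 'a bop" is "(-)"
  by (simp add: minus_blinfun.rep_eq, transfer, simp add: algebra_simps)
lift_definition times_bop :: "'a bop \<Rightarrow> 'a bop \<Rightarrow> 'a bop" is "(o\<^sub>L)" by simp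
lift_definition scaleR_bop :: "real \<Rightarrow> 'a bop \<Rightarrow> 'a bop" is "(*\<^sub>R)"
  by (simp add: scaleR_blinfun.rep_eq, transfer, simp add: algebra_simps)
lift_definition norm_bop :: "'a bop \<Rightarrow> real" is norm .

definition dist_bop :: "'a bop \<Rightarrow> 'a bop \<Rightarrow> real" where "dist_bop x y = norm (x - y)"
definition sgn_bop :: "'a bop \<Rightarrow> 'a bop" where "sgn_bop x = inverse (norm x) *\<^sub>R x"
definition "(uniformity :: ('a bop \<times> 'a bop) filter) = (INF e\<in>{0<..}. principal {(x, y). dist x y < e})"
definition open_bop :: "'a bop set \<Rightarrow> bool" where
  "open_bop S = (\<forall>x\<in>S. \<forall>\<^sub>F (x', y) in uniformity. x' = x \<longrightarrow> y \<in> S)"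

instance
proof
  fix x y z :: "'a bop" and a b :: real
  show "x + y + z = x + (y + z)" by transfer (simp add: algebra_simps)
  show "x + y = y + x" by transfer (simp add: algebra_simps)
  show "0 + x = x" by transfer simp
  show "- x + x = 0" by transfer simp
  show "x - y = x + - y" by transfer simp
  show "a *\<^sub>R (x + y) = a *\<^sub>R x + a *\<^sub>R y" by transfer (simp add: algebra_simps)
  show "(a + b) *\<^sub>R x = a *\<^sub>R x + b *\<^sub>R x" by transfer (simp add: algebra_simps)
  show "a *\<^sub>R b *\<^sub>R x = (a * b) *\<^sub>R x" by transfer (simp add: algebra_simps)
  show "1 *\<^sub>R x = x" by transfer simp
  show "x * y * z = x * (y * z)" by transfer (rule blinfun_eqI, simp)
  show "(x + y) * z = x * z + y * z"
    by transfer (rule blinfun_eqI, simp add: plus_blinfun.rep_eq)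
  show "x * (y + z) = x * y + x * z"
    by transfer (rule blinfun_eqI, simp add: plus_blinfun.rep_eq blinfun.add_right)
  show "1 * x = x" by transfer (rule blinfun_eqI, simp)
  show "x * 1 = x" by transfer (rule blinfun_eqI, simp)
  show "a *\<^sub>R x * y = a *\<^sub>R (x * y)"
    by transfer (rule blinfun_eqI, simp add: scaleR_blinfun.rep_eq)
  show "x * a *\<^sub>R y = a *\<^sub>R (x * y)"
    by transfer (rule blinfun_eqI, simp add: scaleR_blinfun.rep_eq blinfun.scaleR_right)
  show "dist x y = norm (x - y)" by (rule dist_bop_def)
  show "sgn x = inverse (norm x) *\<^sub>R x" by (rule sgn_bop_def)
  show "(uniformity :: ('a bop \<times> 'a bop) filter) = (INF e\<in>{0<..}. principal {(x, y). dist x y < e})"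
    by (rule uniformity_bop_def)
  show "open U = (\<forall>x\<in>U. \<forall>\<^sub>F (x', y) in uniformity. x' = x \<longrightarrow> y \<in> U)" for U :: "'a bop set"
    by (rule open_bop_def)
  show "norm x = 0 \<longleftrightarrow> x = 0" by transfer simp
  show "norm (x + y) \<le> norm x + norm y" by transfer (rule norm_triangle_ineq)
  show "norm (a *\<^sub>R x) = \<bar>a\<bar> * norm x" by transfer simp
  show "norm (x * y) \<le> norm x * norm y" by transfer (rule norm_blinfun_compose)
  obtain j :: 'a where True by simp
  have "Rep_ell2 (unit_ell2 j) j \<noteq> Rep_ell2 0 j"
    by (simp add: unit_ell2.rep_eq zero_ell2.rep_eq)
  then have "unit_ell2 j \<noteq> 0" by metis
  moreover have "norm (unit_ell2 j) \<le> norm (id_blinfun :: 'a ell2 \<Rightarrow>\<^sub>L 'a ell2) * norm (unit_ell2 j)"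
    using norm_blinfun[of id_blinfun "unit_ell2 j"] by simp
  ultimately have "1 \<le> norm (id_blinfun :: 'a ell2 \<Rightarrow>\<^sub>L 'a ell2)"
    using mult_right_le_imp_le[of 1 "norm (unit_ell2 j)"] by simp
  with norm_blinfun_id_le have one: "norm (id_blinfun :: 'a ell2 \<Rightarrow>\<^sub>L 'a ell2) = 1"
    by (rule antisym)
  then show "norm (1 :: 'a bop) = 1" by transfer
  from one show "(0 :: 'a bop) \<noteq> 1" by transfer auto
qed

end

instance bop :: (type) banach
proof
  fix X :: "nat \<Rightarrow> 'a bop"
  assume X: "Cauchy X"
  have "Cauchy (\<lambda>n. Rep_bop (X n))"
    using X unfolding Cauchy_iff by (simp add: norm_bop.rep_eq minus_bop.rep_eq)
  then obtain L where L: "(\<lambda>n. Rep_bop (X n)) \<longlonglongrightarrow> L"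
    using Cauchy_convergent convergent_def by blast
  have "L (scaleC_ell2 c x) = scaleC_ell2 c (L x)" for c x
  proof -
    have bl: "bounded_linear (scaleC_ell2 c :: 'a ell2 \<Rightarrow> 'a ell2)"
    proof (rule bounded_linear_intro)
      show "scaleC_ell2 c (u + v) = scaleC_ell2 c u + scaleC_ell2 c v" for u v :: "'a ell2"
        by transfer (simp add: algebra_simps)
      show "scaleC_ell2 c (r *\<^sub>R u) = r *\<^sub>R scaleC_ell2 c u" for r and u :: "'a ell2"
        by transfer (simp add: algebra_simps)
      show "norm (scaleC_ell2 c u) \<le> norm u * cmod c" for u :: "'a ell2"
        by transfer (simp add: l2_norm_scale)
    qed
    have l: "(\<lambda>n. Rep_bop (X n) v) \<longlonglongrightarrow> L v" for v
      by (intro blinfun.tendsto L tendsto_const)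
    have "(\<lambda>n. scaleC_ell2 c (Rep_bop (X n) x)) \<longlonglongrightarrow> scaleC_ell2 c (L x)"
      by (intro bounded_linear.tendsto[OF bl] l)
    then have "(\<lambda>n. Rep_bop (X n) (scaleC_ell2 c x)) \<longlonglongrightarrow> scaleC_ell2 c (L x)"
      by (simp add: Rep_bop[simplified])
    with l show ?thesis using LIMSEQ_unique by blast
  qed
  then have "Rep_bop (Abs_bop L) = L" by (simp add: Abs_bop_inverse)
  with L have "X \<longlonglongrightarrow> Abs_bop L"
    unfolding LIMSEQ_iff by (simp add: norm_bop.rep_eq minus_bop.rep_eq)
  then show "convergent X" by (auto simp: convergent_def)
qed

definition bop_inverse :: "'a bop \<Rightarrow> 'a bop" where
  "bop_inverse A = (THE B. A * B = 1 \<and> B * A = 1)"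

definition entry :: "'a bop \<Rightarrow> 'a \<Rightarrow> 'a \<Rightarrow> complex" where
  "entry A i j = Rep_ell2 (bop_apply A (unit_ell2 j)) i"

definition diagonal :: "int \<Rightarrow> int bop \<Rightarrow> int \<Rightarrow> complex" where
  "diagonal k A j = entry A j (j - k)"

lift_definition shift_ell2 :: "int \<Rightarrow> int ell2 \<Rightarrow> int ell2" is "\<lambda>n x k. x (k - n)"
  by (rule l2_comp_inj) (auto simp: inj_def)

lemma bounded_linear_shift: "bounded_linear (shift_ell2 n)"
proof (rule bounded_linear_intro[where K = 1])
  fix r and x y :: "int ell2"
  show "shift_ell2 n (x + y) = shift_ell2 n x + shift_ell2 n y" by transfer simp
  show "shift_ell2 n (r *\<^sub>R x) = r *\<^sub>R shift_ell2 n x" by transfer simp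
  show "norm (shift_ell2 n x) \<le> norm x * 1"
    by (simp, transfer, rule l2_comp_inj) (auto simp: inj_def)
qed

definition shift_blinfun :: "int \<Rightarrow> int ell2 \<Rightarrow>\<^sub>L int ell2" where
  "shift_blinfun n = Blinfun (shift_ell2 n)"

lemma shift_blinfun_apply [simp]: "blinfun_apply (shift_blinfun n) = shift_ell2 n"
  by (simp add: shift_blinfun_def bounded_linear_Blinfun_apply bounded_linear_shift)

lift_definition shift_op :: "int \<Rightarrow> int bop" is shift_blinfun
  by (simp add: shift_blinfun_apply, transfer, simp)

text \<open>Multiplication by an unbounded sequence is not an operator and is set to zero.\<close>

lift_definition mult_ell2 :: "('a \<Rightarrow> complex) \<Rightarrow> 'a ell2 \<Rightarrow> 'a ell2" is
  "\<lambda>b x k. if bounded (range b) then b k * x k else 0"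
proof -
  fix b x :: "'a \<Rightarrow> complex"
  assume "l2_summable x"
  then show "l2_summable (\<lambda>k. if bounded (range b) then b k * x k else 0)"
  proof (cases "bounded (range b)")
    case True
    then obtain B where "\<And>i. cmod (b i) \<le> B" by (auto simp: bounded_iff)
    then have "l2_summable (\<lambda>k. b k * x k)" by (rule l2_mult_bounded(1)[OF \<open>l2_summable x\<close>])
    with True show ?thesis by (simp only: if_True)
  qed (simp only: if_False l2_zero)
qed

lemma bounded_linear_mult: "bounded_linear (mult_ell2 b)"
proof -
  obtain B where B: "0 \<le> B" "bounded (range b) \<Longrightarrow> \<forall>i. cmod (b i) \<le> B"
  proof (cases "bounded (range b)")
    case True
    then obtain B where B: "\<forall>i. cmod (b i) \<le> B" by (auto simp: bounded_iff)
    then have "0 \<le> B" using norm_ge_zero order_trans by blast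
    with B show ?thesis using that by blast
  qed (use that[of 0] in auto)
  show ?thesis
  proof (rule bounded_linear_intro[where K = B])
    fix r and x y :: "'a ell2"
    show "mult_ell2 b (x + y) = mult_ell2 b x + mult_ell2 b y"
      by transfer (auto simp: algebra_simps)
    show "mult_ell2 b (r *\<^sub>R x) = r *\<^sub>R mult_ell2 b x"
      by transfer (auto simp: algebra_simps)
    show "norm (mult_ell2 b x) \<le> norm x * B"
      using B
    proof transfer
      fix B :: real and b x :: "'a \<Rightarrow> complex"
      assume "l2_summable x" "0 \<le> B" "bounded (range b) \<Longrightarrow> \<forall>i. cmod (b i) \<le> B"
      then show "l2_norm (\<lambda>k. if bounded (range b) then b k * x k else 0) \<le> l2_norm x * B"
        using l2_mult_bounded(2)[of x b B] l2_norm_nonneg[of x]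
        by (cases "bounded (range b)") (auto simp: l2_zero mult.commute)
    qed
  qed
qed

definition mult_blinfun :: "('a \<Rightarrow> complex) \<Rightarrow> 'a ell2 \<Rightarrow>\<^sub>L 'a ell2" where
  "mult_blinfun b = Blinfun (mult_ell2 b)"

lemma mult_blinfun_apply [simp]: "blinfun_apply (mult_blinfun b) = mult_ell2 b"
  by (simp add: mult_blinfun_def bounded_linear_Blinfun_apply bounded_linear_mult)

lift_definition mult_op :: "('a \<Rightarrow> complex) \<Rightarrow> 'a bop" is mult_blinfun
  by (simp only: mult_blinfun_apply, transfer, rule ext, simp add: mult.left_commute)


section \<open>Compression to the half-line and finite sections\<close>

lift_definition restrict_ell2 :: "int ell2 \<Rightarrow> nat ell2" is "\<lambda>x k. x (int k)"
  by (rule l2_comp_inj) auto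

lift_definition extend_ell2 :: "nat ell2 \<Rightarrow> int ell2" is
  "\<lambda>x k. if k \<ge> 0 then x (nat k) else 0"
  by (rule l2_extend)

lemma bounded_linear_restrict: "bounded_linear restrict_ell2"
proof (rule bounded_linear_intro[where K = 1])
  fix r and x y :: "int ell2"
  show "restrict_ell2 (x + y) = restrict_ell2 x + restrict_ell2 y" by transfer simp
  show "restrict_ell2 (r *\<^sub>R x) = r *\<^sub>R restrict_ell2 x" by transfer simp
  show "norm (restrict_ell2 x) \<le> norm x * 1"
    by (simp, transfer, rule l2_comp_inj) auto
qed

definition restrict_blinfun :: "int ell2 \<Rightarrow>\<^sub>L nat ell2" where
  "restrict_blinfun = Blinfun restrict_ell2"

lemma restrict_blinfun_apply [simp]: "blinfun_apply (restrict_blinfun) = restrict_ell2"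
  by (simp add: restrict_blinfun_def bounded_linear_Blinfun_apply bounded_linear_restrict)

lemma bounded_linear_extend: "bounded_linear extend_ell2"
proof (rule bounded_linear_intro[where K = 1])
  fix r and x y :: "nat ell2"
  show "extend_ell2 (x + y) = extend_ell2 x + extend_ell2 y" by transfer auto
  show "extend_ell2 (r *\<^sub>R x) = r *\<^sub>R extend_ell2 x" by transfer auto
  show "norm (extend_ell2 x) \<le> norm x * 1"
    by (simp, transfer, rule l2_extend)
qed

definition extend_blinfun :: "nat ell2 \<Rightarrow>\<^sub>L int ell2" where
  "extend_blinfun = Blinfun extend_ell2"

lemma extend_blinfun_apply [simp]: "blinfun_apply (extend_blinfun) = extend_ell2"
  by (simp add: extend_blinfun_def bounded_linear_Blinfun_apply bounded_linear_extend)

lift_definition compression :: "int bop \<Rightarrow> nat bop" is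
  "\<lambda>A. restrict_blinfun o\<^sub>L A o\<^sub>L extend_blinfun"
proof -
  fix A :: "int ell2 \<Rightarrow>\<^sub>L int ell2"
  assume A: "\<And>c x. A (scaleC_ell2 c x) = scaleC_ell2 c (A x)"
  have "extend_ell2 (scaleC_ell2 c x) = scaleC_ell2 c (extend_ell2 x)" for c x
    by transfer auto
  moreover have "restrict_ell2 (scaleC_ell2 c x) = scaleC_ell2 c (restrict_ell2 x)" for c x
    by transfer simp
  ultimately show "(restrict_blinfun o\<^sub>L A o\<^sub>L extend_blinfun) (scaleC_ell2 c x) =
      scaleC_ell2 c ((restrict_blinfun o\<^sub>L A o\<^sub>L extend_blinfun) x)" for c x
    using A by (simp add: extend_blinfun_apply restrict_blinfun_apply)
qed

text \<open>The matrix of the compression to the coordinates \<^term>\<open>n1 \<le> k\<close>, \<^term>\<open>k < n2\<close>.\<close>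

definition finite_section :: "int \<Rightarrow> int \<Rightarrow> int bop \<Rightarrow> complex mat" where
  "finite_section n1 n2 A =
     mat (nat (n2 - n1)) (nat (n2 - n1)) (\<lambda>(i, j). entry A (n1 + int i) (n1 + int j))"


section \<open>Fredholm determinants\<close>

text \<open>
  An operator is trace class if it is a sum of operators of rank one with summable norms.
\<close>

definition trace_class :: "'a bop \<Rightarrow> bool" where
  "trace_class K \<longleftrightarrow> (\<exists>x y :: nat \<Rightarrow> 'a ell2.
     summable (\<lambda>n. norm (x n) * norm (y n)) \<and>
     (\<forall>z. (\<lambda>n. scaleC_ell2 (cinner_ell2 (y n) z) (x n)) sums bop_apply K z))"

definition principal_minor :: "'a bop \<Rightarrow> 'a set \<Rightarrow> complex" where
  "principal_minor K S = (\<Sum>p | p permutes S. of_int (sign p) * (\<Prod>i\<in>S. entry K i (p i)))"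

text \<open>
  For trace class \<^term>\<open>K\<close>, the determinant of \<^term>\<open>1 + K\<close> is the sum of the traces of the
  exterior powers of \<^term>\<open>K\<close>. With respect to the standard basis, the trace of the \<^term>\<open>n\<close>-th
  exterior power is the sum of the principal minors of order \<^term>\<open>n\<close>; the double sum converges
  absolutely. The determinant of an operator that is not identity plus trace class is
  not meaningful and is set to zero.
\<close>

definition fredholm_det :: "'a bop \<Rightarrow> complex" where
  "fredholm_det B =
     (if trace_class (B - 1) then \<Sum>\<^sub>\<infinity>S\<in>{S. finite S}. principal_minor (B - 1) S else 0)"


section \<open>Operators with almost periodic diagonals\<close>

definition alpha_weight :: "real \<Rightarrow> real \<Rightarrow> int \<Rightarrow> real" where
  "alpha_weight \<alpha>1 \<alpha>2 k = (if 0 \<le> k then (1 + real_of_int k) powr \<alpha>1 else (1 + \<bar>real_of_int k\<bar>) powr \<alpha>2)"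

definition wiener_APW :: "real \<Rightarrow> real \<Rightarrow> rmodz set \<Rightarrow> (rmodz \<Rightarrow> real) \<Rightarrow> int bop set" where
  "wiener_APW \<alpha>1 \<alpha>2 \<Xi> \<beta> = {A. (\<forall>k. diagonal k A \<in> APW \<Xi> \<beta>) \<and>
     (\<lambda>k. alpha_weight \<alpha>1 \<alpha>2 k * apw_norm \<Xi> \<beta> (diagonal k A)) summable_on UNIV}"

text \<open>The sums are unconditional sums in operator norm.\<close>

definition U_tau ::
  "rmodz set \<Rightarrow> (rmodz \<Rightarrow> real) \<Rightarrow> (rmodz \<Rightarrow> complex) \<Rightarrow> int bop \<Rightarrow> int bop" where
  "U_tau \<Xi> \<beta> \<tau> A = (\<Sum>\<^sub>\<infinity>n. \<Sum>\<^sub>\<infinity>\<xi>\<in>\<Xi>.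
     mult_op (\<lambda>k. apw_coeff \<Xi> \<beta> (diagonal n A) \<xi> * \<tau> \<xi> * echar \<xi> k) * shift_op n)"

text \<open>
  The functions \<open>\<Theta>\<close> depend on the list of exponents and not only on the product of their
  exponentials. Note that \<^term>\<open>echar \<xi> 1\<close> is \<open>e\<^sup>2\<^sup>\<pi>\<^sup>i\<^sup>\<xi>\<close>.
\<close>

definition exp_prod :: "'b list \<Rightarrow> 'b::{real_normed_algebra_1, banach}" where
  "exp_prod As = prod_list (map exp As)"

definition Theta1 ::
  "rmodz set \<Rightarrow> (rmodz \<Rightarrow> real) \<Rightarrow> int bop list \<Rightarrow> (rmodz \<Rightarrow> complex) \<Rightarrow> complex" where
  "Theta1 \<Xi> \<beta> As \<tau> =
     exp (\<Sum>\<^sub>\<infinity>\<xi>\<in>\<Xi> - {0}. apw_coeff \<Xi> \<beta> (diagonal 0 (sum_list As)) \<xi> * (\<tau> \<xi> / (1 - echar \<xi> 1))) *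
     fredholm_det (compression (U_tau \<Xi> \<beta> \<tau> (exp_prod As)) *
       exp_prod (map (\<lambda>B. - compression (U_tau \<Xi> \<beta> \<tau> B)) (rev As)))"

definition Theta2 ::
  "rmodz set \<Rightarrow> (rmodz \<Rightarrow> real) \<Rightarrow> int bop list \<Rightarrow> (rmodz \<Rightarrow> complex) \<Rightarrow> complex" where
  "Theta2 \<Xi> \<beta> As \<tau> =
     exp (\<Sum>\<^sub>\<infinity>\<xi>\<in>\<Xi> - {0}. apw_coeff \<Xi> \<beta> (diagonal 0 (sum_list As)) \<xi> * (- \<tau> \<xi> / (1 - echar \<xi> 1))) *
     fredholm_det (exp_prod (map (\<lambda>B. compression (U_tau \<Xi> \<beta> \<tau> B)) As) *
       compression (U_tau \<Xi> \<beta> \<tau> (bop_inverse (exp_prod As))))"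

end

theory Submission
  imports Defs "HOL-Analysis.Infinite_Set_Sum"
begin

text \<open>
  Instead of trace norms we control operators by their matrix entries. An operator in the algebra
  has entries dominated by a Laurent matrix \<open>\<mu> (i - j)\<close> with \<open>\<mu>\<close> summable against the weight \<open>\<alpha>\<close>. Since
  \<open>min m n \<le> m\<^sup>\<alpha>\<^sup>1 n\<^sup>\<alpha>\<^sup>2\<close>, the difference of \<open>T(AB)\<close> and \<open>T(A)T(B)\<close> has absolutely summable entries, and the
  same holds for \<open>1 - T(A) e^{-T(A_r)} \<dots> e^{-T(A_1)}\<close>. For kernels with summable entries the
  principal minor expansion of the determinant is bounded by products of row sums, so it obeys dominated
  convergence.

  On a finite interval \<open>J\<close> the determinant of the section of \<open>A\<close> is the determinant of
  \<open>T_J(A) e^{-T_J(A_r)} \<dots> e^{-T_J(A_1)}\<close> times the exponential of a trace. The trace is a geometric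
  sum in every character and yields the exponential factors. The remaining kernel is concentrated near
  the two ends of \<open>J\<close>; translated to an end point it converges entrywise, because the translates of \<open>A\<close>
  along a fractal sequence converge to \<open>U\<^sup>\<tau> A\<close>. So its determinant converges to the product of a determinant
  on the right half-line and one on the left half-line. The latter is turned into the determinant in
  \<open>\<Theta>\<^sub>2\<close> by Jacobi's identity for complementary minors, which is proved for finite truncations and carried
  over by dominated convergence.
\<close>

section \<open>Unordered sums in the extended nonnegative reals\<close>

text \<open>The determinants are defined through principal minors in the standard basis, so absolute
  summability of the entries suffices both for being trace class and for computing with them. The
  obstacle is uniformity: the sections live on growing intervals, and dominated convergence needs
  one summable bound for all of them, written in coordinates relative to the two ends. Hence every
  estimate is made for a whole indexed family with a common bound, and it must survive products,
  nonnegative scalings and series in order to reach exponentials. The same closure argument serves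
  convergence, error kernels and coefficients, and is isolated in \<open>gauge\<close>. The ratio is
  chosen because without compression it telescopes to the identity, so that its defect consists of
  corrections localised at the ends. The minimum counts the points from which a step of length m and
  a step of length n in the same direction both cross an end point. Jacobi's identity is needed
  since the right end of an interval yields an operator on the left half-line, while both
  determinants of the theorem live on the right half-line.\<close>

definition esum :: "('a \<Rightarrow> ennreal) \<Rightarrow> ennreal" where
  "esum f = (\<integral>\<^sup>+x. f x \<partial>count_space UNIV)"

lemma esum_mono: "(\<And>x. f x \<le> g x) \<Longrightarrow> esum f \<le> esum g"
  unfolding esum_def by (rule nn_integral_mono) auto

lemma esum_add: "esum (\<lambda>x. f x + g x) = esum f + esum g"
  unfolding esum_def by (rule nn_integral_add) auto

lemma esum_zero [simp]: "esum (\<lambda>x. 0) = 0"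
  by (simp add: esum_def)

lemma esum_cmult: "esum (\<lambda>x. c * f x) = c * esum f"
  unfolding esum_def by (rule nn_integral_cmult) auto

lemma esum_multc: "esum (\<lambda>x. f x * c) = esum f * c"
  unfolding esum_def by (rule nn_integral_multc) auto

lemma esum_sum: "esum (\<lambda>x. \<Sum>e\<in>E. f e x) = (\<Sum>e\<in>E. esum (f e))"
  unfolding esum_def by (rule nn_integral_sum) auto

text \<open>Tonelli's theorem for counting measure holds without any summability hypothesis. This is
  why bounds are kept in \<open>ennreal\<close> and finiteness is checked only at the end.\<close>

lemma esum_swap: "esum (\<lambda>x. esum (\<lambda>y. f x y)) = esum (\<lambda>y. esum (\<lambda>x. f x y))"
  unfolding esum_def
  using nn_integral_fst_count_space[of "\<lambda>(x, y). f x y"] nn_integral_snd_count_space[of "\<lambda>(x, y). f x y"]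
  by simp

lemma esum_prod: "esum (\<lambda>x. esum (\<lambda>y. f x y)) = esum (\<lambda>(x, y). f x y)"
  unfolding esum_def
  using nn_integral_fst_count_space[of "\<lambda>(x, y). f x y"] by simp

lemma esum_ge_point: "f x \<le> esum f"
  unfolding esum_def by (rule nn_integral_ge_point) auto

lemma esum_bij: "bij g \<Longrightarrow> esum (\<lambda>x. f (g x)) = esum f"
  unfolding esum_def by (rule nn_integral_bij_count_space)

lemma esum_minus_right: "esum (\<lambda>x. f (x - a)) = esum (f :: 'a::ab_group_add \<Rightarrow> ennreal)"
  by (rule esum_bij) (rule bij_betw_byWitness[where f' = "\<lambda>x. x + a"], auto)

lemma esum_minus_left: "esum (\<lambda>x. f (a - x)) = esum (f :: 'a::ab_group_add \<Rightarrow> ennreal)"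
  by (rule esum_bij) (rule bij_betw_byWitness[where f' = "\<lambda>x. a - x"], auto)

lemma esum_suminf: "esum (\<lambda>x. \<Sum>k. f k x) = (\<Sum>k. esum (f k))"
  unfolding esum_def by (rule nn_integral_suminf) auto

lemma esum_finite_support:
  "finite F \<Longrightarrow> (\<And>x. x \<notin> F \<Longrightarrow> f x = 0) \<Longrightarrow> esum f = sum f F"
  unfolding esum_def by (rule nn_integral_count_space') auto

lemma esum_delta: "esum (\<lambda>x. if x = a then c else 0) = c"
  by (subst esum_finite_support[of "{a}"]) auto

lemma sum_le_esum:
  assumes "finite F" shows "sum f F \<le> esum f"
proof -
  have "sum f F = esum (\<lambda>x. if x \<in> F then f x else 0)"
    by (subst esum_finite_support[of F]) (use assms in auto)
  also have "\<dots> \<le> esum f" by (rule esum_mono) auto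
  finally show ?thesis .
qed

lemma esum_inj_le:
  assumes "inj g" shows "esum (\<lambda>x. f (g x)) \<le> esum f"
proof -
  have "esum (\<lambda>x. f (g x)) = (\<integral>\<^sup>+x. f x \<partial>count_space (range g))"
    unfolding esum_def by (rule nn_integral_bij_count_space) (use assms in \<open>auto simp: bij_betw_def\<close>)
  also have "\<dots> = (\<integral>\<^sup>+x. f x * indicator (range g) x \<partial>count_space UNIV)"
    by (subst nn_integral_restrict_space[symmetric]) (auto simp: restrict_count_space)
  also have "\<dots> \<le> esum f" unfolding esum_def by (rule nn_integral_mono) (auto simp: indicator_def)
  finally show ?thesis .
qed

lemma esum_summable:
  fixes f :: "'a \<Rightarrow> 'b::banach"
  assumes "esum (\<lambda>x. ennreal (norm (f x))) < Orderings.top"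
  shows "(\<lambda>x. norm (f x)) summable_on UNIV" "f summable_on UNIV"
proof -
  define C where "C = enn2real (esum (\<lambda>x. ennreal (norm (f x))))"
  have "(\<Sum>x\<in>F. norm (f x)) \<le> C" if "finite F" for F
  proof -
    have "ennreal (\<Sum>x\<in>F. norm (f x)) \<le> ennreal C"
      unfolding C_def ennreal_enn2real[OF assms]
      using sum_le_esum[OF that, of "\<lambda>x. ennreal (norm (f x))"] by simp
    then show ?thesis by (simp add: C_def)
  qed
  then show "(\<lambda>x. norm (f x)) summable_on UNIV"
    by (intro nonneg_bdd_above_summable_on) (auto intro!: bdd_aboveI)
  then show "f summable_on UNIV" by (rule abs_summable_summable)
qed

lemma esum_infsum_norm_le:
  fixes f :: "'a \<Rightarrow> 'b::banach"
  shows "ennreal (norm (infsum f UNIV)) \<le> esum (\<lambda>x. ennreal (norm (f x)))"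
proof (cases "esum (\<lambda>x. ennreal (norm (f x))) < Orderings.top")
  case True
  define C where "C = enn2real (esum (\<lambda>x. ennreal (norm (f x))))"
  have "(\<Sum>x\<in>F. norm (f x)) \<le> C" if "finite F" for F
  proof -
    have "ennreal (\<Sum>x\<in>F. norm (f x)) \<le> ennreal C"
      unfolding C_def ennreal_enn2real[OF True]
      using sum_le_esum[OF that, of "\<lambda>x. ennreal (norm (f x))"] by simp
    then show ?thesis by (simp add: C_def)
  qed
  then have "infsum (\<lambda>x. norm (f x)) UNIV \<le> C"
    by (intro infsum_le_finite_sums esum_summable True)
  then have "norm (infsum f UNIV) \<le> C"
    using norm_infsum_bound[OF esum_summable(1)[OF True]] by simp
  then have "ennreal (norm (infsum f UNIV)) \<le> ennreal C" by (rule ennreal_leI)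
  also have "ennreal C = esum (\<lambda>x. ennreal (norm (f x)))"
    unfolding C_def by (rule ennreal_enn2real[OF True])
  finally show ?thesis .
next
  case False
  then show ?thesis by (simp add: less_top[symmetric])
qed

lemma esum_ennreal:
  assumes "\<And>x. 0 \<le> f x" "f summable_on UNIV"
  shows "esum (\<lambda>x. ennreal (f x)) = ennreal (infsum f UNIV)"
proof -
  have a: "Infinite_Set_Sum.abs_summable_on f UNIV"
    using assms(2) unfolding abs_summable_equivalent[symmetric]
    by (simp add: assms(1))
  show ?thesis
    unfolding esum_def using nn_integral_conv_infsetsum[OF a] assms(1) infsetsum_infsum[OF a] by simp
qed

text \<open>An absolutely convergent \<open>infsum\<close> is a Bochner integral for counting
  measure, by way of \<open>infsetsum\<close>, so dominated convergence for integrals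
  applies.\<close>

lemma infsum_dominated_convergence:
  fixes f :: "nat \<Rightarrow> 'a \<Rightarrow> complex"
  assumes lim: "\<And>x. x \<in> A \<Longrightarrow> (\<lambda>n. f n x) \<longlonglongrightarrow> g x"
    and bound: "\<And>n x. x \<in> A \<Longrightarrow> cmod (f n x) \<le> b x" and b: "b summable_on A"
  shows "(\<lambda>n. infsum (f n) A) \<longlonglongrightarrow> infsum g A" "g summable_on A" "f n summable_on A"
proof -
  have bg: "cmod (g x) \<le> b x" if "x \<in> A" for x
    using tendsto_norm[OF lim[OF that]] bound[OF that] by (intro LIMSEQ_le_const2) auto
  have b0: "0 \<le> b x" if "x \<in> A" for x using bound[OF that] norm_ge_zero order_trans by blast
  have sb: "Infinite_Set_Sum.abs_summable_on b A"
    unfolding abs_summable_equivalent[symmetric]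
    by (rule summable_on_cong[THEN iffD2, OF _ b]) (use b0 in auto)
  have sg: "Infinite_Set_Sum.abs_summable_on g A"
    by (rule abs_summable_on_comparison_test[OF sb]) (use b0 bg in auto)
  have sf: "Infinite_Set_Sum.abs_summable_on (f n) A" for n
    by (rule abs_summable_on_comparison_test[OF sb]) (use b0 bound in auto)
  show "g summable_on A" "f n summable_on A"
    using sg sf by (auto intro: abs_summable_summable simp: abs_summable_equivalent)
  have "(\<lambda>n. infsetsum (f n) A) \<longlonglongrightarrow> infsetsum g A"
    unfolding infsetsum_def
  proof (rule integral_dominated_convergence[where w = b])
    show "integrable (count_space A) b" using sb by (simp add: abs_summable_on_def)
  qed (use lim bound in \<open>auto simp: AE_count_space\<close>)
  then show "(\<lambda>n. infsum (f n) A) \<longlonglongrightarrow> infsum g A"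
    using infsetsum_infsum[OF sf] infsetsum_infsum[OF sg] by simp
qed

lemma esum_dominated_convergence:
  fixes f :: "nat \<Rightarrow> 'a \<Rightarrow> complex"
  assumes lim: "\<And>x. (\<lambda>n. f n x) \<longlonglongrightarrow> g x"
    and bound: "\<And>n x. ennreal (cmod (f n x)) \<le> b x" and b: "esum b < Orderings.top"
  shows "(\<lambda>n. infsum (f n) UNIV) \<longlonglongrightarrow> infsum g UNIV"
proof (rule infsum_dominated_convergence(1))
  have bt: "b x < Orderings.top" for x using esum_ge_point[of b x] b by (rule le_less_trans)
  show "(\<lambda>n. f n x) \<longlonglongrightarrow> g x" for x by (rule lim)
  show "cmod (f n x) \<le> enn2real (b x)" for n x
    using enn2real_mono[OF bound[of n x] bt] by simp
  have "esum (\<lambda>x. ennreal (norm (enn2real (b x)))) < Orderings.top" using bt b by simp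
  from esum_summable(1)[OF this] show "(\<lambda>x. enn2real (b x)) summable_on UNIV" by simp
qed

section \<open>Matrix entries of operators\<close>

lemma Rep_ell2_add [simp]: "Rep_ell2 (x + y) i = Rep_ell2 x i + Rep_ell2 y i"
  by (simp add: plus_ell2.rep_eq)

lemma Rep_ell2_norm_le: "cmod (Rep_ell2 x i) \<le> norm x"
  by transfer (rule l2_coord_le)

lemma bounded_linear_Rep_ell2: "bounded_linear (\<lambda>x. Rep_ell2 x i)"
proof (rule bounded_linear_intro[where K = 1])
  show "Rep_ell2 (r *\<^sub>R x) i = r *\<^sub>R Rep_ell2 x i" for r x
    by (simp add: scaleR_ell2.rep_eq scaleR_conv_of_real)
qed (auto simp: Rep_ell2_norm_le)

lemma ell2_eqI: "(\<And>i. Rep_ell2 x i = Rep_ell2 y i) \<Longrightarrow> x = y"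
  by (metis Rep_ell2_inject ext)

text \<open>The error of a finite partial sum has as squared norm a tail of the convergent sum of
  squares. Applying an operator termwise to this expansion recovers it from its matrix.\<close>

lemma ell2_has_sum_units:
  "((\<lambda>l. scaleC_ell2 (Rep_ell2 v l) (unit_ell2 l)) has_sum v) UNIV"
  unfolding has_sum_def
proof (rule tendstoI)
  fix e :: real assume e: "0 < e"
  let ?f = "\<lambda>i. (cmod (Rep_ell2 v i))\<^sup>2"
  have s: "?f summable_on UNIV" using Rep_ell2[of v] by (simp add: l2_summable_def)
  then have "(?f has_sum infsum ?f UNIV) UNIV" by simp
  then have ev: "\<forall>\<^sub>F F in finite_subsets_at_top UNIV. dist (sum ?f F) (infsum ?f UNIV) < e\<^sup>2"
    unfolding has_sum_def by (rule tendstoD) (use e in simp)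
  have fin: "\<forall>\<^sub>F F in finite_subsets_at_top (UNIV :: 'a set). finite F"
    by (rule eventually_finite_subsets_at_top_weakI)
  show "\<forall>\<^sub>F F in finite_subsets_at_top UNIV.
     dist (\<Sum>l\<in>F. scaleC_ell2 (Rep_ell2 v l) (unit_ell2 l)) v < e"
    using ev fin
  proof (eventually_elim)
    case (elim F)
    have rep: "Rep_ell2 (\<Sum>l\<in>F. scaleC_ell2 (Rep_ell2 v l) (unit_ell2 l)) i = (if i \<in> F then Rep_ell2 v i else 0)" for i
    proof -
      have "Rep_ell2 (\<Sum>l\<in>F. scaleC_ell2 (Rep_ell2 v l) (unit_ell2 l)) i
          = (\<Sum>l\<in>F. Rep_ell2 (scaleC_ell2 (Rep_ell2 v l) (unit_ell2 l)) i)"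
        by (rule linear_sum[OF bounded_linear.linear[OF bounded_linear_Rep_ell2[of i]]])
      also have "\<dots> = (\<Sum>l\<in>F. if i = l then Rep_ell2 v i else 0)"
        by (rule sum.cong) (auto simp: scaleC_ell2.rep_eq unit_ell2.rep_eq)
      finally show ?thesis using elim by simp
    qed
    define w where "w = (\<Sum>l\<in>F. scaleC_ell2 (Rep_ell2 v l) (unit_ell2 l)) - v"
    have w: "Rep_ell2 w i = (if i \<in> F then 0 else - Rep_ell2 v i)" for i
      by (simp add: w_def minus_ell2.rep_eq rep)
    have "(norm w)\<^sup>2 = (\<Sum>\<^sub>\<infinity>i. (cmod (Rep_ell2 w i))\<^sup>2)"
      by (simp add: norm_ell2.rep_eq l2_norm_def infsum_nonneg)
    also have "\<dots> = infsum ?f (- F)"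
      by (rule infsum_cong_neutral) (auto simp: w)
    also have "\<dots> = infsum ?f UNIV - sum ?f F"
      using infsum_Un_disjoint[of ?f F "- F"] elim s summable_on_subset[OF s, of "- F"] 
      by (simp add: Compl_partition)
    also have "\<dots> < e\<^sup>2" using elim by (simp add: dist_real_def)
    finally have "norm w < e" using e by (simp add: power2_less_imp_less)
    then show ?case by (simp add: dist_norm w_def)
  qed
qed

lemma bounded_linear_bop_apply: "bounded_linear (bop_apply A)"
  by (simp add: bop_apply_def blinfun.bounded_linear_right)

lemma bop_apply_scaleC: "bop_apply A (scaleC_ell2 c x) = scaleC_ell2 c (bop_apply A x)"
  unfolding bop_apply_def using Rep_bop[of A] by simp

lemma bop_apply_has_sum:
  "((\<lambda>l. entry A i l * Rep_ell2 v l) has_sum Rep_ell2 (bop_apply A v) i) UNIV"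
proof -
  have "((\<lambda>l. Rep_ell2 (bop_apply A (scaleC_ell2 (Rep_ell2 v l) (unit_ell2 l))) i)
      has_sum Rep_ell2 (bop_apply A v) i) UNIV"
    by (intro has_sum_bounded_linear[OF bounded_linear_Rep_ell2]
        has_sum_bounded_linear[OF bounded_linear_bop_apply] ell2_has_sum_units)
  then show ?thesis
    by (simp add: bop_apply_scaleC scaleC_ell2.rep_eq entry_def mult.commute)
qed

lemma bop_eqI:
  assumes "\<And>i j. entry A i j = entry B i j" shows "A = B"
proof -
  have "bop_apply A v = bop_apply B v" for v
  proof (rule ell2_eqI)
    fix i
    show "Rep_ell2 (bop_apply A v) i = Rep_ell2 (bop_apply B v) i"
      by (rule has_sum_unique[OF bop_apply_has_sum]) (use bop_apply_has_sum[of B] in \<open>simp add: assms\<close>)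
  qed
  then show ?thesis by (metis Rep_bop_inject blinfun_eqI bop_apply_def)
qed

lemma bop_apply_times: "bop_apply (A * B) v = bop_apply A (bop_apply B v)"
  by (simp add: bop_apply_def times_bop.rep_eq)

lemma entry_times_has_sum: "((\<lambda>l. entry A i l * entry B l j) has_sum entry (A * B) i j) UNIV"
  using bop_apply_has_sum[of A i "bop_apply B (unit_ell2 j)"]
  by (simp add: entry_def[of B] entry_def[of "A * B"] bop_apply_times)

lemma entry_times: "entry (A * B) i j = (\<Sum>\<^sub>\<infinity>l. entry A i l * entry B l j)"
  using entry_times_has_sum by (rule infsumI[symmetric])

lemma norm_unit_ell2 [simp]: "norm (unit_ell2 j) = 1"
proof -
  have "(\<Sum>\<^sub>\<infinity>i. (cmod (Rep_ell2 (unit_ell2 j) i))\<^sup>2) = (\<Sum>\<^sub>\<infinity>i\<in>{j}. 1 :: real)"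
    by (rule infsum_cong_neutral) (auto simp: unit_ell2.rep_eq)
  then show ?thesis by (simp add: norm_ell2.rep_eq l2_norm_def)
qed

lemma bounded_linear_entry: "bounded_linear (\<lambda>A. entry A i j)"
proof (rule bounded_linear_intro[where K = 1])
  show "entry (A + B) i j = entry A i j + entry B i j" for A B
    by (simp add: entry_def bop_apply_def plus_bop.rep_eq plus_blinfun.rep_eq)
  show "entry (r *\<^sub>R A) i j = r *\<^sub>R entry A i j" for r A
    unfolding entry_def bop_apply_def scaleR_bop.rep_eq scaleR_blinfun.rep_eq
    by (simp add: scaleR_ell2.rep_eq scaleR_conv_of_real)
  show "norm (entry A i j) \<le> norm A * 1" for A
    unfolding entry_def bop_apply_def norm_bop.rep_eq
    using order_trans[OF Rep_ell2_norm_le norm_blinfun[of "Rep_bop A" "unit_ell2 j"]] by simp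
qed

lemmas entry_add = linear_add[OF bounded_linear.linear[OF bounded_linear_entry]]
lemmas entry_diff = linear_diff[OF bounded_linear.linear[OF bounded_linear_entry]]
lemmas entry_uminus = linear_neg[OF bounded_linear.linear[OF bounded_linear_entry]]
lemmas entry_scaleR = linear_cmul[OF bounded_linear.linear[OF bounded_linear_entry]]
lemmas entry_zero = linear_0[OF bounded_linear.linear[OF bounded_linear_entry]]
lemma entry_one: "entry 1 i j = (if i = j then 1 else 0)"
  by (simp add: entry_def bop_apply_def one_bop.rep_eq unit_ell2.rep_eq)

lemma entry_mult_op: "bounded (range b) \<Longrightarrow> entry (mult_op b) i j = (if i = j then b i else 0)"
  by (simp add: entry_def bop_apply_def mult_op.rep_eq mult_ell2.rep_eq unit_ell2.rep_eq)

lemma entry_shift_op: "entry (shift_op n) i j = (if i = j + n then 1 else 0)"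
  by (auto simp: entry_def bop_apply_def shift_op.rep_eq shift_ell2.rep_eq unit_ell2.rep_eq)

lemma infsum_single:
  fixes f :: "'a \<Rightarrow> 'b::{comm_monoid_add,t2_space}"
  assumes "\<And>x. x \<noteq> a \<Longrightarrow> f x = 0" shows "infsum f UNIV = f a"
proof -
  have "infsum f UNIV = infsum f {a}" by (rule infsum_cong_neutral) (use assms in auto)
  then show ?thesis by simp
qed

lemma entry_mult_op_left:
  "bounded (range b) \<Longrightarrow> entry (mult_op b * X) i j = b i * entry X i j"
  unfolding entry_times by (subst infsum_single[of i]) (auto simp: entry_mult_op)

lemma entry_mult_op_right:
  "bounded (range b) \<Longrightarrow> entry (X * mult_op b) i j = entry X i j * b j"
  unfolding entry_times by (subst infsum_single[of j]) (auto simp: entry_mult_op)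

lemma entry_shift_left: "entry (shift_op n * X) i j = entry X (i - n) j"
  unfolding entry_times by (subst infsum_single[of "i - n"]) (auto simp: entry_shift_op)

lemma entry_shift_right: "entry (X * shift_op n) i j = entry X i (j + n)"
  unfolding entry_times by (subst infsum_single[of "j + n"]) (auto simp: entry_shift_op)

lemma entry_times_le:
  "ennreal (cmod (entry (A * B) i j)) \<le> esum (\<lambda>l. ennreal (cmod (entry A i l)) * ennreal (cmod (entry B l j)))"
  unfolding entry_times using esum_infsum_norm_le[of "\<lambda>l. entry A i l * entry B l j"]
  by (simp add: norm_mult ennreal_mult)

lemma entry_compression: "entry (compression A) i j = entry A (int i) (int j)"
proof -
  have "extend_ell2 (unit_ell2 j) = unit_ell2 (int j)"
    by (rule ell2_eqI) (auto simp: extend_ell2.rep_eq unit_ell2.rep_eq)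
  then show ?thesis
    by (simp add: entry_def bop_apply_def compression.rep_eq restrict_ell2.rep_eq)
qed

section \<open>Projections\<close>

definition proj :: "'a set \<Rightarrow> 'a bop" where
  "proj J = mult_op (\<lambda>i. if i \<in> J then 1 else 0)"

lemma bounded_range_ind: "bounded (range (\<lambda>i. if i \<in> J then 1 else 0 :: complex))"
  by (rule boundedI[of _ 1]) auto

lemma entry_proj: "entry (proj J) i j = (if i = j \<and> i \<in> J then 1 else 0)"
  unfolding proj_def entry_mult_op[OF bounded_range_ind] by simp

lemma entry_proj_left: "entry (proj J * X) i j = (if i \<in> J then entry X i j else 0)"
  unfolding proj_def entry_mult_op_left[OF bounded_range_ind] by simp

lemma entry_proj_right: "entry (X * proj J) i j = (if j \<in> J then entry X i j else 0)"
  unfolding proj_def entry_mult_op_right[OF bounded_range_ind] by simp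

lemma proj_times: "proj J * proj L = proj (J \<inter> L)"
  by (rule bop_eqI) (auto simp: entry_proj_left entry_proj)

lemma proj_idem: "proj J * proj J = proj J"
  by (simp add: proj_times)

lemma proj_idem': "proj J * (proj J * X) = proj J * X"
  by (simp add: proj_idem flip: mult.assoc)

lemma proj_compl: "proj (- J) = 1 - proj J"
  by (rule bop_eqI) (auto simp: entry_proj entry_diff entry_one)

section \<open>Determinants of kernels\<close>

text \<open>The formula of \<open>principal_minor\<close> for an arbitrary kernel, since truncated,
  cut-off and relabelled kernels are not kept as operators.\<close>

definition kernel_minor :: "('a \<Rightarrow> 'a \<Rightarrow> complex) \<Rightarrow> 'a set \<Rightarrow> complex" where
  "kernel_minor k S = (\<Sum>p | p permutes S. of_int (sign p) * (\<Prod>i\<in>S. k i (p i)))"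

definition kernel_det :: "('a \<Rightarrow> 'a \<Rightarrow> complex) \<Rightarrow> complex" where
  "kernel_det k = infsum (kernel_minor k) {S. finite S}"

text \<open>The argument includes the identity, unlike that of \<open>kernel_det\<close>. There is
  no trace class test; agreement with \<open>fredholm_det\<close> is proved for summable
  entries.\<close>

definition op_det :: "'a bop \<Rightarrow> complex" where
  "op_det X = kernel_det (entry (X - 1))"

section \<open>Estimates of principal minors by row sums\<close>

lemma sum_permutes_le_PiE:
  fixes w :: "'a \<Rightarrow> 'a \<Rightarrow> real"
  assumes "finite F" "S \<subseteq> F"
    and nn: "\<And>f. 0 \<le> G f" and G: "\<And>f. G f = G (restrict f S)"
  shows "(\<Sum>p | p permutes S. G p) \<le> (\<Sum>f\<in>S \<rightarrow>\<^sub>E F. (G f :: real))"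
proof -
  have fS: "finite S" by (rule finite_subset[OF assms(2,1)])
  \<comment> \<open>A permutation of \<open>S\<close> is the identity off \<open>S\<close>, so its
    restriction to \<open>S\<close> determines it. Enlarging the sum to all functions from
    \<open>S\<close> to \<open>F\<close> lets it factor over the rows.\<close>
  have inj: "inj_on (\<lambda>p. restrict p S) {p. p permutes S}"
  proof (rule inj_onI)
    fix p q assume pq: "p \<in> {p. p permutes S}" "q \<in> {p. p permutes S}" "restrict p S = restrict q S"
    show "p = q"
    proof
      fix x show "p x = q x"
        using pq(1,2) fun_cong[OF pq(3), of x] by (cases "x \<in> S") (auto simp: permutes_not_in)
    qed
  qed
  have "(\<Sum>p | p permutes S. G p) = (\<Sum>f\<in>(\<lambda>p. restrict p S) ` {p. p permutes S}. G f)"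
    by (subst sum.reindex[OF inj]) (auto simp: o_def intro!: sum.cong G)
  also have "\<dots> \<le> (\<Sum>f\<in>S \<rightarrow>\<^sub>E F. G f)"
  proof (rule sum_mono2)
    show "finite (S \<rightarrow>\<^sub>E F)" using fS assms by (intro finite_PiE) auto
    show "(\<lambda>p. restrict p S) ` {p. p permutes S} \<subseteq> S \<rightarrow>\<^sub>E F"
      using assms(2) permutes_in_image by fastforce
  qed (use nn in auto)
  finally show ?thesis .
qed

text \<open>Dropping the injectivity of the permutations turns the sum into a product of row sums.
  This is cruder than Hadamard's inequality but factors over the index set.\<close>

lemma cmod_kernel_minor_le:
  assumes "finite F" "S \<subseteq> F" "\<And>i j. i \<in> S \<Longrightarrow> cmod (k i j) \<le> w i j"
  shows "cmod (kernel_minor k S) \<le> (\<Prod>i\<in>S. \<Sum>j\<in>F. w i j)"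
proof -
  have fS: "finite S" by (rule finite_subset[OF assms(2,1)])
  have "cmod (kernel_minor k S) \<le> (\<Sum>p | p permutes S. \<Prod>i\<in>S. cmod (k i (p i)))"
    unfolding kernel_minor_def
    by (rule order_trans[OF norm_sum]) (auto intro!: sum_mono simp: norm_mult prod_norm[symmetric] sign_def)
  also have "\<dots> \<le> (\<Sum>f\<in>S \<rightarrow>\<^sub>E F. \<Prod>i\<in>S. cmod (k i (f i)))"
    by (rule sum_permutes_le_PiE) (use assms in \<open>auto intro!: prod_nonneg\<close>)
  also have "\<dots> = (\<Prod>i\<in>S. \<Sum>j\<in>F. cmod (k i j))"
    by (rule prod_sum_PiE[symmetric]) (use assms fS in auto)
  also have "\<dots> \<le> (\<Prod>i\<in>S. \<Sum>j\<in>F. w i j)"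
    by (intro prod_mono conjI sum_nonneg sum_mono assms) auto
  finally show ?thesis .
qed

text \<open>Telescoping one factor at a time. The right-hand side is the same telescoping for the
  majorants \<open>w + d\<close> and \<open>w\<close>, a form that still factors after summation
  over permutations and over subsets.\<close>

lemma cmod_prod_diff_le:
  fixes a b :: "'a \<Rightarrow> complex"
  assumes "finite S" "\<And>i. i \<in> S \<Longrightarrow> cmod (a i) \<le> w i" "\<And>i. i \<in> S \<Longrightarrow> cmod (b i) \<le> w i"
    "\<And>i. i \<in> S \<Longrightarrow> cmod (a i - b i) \<le> d i"
  shows "cmod (prod a S - prod b S) \<le> (\<Prod>i\<in>S. w i + d i) - prod w S"
  using assms
proof (induction S rule: finite_induct)
  case (insert x S)
  have w: "0 \<le> w i" and d: "0 \<le> d i" if "i \<in> insert x S" for i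
    using insert.prems(1,3)[OF that] norm_ge_zero order_trans by blast+
  have IH: "cmod (prod a S - prod b S) \<le> (\<Prod>i\<in>S. w i + d i) - prod w S"
    using insert by auto
  have pa: "cmod (prod a S) \<le> (\<Prod>i\<in>S. w i + d i)"
    unfolding prod_norm[symmetric]
    by (intro prod_mono) (use insert.prems(1) d in \<open>force intro: add_increasing2\<close>)
  have "a x * prod a S - b x * prod b S = (a x - b x) * prod a S + b x * (prod a S - prod b S)"
    by (simp add: algebra_simps)
  then have "cmod (a x * prod a S - b x * prod b S) \<le> cmod (a x - b x) * cmod (prod a S) + cmod (b x) * cmod (prod a S - prod b S)"
    by (metis norm_triangle_ineq norm_mult)
  also have "\<dots> \<le> d x * (\<Prod>i\<in>S. w i + d i) + w x * ((\<Prod>i\<in>S. w i + d i) - prod w S)"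
    by (intro add_mono mult_mono IH pa) (use insert.prems w d in auto)
  also have "\<dots> = (w x + d x) * (\<Prod>i\<in>S. w i + d i) - w x * prod w S"
    by (simp add: algebra_simps)
  finally show ?case using insert by simp
qed simp

lemma cmod_kernel_minor_diff_le:
  assumes "finite F" "S \<subseteq> F" "\<And>i j. cmod (k i j) \<le> w i j" "\<And>i j. cmod (l i j) \<le> w i j"
    "\<And>i j. cmod (k i j - l i j) \<le> d i j"
  shows "cmod (kernel_minor k S - kernel_minor l S) \<le> (\<Prod>i\<in>S. (\<Sum>j\<in>F. w i j) + (\<Sum>j\<in>F. d i j)) - (\<Prod>i\<in>S. \<Sum>j\<in>F. w i j)"
proof -
  have fS: "finite S" by (rule finite_subset[OF assms(2,1)])
  have w: "0 \<le> w i j" and d: "0 \<le> d i j" for i j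
    using assms(3,5)[of i j] norm_ge_zero order_trans by blast+
  have "kernel_minor k S - kernel_minor l S = (\<Sum>p | p permutes S. of_int (sign p) * ((\<Prod>i\<in>S. k i (p i)) - (\<Prod>i\<in>S. l i (p i))))"
    by (simp add: kernel_minor_def sum_subtractf right_diff_distrib)
  then have "cmod (kernel_minor k S - kernel_minor l S) \<le> (\<Sum>p | p permutes S. cmod ((\<Prod>i\<in>S. k i (p i)) - (\<Prod>i\<in>S. l i (p i))))"
    by (simp only:) (rule order_trans[OF norm_sum], auto intro!: sum_mono simp: norm_mult sign_def)
  also have "\<dots> \<le> (\<Sum>p | p permutes S. (\<Prod>i\<in>S. w i (p i) + d i (p i)) - (\<Prod>i\<in>S. w i (p i)))"
    by (intro sum_mono cmod_prod_diff_le fS assms)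
  also have "\<dots> \<le> (\<Sum>f\<in>S \<rightarrow>\<^sub>E F. (\<Prod>i\<in>S. w i (f i) + d i (f i)) - (\<Prod>i\<in>S. w i (f i)))"
    by (rule sum_permutes_le_PiE) (use assms(1,2) w d in \<open>auto intro!: prod_mono arg_cong2[where f = minus] prod.cong\<close>)
  also have "\<dots> = (\<Prod>i\<in>S. \<Sum>j\<in>F. w i j + d i j) - (\<Prod>i\<in>S. \<Sum>j\<in>F. w i j)"
    unfolding sum_subtractf
    by (intro arg_cong2[where f = minus] prod_sum_PiE[symmetric]) (use assms fS in auto)
  finally show ?thesis by (simp add: sum.distrib)
qed

lemma kernel_minor_zero_row:
  assumes "finite S" "i \<in> S" "\<And>j. k i j = 0" shows "kernel_minor k S = 0"
proof -
  have "(\<Prod>i\<in>S. k i (p i)) = 0" for p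
    by (rule prod_zero) (use assms in auto)
  then show ?thesis by (simp add: kernel_minor_def)
qed

lemma kernel_det_finite:
  assumes "finite F" "\<And>i j. i \<notin> F \<Longrightarrow> k i j = 0"
  shows "kernel_det k = (\<Sum>S\<in>Pow F. kernel_minor k S)"
proof -
  have "kernel_det k = infsum (kernel_minor k) (Pow F)"
    unfolding kernel_det_def
  proof (rule infsum_cong_neutral)
    fix S assume "S \<in> {S. finite S} - Pow F"
    then obtain i where "finite S" "i \<in> S" "i \<notin> F" by auto
    then show "kernel_minor k S = 0" using assms(2) by (intro kernel_minor_zero_row[of S i]) auto
  qed (use assms(1) in \<open>auto intro: finite_subset\<close>)
  then show ?thesis using assms(1) by simp
qed

lemma prod_one_plus_le_exp:
  assumes "\<And>i. i \<in> F \<Longrightarrow> 0 \<le> r i" shows "(\<Prod>i\<in>F. 1 + r i) \<le> exp (sum r F :: real)"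
proof (cases "finite F")
  case True
  show ?thesis unfolding exp_sum[OF True] by (intro prod_mono) (use assms in \<open>auto intro: add_nonneg_nonneg\<close>)
qed simp

lemma sum_Pow_prod:
  fixes r :: "'a \<Rightarrow> 'b::comm_semiring_1"
  assumes "finite F" shows "(\<Sum>S\<in>Pow F. prod r S) = (\<Prod>i\<in>F. 1 + r i)"
  using prod_add[OF assms, of r "\<lambda>_. 1"] by (simp add: add.commute)

text \<open>Summing the minor estimate over all subsets of \<open>F\<close> gives a difference of
  two products over \<open>F\<close>, and 1 + R + T <= (1 + R)(1 + T) separates the two row sums.
  The bound depends on \<open>F\<close> only through \<open>W\<close> and \<open>D\<close>, which
  makes it uniform over growing intervals.\<close>

lemma kernel_det_lipschitz:
  assumes F: "finite F" "\<And>i j. i \<notin> F \<Longrightarrow> k i j = 0" "\<And>i j. i \<notin> F \<Longrightarrow> l i j = 0"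
    and w: "\<And>i j. cmod (k i j) \<le> w i j" "\<And>i j. cmod (l i j) \<le> w i j"
    and d: "\<And>i j. cmod (k i j - l i j) \<le> d i j"
    and W: "(\<Sum>i\<in>F. \<Sum>j\<in>F. w i j) \<le> W" and D: "(\<Sum>i\<in>F. \<Sum>j\<in>F. d i j) \<le> D"
  shows "cmod (kernel_det k - kernel_det l) \<le> exp W * (exp D - 1)"
proof -
  have w0: "0 \<le> w i j" and d0: "0 \<le> d i j" for i j
    using w(1)[of i j] d[of i j] norm_ge_zero order_trans by blast+
  define R where "R i = (\<Sum>j\<in>F. w i j)" for i
  define T where "T i = (\<Sum>j\<in>F. d i j)" for i
  have R0: "0 \<le> R i" and T0: "0 \<le> T i" for i by (simp_all add: R_def T_def sum_nonneg w0 d0)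
  have "cmod (kernel_det k - kernel_det l) = cmod (\<Sum>S\<in>Pow F. kernel_minor k S - kernel_minor l S)"
    using F by (simp add: kernel_det_finite sum_subtractf)
  also have "\<dots> \<le> (\<Sum>S\<in>Pow F. (\<Prod>i\<in>S. R i + T i) - (\<Prod>i\<in>S. R i))"
    unfolding R_def T_def
    by (rule order_trans[OF norm_sum]) (intro sum_mono cmod_kernel_minor_diff_le, use F w d in auto)
  also have "\<dots> = (\<Prod>i\<in>F. 1 + (R i + T i)) - (\<Prod>i\<in>F. 1 + R i)"
    unfolding sum_subtractf by (simp only: sum_Pow_prod[OF F(1)])
  also have "\<dots> \<le> (\<Prod>i\<in>F. (1 + R i) * (1 + T i)) - (\<Prod>i\<in>F. 1 + R i)"
    using R0 T0 by (intro diff_right_mono prod_mono) (auto simp: algebra_simps intro!: add_nonneg_nonneg)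
  also have "\<dots> = (\<Prod>i\<in>F. 1 + R i) * ((\<Prod>i\<in>F. 1 + T i) - 1)"
    by (simp add: prod.distrib right_diff_distrib)
  also have "\<dots> \<le> exp W * (exp D - 1)"
  proof (rule mult_mono)
    have "(\<Prod>i\<in>F. 1 + R i) \<le> exp (sum R F)" by (rule prod_one_plus_le_exp) (rule R0)
    also have "\<dots> \<le> exp W" using W by (simp add: R_def)
    finally show "(\<Prod>i\<in>F. 1 + R i) \<le> exp W" .
    have "(\<Prod>i\<in>F. 1 + T i) \<le> exp (sum T F)" by (rule prod_one_plus_le_exp) (rule T0)
    also have "\<dots> \<le> exp D" using D by (simp add: T_def)
    finally show "(\<Prod>i\<in>F. 1 + T i) - 1 \<le> exp D - 1" by simp
    show "0 \<le> (\<Prod>i\<in>F. 1 + T i) - 1" using T0 by (simp add: prod_ge_1)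
  qed simp
  finally show ?thesis .
qed

text \<open>Finitely many finite sets lie in the power set of their union, over which the products
  sum to the product of the 1 + r, at most the exponential of the sum of \<open>r\<close>.\<close>

lemma summable_prod_finite_sets:
  fixes r :: "'a \<Rightarrow> real"
  assumes "\<And>i. 0 \<le> r i" "r summable_on UNIV"
  shows "prod r summable_on {S. finite S}"
proof (rule nonneg_bdd_above_summable_on)
  show "bdd_above (sum (prod r) ` {\<F>. \<F> \<subseteq> {S. finite S} \<and> finite \<F>})"
  proof (rule bdd_aboveI2)
    fix \<F> :: "'a set set" assume F: "\<F> \<in> {\<F>. \<F> \<subseteq> {S. finite S} \<and> finite \<F>}"
    then have fU: "finite (\<Union>\<F>)" by auto
    have "sum (prod r) \<F> \<le> sum (prod r) (Pow (\<Union>\<F>))"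
      by (rule sum_mono2) (use fU assms in \<open>auto intro: prod_nonneg\<close>)
    also have "\<dots> \<le> exp (sum r (\<Union>\<F>))"
      unfolding sum_Pow_prod[OF fU] by (rule prod_one_plus_le_exp) (rule assms)
    also have "\<dots> \<le> exp (infsum r UNIV)"
      using fU assms by (simp add: finite_sum_le_infsum)
    finally show "sum (prod r) \<F> \<le> exp (infsum r UNIV)" .
  qed
qed (auto intro: prod_nonneg assms)

lemma kernel_row_sums:
  assumes "esum (\<lambda>i. esum (\<lambda>j. \<kappa> i j)) < Orderings.top"
  obtains r :: "'a \<Rightarrow> real" where "\<And>i. 0 \<le> r i" "r summable_on UNIV"
    "\<And>i j. \<kappa> i j < Orderings.top" "\<And>i F. finite F \<Longrightarrow> (\<Sum>j\<in>F. enn2real (\<kappa> i j)) \<le> r i"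
proof
  have rt: "esum (\<kappa> i) < Orderings.top" for i
    using esum_ge_point[of "\<lambda>i. esum (\<kappa> i)" i] assms by (rule le_less_trans)
  show kt: "\<kappa> i j < Orderings.top" for i j
    using esum_ge_point[of "\<kappa> i" j] rt by (rule le_less_trans)
  show "0 \<le> enn2real (esum (\<kappa> i))" for i by simp
  have "esum (\<lambda>i. ennreal (norm (enn2real (esum (\<kappa> i))))) < Orderings.top"
    using assms rt by simp
  from esum_summable(1)[OF this] show "(\<lambda>i. enn2real (esum (\<kappa> i))) summable_on UNIV" by simp
  show "(\<Sum>j\<in>F. enn2real (\<kappa> i j)) \<le> enn2real (esum (\<kappa> i))" if "finite F" for F i
  proof -
    have "ennreal (\<Sum>j\<in>F. enn2real (\<kappa> i j)) = (\<Sum>j\<in>F. \<kappa> i j)"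
      using kt by (simp add: sum_ennreal[symmetric])
    also have "\<dots> \<le> esum (\<kappa> i)" by (rule sum_le_esum[OF that])
    finally have "enn2real (ennreal (\<Sum>j\<in>F. enn2real (\<kappa> i j))) \<le> enn2real (esum (\<kappa> i))"
      using rt by (intro enn2real_mono)
    then show ?thesis by (simp add: sum_nonneg)
  qed
qed

text \<open>Each minor is a polynomial in finitely many entries and so converges. The products of
  the row sums of \<kappa> dominate the minors for all \<open>n\<close> at once and are summable
  over the finite sets.\<close>

lemma kernel_det_dominated_convergence:
  assumes lim: "\<And>i j. (\<lambda>n. k n i j) \<longlonglongrightarrow> l i j"
    and bound: "\<And>n i j. ennreal (cmod (k n i j)) \<le> \<kappa> i j"
    and \<kappa>: "esum (\<lambda>i. esum (\<lambda>j. \<kappa> i j)) < Orderings.top"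
  shows "(\<lambda>n. kernel_det (k n)) \<longlonglongrightarrow> kernel_det l"
proof -
  obtain r :: "'a \<Rightarrow> real" where r: "\<And>i. 0 \<le> r i" "r summable_on UNIV"
    "\<And>i j. \<kappa> i j < Orderings.top" "\<And>i F. finite F \<Longrightarrow> (\<Sum>j\<in>F. enn2real (\<kappa> i j)) \<le> r i"
    using kernel_row_sums[OF \<kappa>] by metis
  have b: "cmod (k n i j) \<le> enn2real (\<kappa> i j)" for n i j
    using enn2real_mono[OF bound r(3)] by simp
  show ?thesis unfolding kernel_det_def
  proof (rule infsum_dominated_convergence(1))
    show "prod r summable_on {S. finite S}" by (rule summable_prod_finite_sets) (rule r)+
    fix S :: "'a set" assume S: "S \<in> {S. finite S}"
    show "(\<lambda>n. kernel_minor (k n) S) \<longlonglongrightarrow> kernel_minor l S"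
      unfolding kernel_minor_def by (intro tendsto_intros lim)
    show "cmod (kernel_minor (k n) S) \<le> prod r S" for n
    proof -
      have "cmod (kernel_minor (k n) S) \<le> (\<Prod>i\<in>S. \<Sum>j\<in>S. enn2real (\<kappa> i j))"
        by (rule cmod_kernel_minor_le) (use S b in auto)
      also have "\<dots> \<le> prod r S"
        using S by (intro prod_mono) (auto intro: sum_nonneg r(4))
      finally show ?thesis .
    qed
  qed
qed

section \<open>Relabelling the indices and shrinking the support\<close>

lemma kernel_minor_image:
  assumes "finite S" "inj_on f S"
  shows "kernel_minor k (f ` S) = kernel_minor (\<lambda>i j. k (f i) (f j)) S"
proof -
  have bij: "bij_betw f S (f ` S)" using assms(2) by (rule inj_on_imp_bij_betw)
  let ?g = "inv_into S f"
  have g: "\<And>x. x \<in> S \<Longrightarrow> ?g (f x) = x" using assms(2) by simp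
  have g': "\<And>x. x \<in> f ` S \<Longrightarrow> f (?g x) = x" by (rule f_inv_into_f)
  have bij': "bij_betw ?g (f ` S) S" using bij by (rule bij_betw_inv_into)
  show ?thesis unfolding kernel_minor_def
  \<comment> \<open>Permutations of \<open>S\<close> and of its image correspond by conjugation with
    \<open>f\<close>, which preserves the sign.\<close>
  proof (rule sum.reindex_bij_witness[where i = "map_permutation S f" and j = "map_permutation (f ` S) ?g"], goal_cases)
    case (1 p)
    then show ?case using map_permutation_compose_inv[OF bij' _ g', of p] by simp
  next
    case (2 p)
    then show ?case using map_permutation_permutes[OF bij'] by simp
  next
    case (3 p)
    then show ?case using map_permutation_compose_inv[OF bij _ g, of p] by simp
  next
    case (4 p)
    then show ?case using map_permutation_permutes[OF bij] by simp
  next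
    case (5 p)
    then have p: "p permutes f ` S" by simp
    define q where "q = map_permutation (f ` S) ?g p"
    have q: "q permutes S" unfolding q_def by (rule map_permutation_permutes[OF bij' p])
    have pq: "p = map_permutation S f q"
      unfolding q_def using map_permutation_compose_inv[OF bij' p g'] by simp
    have "sign p = sign q" unfolding pq
      by (rule sign_map_permutation) (use assms q in auto)
    moreover have "(\<Prod>i\<in>f ` S. k i (p i)) = (\<Prod>i\<in>S. k (f i) (f (q i)))"
      by (subst prod.reindex[OF assms(2)]) (auto simp: pq map_permutation_apply[OF assms(2)] intro!: prod.cong)
    ultimately show ?case by (simp add: q_def)
  qed
qed

text \<open>A zero row kills every minor through it, so only the images under \<open>f\<close> of
  finite sets contribute.\<close>

lemma kernel_det_inj:
  assumes "inj f" "\<And>i j. i \<notin> range f \<Longrightarrow> k i j = 0"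
  shows "kernel_det k = kernel_det (\<lambda>i j. k (f i) (f j))"
proof -
  have "kernel_det k = infsum (kernel_minor k) (image f ` {S. finite S})"
    unfolding kernel_det_def
  proof (rule infsum_cong_neutral)
    fix S assume S: "S \<in> {S. finite S} - image f ` {S. finite S}"
    have "\<not> S \<subseteq> range f"
    proof
      assume "S \<subseteq> range f"
      then have "S = f ` (f -` S)" by (rule image_vimage_eq[THEN trans, symmetric, OF Int_absorb2])
      moreover have "f -` S \<in> {S. finite S}" using S assms(1) by (auto intro: finite_vimageI)
      ultimately have "S \<in> image f ` {S. finite S}" by (rule image_eqI)
      then show False using S by simp
    qed
    then obtain i where "i \<in> S" "i \<notin> range f" by auto
    then show "kernel_minor k S = 0" using S assms(2) by (intro kernel_minor_zero_row[of S i]) auto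
  qed auto
  also have "\<dots> = infsum (kernel_minor k \<circ> image f) {S. finite S}"
  proof (rule infsum_reindex)
    show "inj_on (image f) {S. finite S}" using assms(1) by (auto simp: inj_on_def inj_image_eq_iff)
  qed
  also have "\<dots> = kernel_det (\<lambda>i j. k (f i) (f j))"
    unfolding kernel_det_def
    by (rule infsum_cong) (use assms(1) in \<open>auto intro!: kernel_minor_image inj_on_subset[of f UNIV]\<close>)
  finally show ?thesis .
qed

text \<open>Minors on subsets of \<open>J\<close> see only entries with both indices in
  \<open>J\<close>, and all others contain a zero row. The kernels may differ in the columns outside
  \<open>J\<close>: adding the identity gives block triangular matrices.\<close>

lemma kernel_det_cong_support:
  assumes "\<And>i j. i \<notin> J \<Longrightarrow> k i j = 0" "\<And>i j. i \<notin> J \<Longrightarrow> l i j = 0"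
    "\<And>i j. i \<in> J \<Longrightarrow> j \<in> J \<Longrightarrow> k i j = l i j"
  shows "kernel_det k = kernel_det l"
  unfolding kernel_det_def
proof (rule infsum_cong)
  fix S :: "'a set" assume S: "S \<in> {S. finite S}"
  show "kernel_minor k S = kernel_minor l S"
  proof (cases "S \<subseteq> J")
    case True
    show ?thesis unfolding kernel_minor_def
      by (intro sum.cong refl arg_cong2[where f = times] prod.cong assms(3))
        (use True in \<open>auto simp: permutes_in_image\<close>)
  next
    case False
    then obtain i where "i \<in> S" "i \<notin> J" by auto
    then show ?thesis using S assms(1,2) by (simp add: kernel_minor_zero_row[of S i])
  qed
qed

section \<open>Matrix determinants and multiplicativity\<close>

lemma kernel_det_eq_det:
  assumes "\<And>i j. i \<ge> n \<Longrightarrow> k i j = 0"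
  shows "kernel_det k = Determinant.det (mat n n (\<lambda>(i, j). (if i = j then 1 else 0) + k i j))"
proof -
  let ?A = "{0..<n}"
  let ?T = "\<lambda>X p. (\<Prod>i\<in>X. k i (p i)) * (\<Prod>i\<in>?A - X. if i = p i then 1 else 0)"
  have "Determinant.det (mat n n (\<lambda>(i, j). (if i = j then 1 else 0) + k i j))
      = (\<Sum>p | p permutes ?A. of_int (sign p) * (\<Prod>i\<in>?A. k i (p i) + (if i = p i then 1 else 0)))"
    unfolding det_def
    by (auto intro!: sum.cong arg_cong2[where f = times] prod.cong simp: add.commute permutes_in_image[of _ ?A, simplified])
  \<comment> \<open>In each row either the kernel or the identity is chosen, and \<open>X\<close> is
    the set of rows where the kernel is. The identity forces \<open>p\<close> to fix the remaining
    rows, so only permutations of \<open>X\<close> survive.\<close>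
  also have "\<dots> = (\<Sum>p | p permutes ?A. \<Sum>X\<in>Pow ?A. of_int (sign p) * ?T X p)"
    by (subst prod_add) (simp_all add: sum_distrib_left)
  also have "\<dots> = (\<Sum>X\<in>Pow ?A. \<Sum>p | p permutes ?A. of_int (sign p) * ?T X p)"
    by (rule sum.swap)
  also have "\<dots> = (\<Sum>X\<in>Pow ?A. kernel_minor k X)"
  proof (rule sum.cong[OF refl])
    fix X assume X: "X \<in> Pow ?A"
    have "(\<Sum>p | p permutes ?A. of_int (sign p) * ?T X p)
        = (\<Sum>p | p permutes X. of_int (sign p) * ?T X p)"
    proof (rule sum.mono_neutral_right)
      show "finite {p. p permutes ?A}" by (simp add: finite_permutations)
      show "{p. p permutes X} \<subseteq> {p. p permutes ?A}" using X by (auto intro: permutes_subset)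
      show "\<forall>p\<in>{p. p permutes ?A} - {p. p permutes X}.
        of_int (sign p) * ?T X p = 0"
      proof
        fix p assume p: "p \<in> {p. p permutes ?A} - {p. p permutes X}"
        then obtain i where "i \<in> ?A - X" "p i \<noteq> i" using permutes_superset[of p ?A X] by blast
        then have "(\<Prod>i\<in>?A - X. if i = p i then 1 else 0 :: complex) = 0"
          by (intro prod_zero) (auto intro!: bexI[of _ i])
        then show "of_int (sign p) * ?T X p = 0"
          by simp
      qed
    qed
    also have "\<dots> = kernel_minor k X"
      unfolding kernel_minor_def
    proof (rule sum.cong[OF refl])
      fix p assume "p \<in> {p. p permutes X}"
      then have "(\<Prod>i\<in>?A - X. if i = p i then 1 else 0 :: complex) = 1"
        by (intro prod.neutral) (auto simp: permutes_not_in)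
      then show "of_int (sign p) * ?T X p
          = of_int (sign p) * (\<Prod>i\<in>X. k i (p i))" by simp
    qed
    finally show "(\<Sum>p | p permutes ?A. of_int (sign p) * ?T X p) = kernel_minor k X" .
  qed
  also have "\<dots> = kernel_det k" by (rule kernel_det_finite[symmetric]) (use assms in auto)
  finally show ?thesis by simp
qed

text \<open>The kernel on the left belongs to the product (1 + k)(1 + l). As the rows of
  \<open>l\<close> from \<open>n\<close> on vanish, the sum over x < n is the whole matrix
  product.\<close>

lemma kernel_det_mult_nat:
  fixes k l :: "nat \<Rightarrow> nat \<Rightarrow> complex"
  assumes k: "\<And>i j. i \<ge> n \<Longrightarrow> k i j = 0" and l: "\<And>i j. i \<ge> n \<Longrightarrow> l i j = 0"
  shows "kernel_det (\<lambda>i j. k i j + l i j + (\<Sum>x<n. k i x * l x j)) = kernel_det k * kernel_det l"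
proof -
  let ?I = "\<lambda>k. mat n n (\<lambda>(i, j). (if i = j then 1 else 0) + k i j)"
  have "?I k * ?I l = ?I (\<lambda>i j. k i j + l i j + (\<Sum>x<n. k i x * l x j))"
  proof (rule eq_matI)
    fix i j assume "i < dim_row (?I (\<lambda>i j. k i j + l i j + (\<Sum>x<n. k i x * l x j)))"
      "j < dim_col (?I (\<lambda>i j. k i j + l i j + (\<Sum>x<n. k i x * l x j)))"
    then have ij: "i < n" "j < n" by simp_all
    have "(?I k * ?I l) $$ (i, j) = (\<Sum>x<n. ((if i = x then 1 else 0) + k i x) * ((if x = j then 1 else 0) + l x j))"
      using ij by (simp add: scalar_prod_def atLeast0LessThan)
    also have "\<dots> = (\<Sum>x<n. (if i = x then (if x = j then 1 else 0) + l x j else 0) + (if x = j then k i x else 0) + k i x * l x j)"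
      by (rule sum.cong) (auto simp: algebra_simps)
    also have "\<dots> = ((if i = j then 1 else 0) + l i j) + k i j + (\<Sum>x<n. k i x * l x j)"
      using ij by (simp add: sum.distrib)
    finally show "(?I k * ?I l) $$ (i, j) = ?I (\<lambda>i j. k i j + l i j + (\<Sum>x<n. k i x * l x j)) $$ (i, j)"
      using ij by simp
  qed simp_all
  moreover have "Determinant.det (?I k * ?I l) = Determinant.det (?I k) * Determinant.det (?I l)"
    by (rule det_mult[of _ n]) simp_all
  moreover have "kernel_det (\<lambda>i j. k i j + l i j + (\<Sum>x<n. k i x * l x j)) = Determinant.det (?I (\<lambda>i j. k i j + l i j + (\<Sum>x<n. k i x * l x j)))"
    by (rule kernel_det_eq_det) (simp add: k l)
  ultimately show ?thesis by (simp only: kernel_det_eq_det[OF k] kernel_det_eq_det[OF l])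
qed

lemma kernel_det_mult_int:
  fixes k l :: "int \<Rightarrow> int \<Rightarrow> complex"
  assumes F: "finite F" and k: "\<And>i j. i \<notin> F \<Longrightarrow> k i j = 0" and l: "\<And>i j. i \<notin> F \<Longrightarrow> l i j = 0"
  shows "kernel_det (\<lambda>i j. k i j + l i j + (\<Sum>x\<in>F. k i x * l x j)) = kernel_det k * kernel_det l"
proof -
  obtain a b where ab: "F \<subseteq> {a..b}"
  proof
    show "F \<subseteq> {Min F..Max F}" using F by auto
  qed
  define n where "n = nat (b - a + 1)"
  define f where "f i = a + int i" for i
  have f: "inj f" by (auto simp: f_def inj_def)
  have Ff: "F \<subseteq> f ` {..<n}"
  proof
    fix x assume "x \<in> F"
    then have "a \<le> x" "x \<le> b" using ab by auto
    then have "x = f (nat (x - a))" "nat (x - a) < n" by (auto simp: f_def n_def)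
    then show "x \<in> f ` {..<n}" by blast
  qed
  have range: "i \<notin> F" if "i \<notin> range f" for i using that Ff by auto
  have nF: "f i \<notin> F" if "i \<ge> n" for i
    using that Ff injD[OF f] by fastforce
  have "(\<Sum>x\<in>F. k i x * l x j) = (\<Sum>x<n. k i (f x) * l (f x) j)" for i j
  proof -
    have "(\<Sum>x\<in>F. k i x * l x j) = (\<Sum>x\<in>f ` {..<n}. k i x * l x j)"
      by (rule sum.mono_neutral_left) (use Ff l in auto)
    also have "\<dots> = (\<Sum>x<n. k i (f x) * l (f x) j)"
      by (subst sum.reindex) (use f in \<open>auto intro: inj_on_subset\<close>)
    finally show ?thesis .
  qed
  then have "kernel_det (\<lambda>i j. k i j + l i j + (\<Sum>x\<in>F. k i x * l x j))
     = kernel_det (\<lambda>i j. k (f i) (f j) + l (f i) (f j) + (\<Sum>x<n. k (f i) (f x) * l (f x) (f j)))"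
    by (subst kernel_det_inj[OF f]) (auto simp: k l range)
  also have "\<dots> = kernel_det (\<lambda>i j. k (f i) (f j)) * kernel_det (\<lambda>i j. l (f i) (f j))"
    by (rule kernel_det_mult_nat[of n "\<lambda>i j. k (f i) (f j)" "\<lambda>i j. l (f i) (f j)"]) (simp_all add: nF k l)
  also have "\<dots> = kernel_det k * kernel_det l"
    using kernel_det_inj[OF f, of k] kernel_det_inj[OF f, of l] k l range by simp
  finally show ?thesis .
qed

lemma op_det_mult:
  fixes X Y :: "int bop"
  assumes F: "finite F" and X: "\<And>i j. i \<notin> F \<Longrightarrow> entry (X - 1) i j = 0"
    and Y: "\<And>i j. i \<notin> F \<Longrightarrow> entry (Y - 1) i j = 0"
  shows "op_det (X * Y) = op_det X * op_det Y"
proof -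
  have "X * Y - 1 = (X - 1) + (Y - 1) + (X - 1) * (Y - 1)" by (simp add: algebra_simps)
  then have a: "entry (X * Y - 1) i j = entry (X - 1) i j + entry (Y - 1) i j + entry ((X - 1) * (Y - 1)) i j" for i j
    by (metis entry_add)
  have "entry ((X - 1) * (Y - 1)) i j = (\<Sum>x\<in>F. entry (X - 1) i x * entry (Y - 1) x j)" for i j
  proof -
    have "entry ((X - 1) * (Y - 1)) i j = infsum (\<lambda>x. entry (X - 1) i x * entry (Y - 1) x j) F"
      unfolding entry_times by (rule infsum_cong_neutral) (auto simp: Y)
    then show ?thesis using F by simp
  qed
  then have "entry (X * Y - 1) = (\<lambda>i j. entry (X - 1) i j + entry (Y - 1) i j + (\<Sum>x\<in>F. entry (X - 1) i x * entry (Y - 1) x j))"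
    by (intro ext) (simp only: a)
  then show ?thesis unfolding op_det_def using kernel_det_mult_int[OF F X Y] by simp
qed

section \<open>Determinants of exponentials and trace class operators\<close>

lemma mult_exp_annihilate_left:
  fixes Q Y :: "'b::{real_normed_algebra_1,banach}"
  assumes "Q * Y = 0" shows "Q * exp Y = Q"
proof -
  have "(\<lambda>n. Q * (Y ^ n /\<^sub>R fact n)) sums (Q * exp Y)"
    unfolding exp_def by (intro sums_mult summable_sums summable_exp_generic)
  moreover have "(\<lambda>n. Q * (Y ^ n /\<^sub>R fact n)) = (\<lambda>n. if n = 0 then Q else 0)"
  proof
    fix n show "Q * (Y ^ n /\<^sub>R fact n) = (if n = 0 then Q else 0)"
      using assms by (cases n) (auto simp flip: mult.assoc)
  qed
  moreover have "(\<lambda>n. if n = 0 then Q else 0) sums Q" using sums_single[of 0 "\<lambda>_. Q"] by simp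
  ultimately show ?thesis using sums_unique2 by metis
qed

lemma entry_exp_minus_one_zero_row:
  assumes "\<And>j. entry X i j = 0" shows "entry (exp X - 1) i j = 0"
proof -
  have "proj {i} * X = 0" by (rule bop_eqI) (auto simp: entry_proj_left entry_zero assms)
  then have "entry (proj {i} * exp X) i j = entry (proj {i}) i j" 
    by (simp add: mult_exp_annihilate_left)
  then show ?thesis by (simp add: entry_proj_left entry_proj entry_diff entry_one)
qed

text \<open>The identity det(exp X) = exp(tr X) without triangularisation: the determinant of
  exp(tX) is multiplicative in the real variable t, so its derivative at 0 determines it, and that
  derivative is the trace.\<close>

lemma op_det_exp:
  fixes X :: "int bop"
  assumes F: "finite F" and X: "\<And>i j. i \<notin> F \<Longrightarrow> entry X i j = 0"
  shows "op_det (exp X) = exp (\<Sum>i\<in>F. entry X i i)"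
proof -
  define f where "f t = op_det (exp (t *\<^sub>R X))" for t :: real
  define c where "c = (\<Sum>i\<in>F. entry X i i)"
  have rows: "entry (exp (t *\<^sub>R X) - 1) i j = 0" if "i \<notin> F" for t i j
    by (rule entry_exp_minus_one_zero_row) (simp add: entry_scaleR X that)
  have f_add: "f (s + t) = f s * f t" for s t
  proof -
    have "exp ((s + t) *\<^sub>R X) = exp (s *\<^sub>R X) * exp (t *\<^sub>R X)"
      unfolding scaleR_left_distrib by (rule exp_add_commuting) simp
    then show ?thesis unfolding f_def by (simp add: op_det_mult[OF F rows rows])
  qed
  define e where "e i j t = entry (exp (t *\<^sub>R X) - 1) i j" for i j t
  have e0: "e i j 0 = 0" for i j by (simp add: e_def entry_zero)
  have e': "(e i j has_derivative (\<lambda>y. y *\<^sub>R entry X i j)) (at 0)" for i j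
  proof -
    have "((\<lambda>t. exp (t *\<^sub>R X) - 1) has_vector_derivative X) (at 0)"
      using has_vector_derivative_diff[OF exp_scaleR_has_vector_derivative_right[of X 0] has_vector_derivative_const[of 1]] by simp
    from bounded_linear.has_vector_derivative[OF bounded_linear_entry this]
    show ?thesis unfolding e_def has_vector_derivative_def .
  qed
  have f_eq: "f = (\<lambda>t. \<Sum>S\<in>Pow F. \<Sum>p | p permutes S. of_int (sign p) * (\<Prod>i\<in>S. e i (p i) t))"
    unfolding f_def op_det_def e_def
    by (subst kernel_det_finite[OF F rows]) (simp_all add: kernel_minor_def)
  have "(f has_derivative (\<lambda>y. \<Sum>S\<in>Pow F. \<Sum>p | p permutes S. of_int (sign p) *
     (\<Sum>i\<in>S. y *\<^sub>R entry X i (p i) * (\<Prod>j\<in>S - {i}. e j (p j) 0)))) (at 0)"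
    unfolding f_eq by (intro has_derivative_sum has_derivative_mult_right has_derivative_prod e')
  moreover have "(\<Sum>S\<in>Pow F. \<Sum>p | p permutes S. of_int (sign p) *
     (\<Sum>i\<in>S. y *\<^sub>R entry X i (p i) * (\<Prod>j\<in>S - {i}. e j (p j) 0))) = y *\<^sub>R c" for y
  proof -
    let ?D = "\<lambda>S. \<Sum>p | p permutes S. of_int (sign p) *
     (\<Sum>i\<in>S. y *\<^sub>R entry X i (p i) * (\<Prod>j\<in>S - {i}. e j (p j) 0))"
    \<comment> \<open>All entries of exp(tX) - 1 vanish at t = 0, so a product of two or more of
      them has derivative zero there. Only singletons contribute, each with a diagonal entry of
      \<open>X\<close>.\<close>
    have "(\<Sum>S\<in>Pow F. ?D S) = (\<Sum>S\<in>(\<lambda>i. {i}) ` F. ?D S)"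
    proof (rule sum.mono_neutral_right)
      show "\<forall>S\<in>Pow F - (\<lambda>i. {i}) ` F. ?D S = 0"
      proof
        fix S assume S: "S \<in> Pow F - (\<lambda>i. {i}) ` F"
        then have fS: "finite S" using F by (auto intro: finite_subset)
        have "(\<Prod>j\<in>S - {i}. e j (p j) 0) = 0" if "i \<in> S" for i and p :: "int \<Rightarrow> int"
        proof -
          have "S - {i} \<noteq> {}" using S that by auto
          then show ?thesis using fS by (auto simp: e0)
        qed
        then show "?D S = 0" by simp
      qed
    qed (use F in auto)
    also have "\<dots> = (\<Sum>i\<in>F. ?D {i})"
      by (subst sum.reindex) (auto simp: inj_on_def)
    also have "\<dots> = (\<Sum>i\<in>F. y *\<^sub>R entry X i i)"
      by (rule sum.cong) (auto simp: permutes_sing sign_id)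
    also have "\<dots> = y *\<^sub>R c" by (simp add: c_def scaleR_sum_right)
    finally show ?thesis .
  qed
  ultimately have f0: "(f has_vector_derivative c) (at 0)" by (simp add: has_vector_derivative_def)
  have f1: "(f has_vector_derivative f t * c) (at t)" for t
  proof -
    have "((\<lambda>s. s - t) has_vector_derivative 1) (at t)"
      using has_vector_derivative_diff[OF has_vector_derivative_id[of "at t"] has_vector_derivative_const[of t "at t"]] by simp
    from vector_diff_chain_at[OF this, of f c] have "((\<lambda>s. f (s - t)) has_vector_derivative c) (at t)"
      using f0 by (simp add: o_def)
    then have "((\<lambda>s. f t * f (s - t)) has_vector_derivative f t * c) (at t)"
      by (rule has_vector_derivative_mult_right)
    then show ?thesis by (simp add: f_add[symmetric])
  qed
  have "((\<lambda>t. f t * exp (- (t *\<^sub>R c))) has_vector_derivative 0) (at t within UNIV)" for t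
  proof -
    have "((\<lambda>t. exp (t *\<^sub>R (- c))) has_vector_derivative exp (t *\<^sub>R (- c)) * (- c)) (at t)"
      by (rule exp_scaleR_has_vector_derivative_right)
    from has_vector_derivative_mult[OF f1 this] show ?thesis by (simp add: algebra_simps)
  qed
  then obtain C where C: "\<And>t. f t * exp (- (t *\<^sub>R c)) = C"
    using has_vector_derivative_zero_constant[of UNIV "\<lambda>t. f t * exp (- (t *\<^sub>R c))"] by auto
  have "f 0 = 1"
  proof -
    have "f 0 = (\<Sum>S\<in>Pow F. kernel_minor (entry (0 :: int bop)) S)"
      unfolding f_def op_det_def by (subst kernel_det_finite[OF F]) (auto simp: entry_zero)
    also have "\<dots> = (\<Sum>S\<in>{{}}. kernel_minor (entry (0 :: int bop)) S)"
    proof (rule sum.mono_neutral_right)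
      show "\<forall>S\<in>Pow F - {{}}. kernel_minor (entry (0 :: int bop)) S = 0"
      proof
        fix S assume "S \<in> Pow F - {{}}"
        then obtain i where "i \<in> S" "finite S" using F finite_subset by blast
        then show "kernel_minor (entry (0 :: int bop)) S = 0" by (intro kernel_minor_zero_row[of S i]) (auto simp: entry_zero)
      qed
    qed (use F in auto)
    also have "\<dots> = 1" by (simp add: kernel_minor_def)
    finally show ?thesis .
  qed
  then have "C = 1" using C[of 0] by simp
  then have "f 1 * exp (- c) = 1" using C[of 1] by simp
  then show ?thesis by (simp add: f_def c_def exp_minus field_simps)
qed

text \<open>The matrix is the sum of its single-entry pieces, which have rank at most one and the
  moduli of the entries as norms. The definition asks for a sequence, hence the enumeration of pairs
  by \<open>prod_decode\<close>.\<close>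

lemma trace_class_of_summable_entries:
  fixes K :: "nat bop"
  assumes "esum (\<lambda>i. esum (\<lambda>j. ennreal (cmod (entry K i j)))) < Orderings.top"
  shows "trace_class K"
proof -
  define x where "x n = (case prod_decode n of (i, j) \<Rightarrow> scaleC_ell2 (entry K i j) (unit_ell2 i))" for n
  define y where "y n = (case prod_decode n of (i, j) \<Rightarrow> unit_ell2 j)" for n :: nat
  have nsc: "norm (scaleC_ell2 c v) = cmod c * norm v" for c and v :: "nat ell2"
    by transfer (rule l2_norm_scale)
  have cin: "cinner_ell2 (unit_ell2 j) z = Rep_ell2 z j" for j :: nat and z
    unfolding cinner_ell2.rep_eq by (subst infsum_single[of j]) (auto simp: unit_ell2.rep_eq)
  have nx: "norm (x n) * norm (y n) = (case prod_decode n of (i, j) \<Rightarrow> cmod (entry K i j))" for n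
    by (simp add: x_def y_def nsc split: prod.split)
  have sK: "(\<lambda>(i, j). cmod (entry K i j)) summable_on UNIV"
    using esum_summable(1)[of "\<lambda>(i, j). entry K i j"] assms
    by (simp add: esum_prod case_prod_unfold)
  have "(\<lambda>n. (\<lambda>(i, j). cmod (entry K i j)) (prod_decode n)) summable_on UNIV"
    using sK summable_on_reindex_bij_betw[OF bij_prod_decode, of "\<lambda>(i, j). cmod (entry K i j)"] by simp
  then have s1: "summable (\<lambda>n. norm (x n) * norm (y n))"
    by (subst nx) (rule summable_on_imp_summable)
  have "(\<lambda>n. scaleC_ell2 (cinner_ell2 (y n) z) (x n)) sums bop_apply K z" for z
  proof -
    have nt: "norm (scaleC_ell2 (cinner_ell2 (y n) z) (x n)) \<le> norm z * (norm (x n) * norm (y n))" for n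
      by (auto simp: nsc x_def y_def cin split: prod.split intro!: mult_right_mono Rep_ell2_norm_le)
    have sm: "summable (\<lambda>n. norm (scaleC_ell2 (cinner_ell2 (y n) z) (x n)))"
      by (rule summable_comparison_test[OF _ summable_mult[OF s1, of "norm z"]]) (use nt in auto)
    then have hs: "((\<lambda>n. scaleC_ell2 (cinner_ell2 (y n) z) (x n)) has_sum (\<Sum>n. scaleC_ell2 (cinner_ell2 (y n) z) (x n))) UNIV"
      by (intro norm_summable_imp_has_sum) (auto intro: summable_sums summable_norm_cancel)
    have "(\<Sum>n. scaleC_ell2 (cinner_ell2 (y n) z) (x n)) = bop_apply K z"
    proof (rule ell2_eqI)
      fix i
      let ?g = "\<lambda>(a, b). Rep_ell2 z b * (entry K a b * (if i = a then 1 else 0))"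
      have "((\<lambda>n. Rep_ell2 (scaleC_ell2 (cinner_ell2 (y n) z) (x n)) i) has_sum Rep_ell2 (\<Sum>n. scaleC_ell2 (cinner_ell2 (y n) z) (x n)) i) UNIV"
        by (rule has_sum_bounded_linear[OF bounded_linear_Rep_ell2 hs])
      moreover have "(\<lambda>n. Rep_ell2 (scaleC_ell2 (cinner_ell2 (y n) z) (x n)) i) = (\<lambda>n. ?g (prod_decode n))"
        by (auto simp: x_def y_def cin scaleC_ell2.rep_eq unit_ell2.rep_eq split: prod.split)
      ultimately have "((\<lambda>n. ?g (prod_decode n)) has_sum Rep_ell2 (\<Sum>n. scaleC_ell2 (cinner_ell2 (y n) z) (x n)) i) UNIV"
        by simp
      then have "(?g has_sum Rep_ell2 (\<Sum>n. scaleC_ell2 (cinner_ell2 (y n) z) (x n)) i) UNIV"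
        using has_sum_reindex_bij_betw[OF bij_prod_decode, of ?g] by simp
      then have "(?g has_sum Rep_ell2 (\<Sum>n. scaleC_ell2 (cinner_ell2 (y n) z) (x n)) i) (Pair i ` UNIV)"
        by (subst has_sum_cong_neutral[where T = UNIV and g = ?g]) auto
      then have "((\<lambda>b. entry K i b * Rep_ell2 z b) has_sum Rep_ell2 (\<Sum>n. scaleC_ell2 (cinner_ell2 (y n) z) (x n)) i) UNIV"
        by (subst (asm) has_sum_reindex) (auto simp: inj_on_def o_def mult.commute)
      then show "Rep_ell2 (\<Sum>n. scaleC_ell2 (cinner_ell2 (y n) z) (x n)) i = Rep_ell2 (bop_apply K z) i"
        by (rule has_sum_unique[OF _ bop_apply_has_sum])
    qed
    then show ?thesis using summable_sums[OF summable_norm_cancel[OF sm]] by simp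
  qed
  with s1 show ?thesis unfolding trace_class_def by blast
qed

lemma fredholm_det_eq_op_det:
  fixes B :: "nat bop"
  assumes "esum (\<lambda>i. esum (\<lambda>j. ennreal (cmod (entry (B - 1) i j)))) < Orderings.top"
  shows "fredholm_det B = op_det B"
proof -
  have "principal_minor (B - 1) = kernel_minor (entry (B - 1))"
    by (auto simp: principal_minor_def kernel_minor_def)
  then show ?thesis
    using trace_class_of_summable_entries[OF assms] by (simp add: fredholm_det_def op_det_def kernel_det_def)
qed

section \<open>Predicates closed under the exponential\<close>

lemma exp_prod_Nil [simp]: "exp_prod [] = 1"
  by (simp add: exp_prod_def)

lemma exp_prod_Cons [simp]: "exp_prod (B # Bs) = exp B * exp_prod Bs"
  by (simp add: exp_prod_def)

lemma exp_prod_append: "exp_prod (Bs @ Cs) = exp_prod Bs * exp_prod Cs"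
  by (simp add: exp_prod_def)

lemma exp_prod_inverse: "exp_prod Bs * exp_prod (map uminus (rev Bs)) = 1"
proof (induction Bs)
  case (Cons B Bs)
  have "exp_prod (B # Bs) * exp_prod (map uminus (rev (B # Bs)))
      = exp B * (exp_prod Bs * exp_prod (map uminus (rev Bs))) * exp (- B)"
    by (simp add: exp_prod_append mult.assoc)
  also have "\<dots> = 1" unfolding Cons.IH by (simp add: exp_minus_inverse)
  finally show ?case .
qed simp

lemma exp_prod_inverse': "exp_prod (map uminus (rev Bs)) * exp_prod Bs = 1"
  using exp_prod_inverse[of "map uminus (rev Bs)"] by (simp add: rev_map o_def)

text \<open>
  \<open>G F c\<close> says that a family \<open>F\<close> has some structure whose submultiplicative norm is at most \<open>c\<close>.
\<close>

locale gauge =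
  fixes G :: "('i \<Rightarrow> 'b::{real_normed_algebra_1,banach}) \<Rightarrow> real \<Rightarrow> bool" and d :: real
  assumes nonneg: "G F c \<Longrightarrow> 0 \<le> c"
    and one: "G (\<lambda>_. 1) d"
    and mult: "G F c \<Longrightarrow> G F' c' \<Longrightarrow> G (\<lambda>i. F i * F' i) (c * c')"
    and scale: "G F c \<Longrightarrow> 0 \<le> t \<Longrightarrow> G (\<lambda>i. t *\<^sub>R F i) (t * c)"
    and sums: "(\<And>k. G (Fs k) (cs k)) \<Longrightarrow> summable cs \<Longrightarrow> (\<And>i. (\<lambda>k. Fs k i) sums S i) \<Longrightarrow> G S (suminf cs)"
begin

lemma power: "G F c \<Longrightarrow> G (\<lambda>i. F i ^ k) (c ^ k * d)"
  by (induction k) (auto simp: one mult.assoc intro: mult)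

text \<open>The exponential series is bounded termwise. The factor \<open>d\<close> stems from the
  empty product in the zeroth power, whose bound need not be 1.\<close>

lemma exp: assumes "G F c" shows "G (\<lambda>i. exp (F i)) (\<Sum>k. (1 / fact k) * (c ^ k * d))"
proof (rule sums)
  show "G (\<lambda>i. (1 / fact k) *\<^sub>R F i ^ k) ((1 / fact k) * (c ^ k * d))" for k
    by (intro scale power assms) simp
  show "summable (\<lambda>k. (1 / fact k) * (c ^ k * d))"
    using summable_mult2[OF summable_exp[of c], of d] by (simp add: field_simps)
  show "(\<lambda>k. (1 / fact k) *\<^sub>R F i ^ k) sums exp (F i)" for i
    using exp_converges[of "F i"] by (simp add: inverse_eq_divide)
qed

lemma exp_prod:
  assumes "\<And>B. B \<in> set Bs \<Longrightarrow> \<exists>c. G B c"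
  shows "\<exists>c. G (\<lambda>i. exp_prod (map (\<lambda>B. B i) Bs)) c"
  using assms
proof (induction Bs)
  case Nil
  then show ?case using one by auto
next
  case (Cons B Bs)
  obtain c where c: "G B c" using Cons.prems[of B] by auto
  obtain c' where "G (\<lambda>i. exp_prod (map (\<lambda>B. B i) Bs)) c'" using Cons by auto
  from mult[OF exp[OF c] this] show ?case by auto
qed

end

section \<open>Operators dominated by Laurent matrices\<close>

definition ldom :: "(int \<Rightarrow> ennreal) \<Rightarrow> int bop \<Rightarrow> bool" where
  "ldom \<mu> X \<longleftrightarrow> (\<forall>i j. ennreal (cmod (entry X i j)) \<le> \<mu> (i - j))"

definition conv :: "(int \<Rightarrow> ennreal) \<Rightarrow> (int \<Rightarrow> ennreal) \<Rightarrow> int \<Rightarrow> ennreal" where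
  "conv \<mu> \<nu> n = esum (\<lambda>l. \<mu> (n - l) * \<nu> l)"

text \<open>The l1 norm of a kernel on pairs of integers. It dominates the trace norm and does not
  change under translation, so it can be measured from either end of an interval.\<close>

definition knorm :: "(int \<Rightarrow> int \<Rightarrow> ennreal) \<Rightarrow> ennreal" where
  "knorm k = esum (\<lambda>i. esum (\<lambda>j. k i j))"

lemma ldomD: "ldom \<mu> X \<Longrightarrow> ennreal (cmod (entry X i j)) \<le> \<mu> (i - j)"
  by (simp add: ldom_def)

lemma esum_conv: "esum (\<lambda>l. \<mu> (i - l) * \<nu> (l - j)) = conv \<mu> \<nu> (i - j)"
  unfolding conv_def
  using esum_minus_right[of "\<lambda>l. \<mu> (i - j - l) * \<nu> l" j] by simp

lemma ldom_mult: "ldom \<mu> X \<Longrightarrow> ldom \<nu> Y \<Longrightarrow> ldom (conv \<mu> \<nu>) (X * Y)"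
  unfolding ldom_def esum_conv[symmetric]
  by (intro allI order_trans[OF entry_times_le] esum_mono mult_mono) auto

lemma ldom_one: "ldom (\<lambda>n. if n = 0 then 1 else 0) 1"
  by (simp add: ldom_def entry_one)

lemma ldom_proj: "ldom \<mu> X \<Longrightarrow> ldom \<mu> (proj J * X * proj L)"
  by (simp add: ldom_def entry_proj_left entry_proj_right)

lemma ldom_uminus: "ldom \<mu> (- X) \<longleftrightarrow> ldom \<mu> X"
  by (simp add: ldom_def entry_uminus)

lemma sums_norm_le_suminf:
  fixes f :: "nat \<Rightarrow> 'b::real_normed_vector"
  assumes "f sums s" shows "ennreal (norm s) \<le> (\<Sum>k. ennreal (norm (f k)))"
proof (rule LIMSEQ_le_const2)
  show "(\<lambda>n. ennreal (norm (sum f {..<n}))) \<longlonglongrightarrow> ennreal (norm s)"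
    using assms unfolding sums_def by (intro tendsto_ennrealI tendsto_norm)
  have "ennreal (norm (sum f {..<n})) \<le> (\<Sum>k. ennreal (norm (f k)))" for n
  proof -
    have "ennreal (norm (sum f {..<n})) \<le> ennreal (\<Sum>k<n. norm (f k))"
      by (intro ennreal_leI norm_sum)
    also have "\<dots> = (\<Sum>k<n. ennreal (norm (f k)))" by simp
    also have "\<dots> \<le> (\<Sum>k. ennreal (norm (f k)))" by (intro sum_le_suminf) auto
    finally show ?thesis .
  qed
  then show "\<exists>N. \<forall>n\<ge>N. ennreal (norm (sum f {..<n})) \<le> (\<Sum>k. ennreal (norm (f k)))" by blast
qed

lemma entry_sums: "X sums S \<Longrightarrow> (\<lambda>k. entry (X k) i j) sums entry S i j"
  by (rule bounded_linear.sums[OF bounded_linear_entry])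

lemma entry_sums_le:
  assumes "X sums S" "\<And>k. ennreal (cmod (entry (X k) i j)) \<le> b k"
  shows "ennreal (cmod (entry S i j)) \<le> (\<Sum>k. b k)"
  by (rule order_trans[OF sums_norm_le_suminf[OF entry_sums[OF assms(1)]]]) (intro suminf_le assms allI summableI)

lemma ldom_sums: "(\<And>k. ldom (\<mu> k) (X k)) \<Longrightarrow> X sums S \<Longrightarrow> ldom (\<lambda>n. \<Sum>k. \<mu> k n) S"
  unfolding ldom_def by (auto intro: entry_sums_le)

lemma suminf_le_ennreal:
  assumes "\<And>k. f k \<le> ennreal (c k)" "\<And>k. 0 \<le> c k" "summable c"
  shows "(\<Sum>k. f k) \<le> ennreal (suminf c)"
proof -
  have "(\<Sum>k. f k) \<le> (\<Sum>k. ennreal (c k))" by (intro suminf_le assms allI summableI)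
  also have "\<dots> = ennreal (suminf c)" using assms by (intro suminf_ennreal2) auto
  finally show ?thesis .
qed

text \<open>
  The last two assumptions count the points from which steps of length \<open>m\<close> and \<open>-n\<close> both cross the
  origin. They make the entries of a product of two Hankel matrices summable.
\<close>

locale weight =
  fixes w :: "int \<Rightarrow> ennreal"
  assumes one_le: "1 \<le> w n" and w0: "w 0 = 1" and submult: "w (m + n) \<le> w m * w n"
    and hankT: "esum (\<lambda>x. if x < 0 \<and> 0 \<le> x + m \<and> 0 \<le> x - n then 1 else 0) \<le> w m * w n"
    and hankF: "esum (\<lambda>x. if 0 \<le> x \<and> x + m < 0 \<and> x - n < 0 then 1 else 0) \<le> w m * w n"
begin

definition wnorm :: "(int \<Rightarrow> ennreal) \<Rightarrow> ennreal" where
  "wnorm \<mu> = esum (\<lambda>n. w n * \<mu> n)"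

lemma le_wnorm: "\<mu> n \<le> w n * \<mu> n"
  using mult_right_mono[OF one_le, of "\<mu> n" n] by simp

lemma esum_le_wnorm: "esum \<mu> \<le> wnorm \<mu>"
  unfolding wnorm_def by (rule esum_mono) (rule le_wnorm)

lemma point_le_wnorm: "\<mu> n \<le> wnorm \<mu>"
  using esum_ge_point[of \<mu> n] esum_le_wnorm order_trans by blast

lemma wnorm_conv: "wnorm (conv \<mu> \<nu>) \<le> wnorm \<mu> * wnorm \<nu>"
proof -
  have "wnorm (conv \<mu> \<nu>) = esum (\<lambda>n. esum (\<lambda>l. w n * (\<mu> (n - l) * \<nu> l)))"
    by (simp add: wnorm_def conv_def esum_cmult)
  also have "\<dots> \<le> esum (\<lambda>n. esum (\<lambda>l. (w (n - l) * \<mu> (n - l)) * (w l * \<nu> l)))"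
  proof (intro esum_mono)
    fix n l
    have "w n \<le> w (n - l) * w l" using submult[of "n - l" l] by simp
    then have "w n * (\<mu> (n - l) * \<nu> l) \<le> (w (n - l) * w l) * (\<mu> (n - l) * \<nu> l)"
      by (rule mult_right_mono) simp
    then show "w n * (\<mu> (n - l) * \<nu> l) \<le> (w (n - l) * \<mu> (n - l)) * (w l * \<nu> l)"
      by (simp add: mult_ac)
  qed
  also have "\<dots> = esum (\<lambda>l. esum (\<lambda>n. (w (n - l) * \<mu> (n - l)) * (w l * \<nu> l)))"
    by (rule esum_swap)
  also have "\<dots> = esum (\<lambda>l. wnorm \<mu> * (w l * \<nu> l))"
    unfolding esum_multc wnorm_def using esum_minus_right[of "\<lambda>n. w n * \<mu> n"] by simp
  also have "\<dots> = wnorm \<mu> * wnorm \<nu>" by (simp add: esum_cmult wnorm_def)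
  finally show ?thesis .
qed

lemma wnorm_delta: "wnorm (\<lambda>n. if n = 0 then 1 else 0) = 1"
  unfolding wnorm_def by (subst esum_finite_support[of "{0}"]) (auto simp: w0)

lemma wnorm_scale: "wnorm (\<lambda>n. c * \<mu> n) = c * wnorm \<mu>"
  unfolding wnorm_def esum_cmult[symmetric] by (simp add: mult_ac)

lemma wnorm_suminf: "wnorm (\<lambda>n. \<Sum>k. \<mu> k n) = (\<Sum>k. wnorm (\<mu> k))"
  unfolding wnorm_def esum_suminf[symmetric] by simp

subsection \<open>Entrywise convergence\<close>

text \<open>The index \<open>None\<close> stands for the limit and \<open>Some n\<close> for the
  approximants. Packing both into one family lets the general closure under exponentials treat them
  with a common majorant.\<close>

definition Conv :: "(nat option \<Rightarrow> int bop) \<Rightarrow> real \<Rightarrow> bool" where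
  "Conv F c \<longleftrightarrow> 0 \<le> c \<and> (\<exists>\<mu>. wnorm \<mu> \<le> ennreal c \<and> (\<forall>i. ldom \<mu> (F i)) \<and>
     (\<forall>j l. (\<lambda>n. entry (F (Some n)) j l) \<longlonglongrightarrow> entry (F None) j l))"

text \<open>Entrywise limits alone do not pass through products. The common majorant gives dominated
  convergence in the inner sum of a product, and the summable constants give it for a
  series.\<close>

lemma gauge_Conv: "gauge Conv 1"
proof
  show "Conv (\<lambda>_. 1) 1"
    unfolding Conv_def
    by (auto intro!: exI[of _ "\<lambda>n. if n = 0 then 1 else 0"] ldom_one simp: wnorm_delta)
next
  fix F F' :: "nat option \<Rightarrow> int bop" and c c' assume "Conv F c" "Conv F' c'"
  then obtain \<mu> \<mu>' where c: "0 \<le> c" "0 \<le> c'" and m: "wnorm \<mu> \<le> ennreal c" "\<And>i. ldom \<mu> (F i)"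
     "\<And>j l. (\<lambda>n. entry (F (Some n)) j l) \<longlonglongrightarrow> entry (F None) j l"
    and m': "wnorm \<mu>' \<le> ennreal c'" "\<And>i. ldom \<mu>' (F' i)"
     "\<And>j l. (\<lambda>n. entry (F' (Some n)) j l) \<longlonglongrightarrow> entry (F' None) j l"
    unfolding Conv_def by metis
  have 1: "wnorm (conv \<mu> \<mu>') \<le> ennreal (c * c')"
    using order_trans[OF wnorm_conv mult_mono[OF m(1) m'(1)]] c by (simp add: ennreal_mult)
  have "(\<lambda>n. entry (F (Some n) * F' (Some n)) j l) \<longlonglongrightarrow> entry (F None * F' None) j l" for j l
    unfolding entry_times
  proof (rule esum_dominated_convergence)
    show "(\<lambda>n. entry (F (Some n)) j x * entry (F' (Some n)) x l) \<longlonglongrightarrow> entry (F None) j x * entry (F' None) x l" for x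
      by (intro tendsto_mult m m')
    show "ennreal (cmod (entry (F (Some n)) j x * entry (F' (Some n)) x l)) \<le> \<mu> (j - x) * \<mu>' (x - l)" for n x
      using mult_mono[OF ldomD[OF m(2)] ldomD[OF m'(2)]] by (simp add: norm_mult ennreal_mult)
    show "esum (\<lambda>x. \<mu> (j - x) * \<mu>' (x - l)) < Orderings.top"
      unfolding esum_conv using order_trans[OF point_le_wnorm 1] by (rule le_less_trans) simp
  qed
  then show "Conv (\<lambda>i. F i * F' i) (c * c')"
    unfolding Conv_def using 1 c ldom_mult[OF m(2) m'(2)] by (auto intro!: exI[of _ "conv \<mu> \<mu>'"])
next
  fix F :: "nat option \<Rightarrow> int bop" and c t :: real assume "Conv F c" and t: "0 \<le> t"
  then obtain \<mu> where c: "0 \<le> c" and m: "wnorm \<mu> \<le> ennreal c" "\<And>i. ldom \<mu> (F i)"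
     "\<And>j l. (\<lambda>n. entry (F (Some n)) j l) \<longlonglongrightarrow> entry (F None) j l"
    unfolding Conv_def by metis
  have "ldom (\<lambda>n. ennreal t * \<mu> n) (t *\<^sub>R F i)" for i
    using m(2)[of i] t by (simp add: ldom_def entry_scaleR ennreal_mult mult_left_mono)
  moreover have "wnorm (\<lambda>n. ennreal t * \<mu> n) \<le> ennreal (t * c)"
    using m(1) t c by (simp add: wnorm_scale ennreal_mult mult_left_mono)
  moreover have "(\<lambda>n. entry (t *\<^sub>R F (Some n)) j l) \<longlonglongrightarrow> entry (t *\<^sub>R F None) j l" for j l
    unfolding entry_scaleR by (intro tendsto_intros m)
  ultimately show "Conv (\<lambda>i. t *\<^sub>R F i) (t * c)"
    unfolding Conv_def using t c by (auto intro!: exI[of _ "\<lambda>n. ennreal t * \<mu> n"])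
next
  fix F :: "nat \<Rightarrow> nat option \<Rightarrow> int bop" and c S
  assume "\<And>k. Conv (F k) (c k)" and sc: "summable c" and S: "\<And>i. (\<lambda>k. F k i) sums S i"
  then have c: "\<And>k. 0 \<le> c k" and "\<forall>k. \<exists>\<mu>. wnorm \<mu> \<le> ennreal (c k) \<and> (\<forall>i. ldom \<mu> (F k i)) \<and>
     (\<forall>j l. (\<lambda>n. entry (F k (Some n)) j l) \<longlonglongrightarrow> entry (F k None) j l)"
    unfolding Conv_def by blast+
  then obtain \<mu> where m: "\<And>k. wnorm (\<mu> k) \<le> ennreal (c k)" "\<And>k i. ldom (\<mu> k) (F k i)"
     "\<And>k j l. (\<lambda>n. entry (F k (Some n)) j l) \<longlonglongrightarrow> entry (F k None) j l"
    by metis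
  have b: "cmod (entry (F k i) j l) \<le> c k" for k i j l
  proof -
    have "ennreal (cmod (entry (F k i) j l)) \<le> ennreal (c k)"
      by (rule order_trans[OF ldomD[OF m(2)[of k i]] order_trans[OF point_le_wnorm m(1)]])
    then show ?thesis using c[of k] by simp
  qed
  have e: "entry (S i) j l = infsum (\<lambda>k. entry (F k i) j l) UNIV" for i j l
  proof (rule infsumI[symmetric], rule norm_summable_imp_has_sum)
    show "summable (\<lambda>k. cmod (entry (F k i) j l))"
      by (rule summable_comparison_test[OF _ sc]) (use b in auto)
  qed (rule entry_sums[OF S])
  have "wnorm (\<lambda>n. \<Sum>k. \<mu> k n) \<le> ennreal (suminf c)"
    unfolding wnorm_suminf by (rule suminf_le_ennreal) (use m c sc in auto)
  moreover have "(\<lambda>n. entry (S (Some n)) j l) \<longlonglongrightarrow> entry (S None) j l" for j l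
    unfolding e
  proof (rule infsum_dominated_convergence(1)[OF m(3) b])
    show "c summable_on UNIV" by (rule summable_nonneg_imp_summable_on[OF sc c])
  qed
  ultimately show "Conv S (suminf c)"
    unfolding Conv_def using suminf_nonneg[OF sc] c ldom_sums[OF m(2) S] by blast
qed (auto simp: Conv_def)

lemma ConvI:
  assumes "\<And>i. ldom \<mu> (F i)" "wnorm \<mu> < Orderings.top"
    "\<And>j l. (\<lambda>n. entry (F (Some n)) j l) \<longlonglongrightarrow> entry (F None) j l"
  shows "\<exists>c. Conv F c"
proof (rule exI[of _ "enn2real (wnorm \<mu>)"])
  show "Conv F (enn2real (wnorm \<mu>))"
    unfolding Conv_def using assms by (auto intro!: exI[of _ \<mu>])
qed

lemma ConvD: "Conv F c \<Longrightarrow> (\<lambda>n. entry (F (Some n)) j l) \<longlonglongrightarrow> entry (F None) j l"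
  by (auto simp: Conv_def)

end

subsection \<open>Compressions to intervals\<close>

text \<open>The Boolean names the end point: \<open>True\<close> is a left end, where a right
  half-line begins, and \<open>False\<close> is a right end, which does not belong to its half-line,
  in accordance with half-open intervals.\<close>

definition inside :: "bool \<Rightarrow> int \<Rightarrow> bool" where
  "inside e l \<longleftrightarrow> (if e then 0 \<le> l else l < 0)"

text \<open>
  \<open>cells E s\<close> is an interval with a left end point at \<open>s True\<close> (if \<open>True \<in> E\<close>) and a right end
  point at \<open>s False\<close> (if \<open>False \<in> E\<close>).
\<close>

definition cells :: "bool set \<Rightarrow> (bool \<Rightarrow> int) \<Rightarrow> int set" where
  "cells E s = {l. \<forall>e\<in>E. inside e (l - s e)}"

context weight
begin

lemma hank: "esum (\<lambda>x. if \<not> inside e x \<and> inside e (x + m) \<and> inside e (x - n) then 1 else 0) \<le> w m * w n"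
  using hankT[of m n] hankF[of m n] by (cases e) (simp_all add: inside_def not_le not_less)

text \<open>A majorant for a product of two Hankel blocks, the difference of T(AB) and T(A)T(B): it
  sums over the paths from \<open>b\<close> to \<open>a\<close> whose intermediate point
  \<open>x\<close> lies outside the half-line.\<close>

definition hkernel where
  "hkernel \<mu> \<nu> e a b = (if inside e a \<and> inside e b then esum (\<lambda>x. if \<not> inside e x then \<mu> (a - x) * \<nu> (x - b) else 0) else 0)"

text \<open>In the variables m = a - x and n = x - b the majorants no longer depend on
  \<open>x\<close>, so the sum over \<open>x\<close> merely counts the points in
  \<open>hank\<close>, and what remains factors.\<close>

lemma knorm_hkernel: "knorm (hkernel \<mu> \<nu> e) \<le> wnorm \<mu> * wnorm \<nu>"
proof -
  let ?I = "\<lambda>a b x. if \<not> inside e x \<and> inside e a \<and> inside e b then 1 else 0 :: ennreal"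
  have "hkernel \<mu> \<nu> e a b = esum (\<lambda>x. ?I a b x * (\<mu> (a - x) * \<nu> (x - b)))" for a b
    unfolding hkernel_def by (auto intro!: arg_cong[of _ _ esum])
  then have "knorm (hkernel \<mu> \<nu> e) = esum (\<lambda>a. esum (\<lambda>b. esum (\<lambda>x. ?I a b x * (\<mu> (a - x) * \<nu> (x - b)))))"
    by (simp add: knorm_def)
  also have "\<dots> = esum (\<lambda>a. esum (\<lambda>x. esum (\<lambda>b. ?I a b x * (\<mu> (a - x) * \<nu> (x - b)))))"
    by (subst (2) esum_swap) (rule refl)
  also have "\<dots> = esum (\<lambda>x. esum (\<lambda>a. esum (\<lambda>b. ?I a b x * (\<mu> (a - x) * \<nu> (x - b)))))"
    by (rule esum_swap)
  also have "\<dots> = esum (\<lambda>x. esum (\<lambda>m. esum (\<lambda>n. ?I (x + m) (x - n) x * (\<mu> m * \<nu> n))))"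
  proof (rule arg_cong[of _ _ esum], rule ext)
    fix x
    have "esum (\<lambda>a. esum (\<lambda>b. ?I a b x * (\<mu> (a - x) * \<nu> (x - b)))) =
        esum (\<lambda>a. esum (\<lambda>n. ?I (x + (a - x)) (x - n) x * (\<mu> (a - x) * \<nu> n)))"
    proof (rule arg_cong[of _ _ esum], rule ext)
      fix a
      show "esum (\<lambda>b. ?I a b x * (\<mu> (a - x) * \<nu> (x - b))) = esum (\<lambda>n. ?I (x + (a - x)) (x - n) x * (\<mu> (a - x) * \<nu> n))"
        using esum_minus_left[of "\<lambda>n. ?I (x + (a - x)) (x - n) x * (\<mu> (a - x) * \<nu> n)" x] by simp
    qed
    also have "\<dots> = esum (\<lambda>m. esum (\<lambda>n. ?I (x + m) (x - n) x * (\<mu> m * \<nu> n)))"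
      by (rule esum_minus_right[of "\<lambda>m. esum (\<lambda>n. ?I (x + m) (x - n) x * (\<mu> m * \<nu> n))" x])
    finally show "esum (\<lambda>a. esum (\<lambda>b. ?I a b x * (\<mu> (a - x) * \<nu> (x - b)))) = esum (\<lambda>m. esum (\<lambda>n. ?I (x + m) (x - n) x * (\<mu> m * \<nu> n)))" .
  qed
  also have "\<dots> = esum (\<lambda>m. esum (\<lambda>x. esum (\<lambda>n. ?I (x + m) (x - n) x * (\<mu> m * \<nu> n))))"
    by (rule esum_swap)
  also have "\<dots> = esum (\<lambda>m. esum (\<lambda>n. esum (\<lambda>x. ?I (x + m) (x - n) x * (\<mu> m * \<nu> n))))"
    by (subst (2) esum_swap) (rule refl)
  also have "\<dots> \<le> esum (\<lambda>m. esum (\<lambda>n. (w m * w n) * (\<mu> m * \<nu> n)))"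
    unfolding esum_multc by (intro esum_mono mult_right_mono hank) simp
  also have "\<dots> = esum (\<lambda>m. (w m * \<mu> m) * wnorm \<nu>)"
    unfolding wnorm_def esum_cmult[symmetric] by (simp add: mult_ac)
  also have "\<dots> = wnorm \<mu> * wnorm \<nu>" unfolding wnorm_def by (rule esum_multc)
  finally show ?thesis .
qed

lemma knorm_kernel_conv: "knorm (\<lambda>a b. esum (\<lambda>x. k a x * \<nu> (x - b))) \<le> knorm k * wnorm \<nu>"
proof -
  have "knorm (\<lambda>a b. esum (\<lambda>x. k a x * \<nu> (x - b))) = esum (\<lambda>a. esum (\<lambda>x. esum (\<lambda>b. k a x * \<nu> (x - b))))"
    unfolding knorm_def by (subst (2) esum_swap) (rule refl)
  also have "\<dots> = esum (\<lambda>a. esum (\<lambda>x. k a x * esum \<nu>))"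
    by (simp add: esum_cmult esum_minus_left[of \<nu>])
  also have "\<dots> = knorm k * esum \<nu>" by (simp add: esum_multc knorm_def)
  also have "\<dots> \<le> knorm k * wnorm \<nu>" by (intro mult_left_mono esum_le_wnorm) simp
  finally show ?thesis .
qed

lemma knorm_conv_kernel: "knorm (\<lambda>a b. esum (\<lambda>x. \<mu> (a - x) * k x b)) \<le> wnorm \<mu> * knorm k"
proof -
  have "knorm (\<lambda>a b. esum (\<lambda>x. \<mu> (a - x) * k x b)) = esum (\<lambda>a. esum (\<lambda>x. esum (\<lambda>b. \<mu> (a - x) * k x b)))"
    unfolding knorm_def by (subst (2) esum_swap) (rule refl)
  also have "\<dots> = esum (\<lambda>x. esum (\<lambda>a. \<mu> (a - x) * esum (k x)))"
    unfolding esum_cmult by (rule esum_swap)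
  also have "\<dots> = esum \<mu> * knorm k"
    by (simp add: esum_multc esum_cmult esum_minus_right[of \<mu>] knorm_def)
  also have "\<dots> \<le> wnorm \<mu> * knorm k" by (intro mult_right_mono esum_le_wnorm) simp
  finally show ?thesis .
qed

text \<open>
  \<open>F (i, False)\<close> stands for an operator on the interval \<open>cells E (s i)\<close> that differs from the compression
  of \<open>F (i, True)\<close> only near the end points, uniformly in \<open>i\<close>. The factor \<open>4\<close> absorbs the error terms of
  a product and makes \<open>c\<close> submultiplicative.
\<close>

definition Domk :: "bool set \<Rightarrow> ('i \<Rightarrow> bool \<Rightarrow> int) \<Rightarrow> ('i \<times> bool \<Rightarrow> int bop) \<Rightarrow> real \<Rightarrow>
    (int \<Rightarrow> ennreal) \<Rightarrow> (bool \<Rightarrow> int \<Rightarrow> int \<Rightarrow> ennreal) \<Rightarrow> bool" where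
  "Domk E s F c \<mu> k \<longleftrightarrow> wnorm \<mu> \<le> ennreal (c / 4) \<and> (\<Sum>e\<in>E. knorm (k e)) \<le> ennreal (c / 4) \<and>
     (\<forall>x. ldom \<mu> (F x)) \<and>
     (\<forall>i. proj (cells E (s i)) * F (i, False) = F (i, False) * proj (cells E (s i))) \<and>
     (\<forall>i. \<forall>j\<in>cells E (s i). \<forall>l\<in>cells E (s i). ennreal (cmod (entry (F (i, True) - F (i, False)) j l))
         \<le> (\<Sum>e\<in>E. k e (j - s i e) (l - s i e)))"

lemma DomkD:
  assumes "Domk E s F c \<mu> k"
  shows "wnorm \<mu> \<le> ennreal (c / 4)" "(\<Sum>e\<in>E. knorm (k e)) \<le> ennreal (c / 4)"
    "\<And>x. ldom \<mu> (F x)" "\<And>i. proj (cells E (s i)) * F (i, False) = F (i, False) * proj (cells E (s i))"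
    "\<And>i j l. j \<in> cells E (s i) \<Longrightarrow> l \<in> cells E (s i) \<Longrightarrow> ennreal (cmod (entry (F (i, True) - F (i, False)) j l))
         \<le> (\<Sum>e\<in>E. k e (j - s i e) (l - s i e))"
  using assms unfolding Domk_def by blast+

definition Dom :: "bool set \<Rightarrow> ('i \<Rightarrow> bool \<Rightarrow> int) \<Rightarrow> ('i \<times> bool \<Rightarrow> int bop) \<Rightarrow> real \<Rightarrow> bool" where
  "Dom E s F c \<longleftrightarrow> 0 \<le> c \<and> (\<exists>\<mu> k. Domk E s F c \<mu> k)"

lemma diff_diff_same: "a - c - (b - c) = a - (b :: int)"
  by simp

lemma Dom_mult:
  fixes s :: "'i \<Rightarrow> bool \<Rightarrow> int"
  assumes "Dom E s F c" "Dom E s F' c'"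
  shows "Dom E s (\<lambda>x. F x * F' x) (c * c')"
proof -
  let ?J = "\<lambda>i. cells E (s i)"
  obtain \<mu> k where c: "0 \<le> c" and "Domk E s F c \<mu> k"
    using assms(1) unfolding Dom_def by blast
  note m = DomkD[OF this(2)]
  obtain \<mu>' k' where c': "0 \<le> c'" and "Domk E s F' c' \<mu>' k'"
    using assms(2) unfolding Dom_def by blast
  note m' = DomkD[OF this(2)]
  define k2 where "k2 e a b = esum (\<lambda>x. k e a x * \<mu>' (x - b))" for e a b
  define k3 where "k3 e a b = esum (\<lambda>x. \<mu> (a - x) * k' e x b)" for e a b
  define K where "K e a b = hkernel \<mu> \<mu>' e a b + k2 e a b + k3 e a b" for e a b
  have wc: "wnorm (conv \<mu> \<mu>') \<le> ennreal (c * c' / 4)"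
  proof -
    have "wnorm (conv \<mu> \<mu>') \<le> ennreal (c / 4) * ennreal (c' / 4)"
      using wnorm_conv mult_mono[OF m(1) m'(1)] by (rule order_trans) auto
    also have "\<dots> = ennreal (c * c' / 16)" using c c' by (simp add: ennreal_mult[symmetric])
    also have "\<dots> \<le> ennreal (c * c' / 4)" using c c' by (intro ennreal_leI) simp
    finally show ?thesis .
  qed
  \<comment> \<open>Each summand is at most c c' / 16. The Hankel term occurs up to twice, once for
    each possible end point, and the two error terms once each, so the total is c c' / 4. This is
    the origin of the constant 4 in \<open>Domk\<close>.\<close>
  have kn: "(\<Sum>e\<in>E. knorm (K e)) \<le> ennreal (c * c' / 4)"
  proof -
    have "knorm (K e) = knorm (hkernel \<mu> \<mu>' e) + knorm (k2 e) + knorm (k3 e)" for e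
      by (simp add: K_def knorm_def esum_add)
    then have "(\<Sum>e\<in>E. knorm (K e)) = (\<Sum>e\<in>E. knorm (hkernel \<mu> \<mu>' e)) + (\<Sum>e\<in>E. knorm (k2 e)) + (\<Sum>e\<in>E. knorm (k3 e))"
      by (simp add: sum.distrib)
    also have "\<dots> \<le> (\<Sum>e\<in>(UNIV :: bool set). wnorm \<mu> * wnorm \<mu>') + (\<Sum>e\<in>E. knorm (k e) * wnorm \<mu>') + (\<Sum>e\<in>E. wnorm \<mu> * knorm (k' e))"
      unfolding k2_def k3_def
      by (intro add_mono sum_mono knorm_kernel_conv knorm_conv_kernel
          order_trans[OF sum_mono[OF knorm_hkernel] sum_mono2]) auto
    also have "\<dots> = wnorm \<mu> * wnorm \<mu>' + wnorm \<mu> * wnorm \<mu>' + (\<Sum>e\<in>E. knorm (k e)) * wnorm \<mu>' + wnorm \<mu> * (\<Sum>e\<in>E. knorm (k' e))"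
      by (simp add: UNIV_bool sum_distrib_left sum_distrib_right mult_2)
    also have "\<dots> \<le> ennreal (c / 4) * ennreal (c' / 4) + ennreal (c / 4) * ennreal (c' / 4)
        + ennreal (c / 4) * ennreal (c' / 4) + ennreal (c / 4) * ennreal (c' / 4)"
      by (intro add_mono mult_mono m m') auto
    also have "\<dots> = ennreal (c * c' / 4)"
      using c c' by (simp add: ennreal_mult[symmetric] ennreal_plus[symmetric] del: ennreal_plus)
    finally show ?thesis .
  qed
  have comm: "proj (?J i) * (F (i, False) * F' (i, False)) = (F (i, False) * F' (i, False)) * proj (?J i)" for i
    by (metis m(4) m'(4) mult.assoc)
  have D: "ennreal (cmod (entry (F (i, True) * F' (i, True) - F (i, False) * F' (i, False)) j l))
       \<le> (\<Sum>e\<in>E. K e (j - s i e) (l - s i e))" if j: "j \<in> ?J i" and l: "l \<in> ?J i" for i j l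
  proof -
    let ?X = "F (i, True)" and ?Z = "F (i, False)" and ?X' = "F' (i, True)" and ?Z' = "F' (i, False)"
    let ?P = "proj (?J i)" and ?Q = "proj (- ?J i)"
    \<comment> \<open>As \<open>?Z'\<close> commutes with \<open>?P\<close>, the projection may be
      inserted between the factors for a column inside the interval.\<close>
    have zz: "entry (?Z * ?Z') j l = entry (?Z * (?P * ?Z')) j l"
    proof -
      have "?Z * (?P * ?Z') = (?Z * ?Z') * ?P" by (simp add: m'(4) mult.assoc)
      then show ?thesis using l by (simp add: entry_proj_right)
    qed
    have PQ: "?Q = 1 - ?P" by (rule proj_compl)
    \<comment> \<open>The first term passes through the complement of the interval and is a Hankel
      product; the other two carry the error kernel of one factor.\<close>
    have "?X * ?X' - ?Z * (?P * ?Z') = ?X * (?Q * ?X') + (?X - ?Z) * (?P * ?X') + ?Z * (?P * (?X' - ?Z'))"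
      unfolding PQ by (simp add: algebra_simps)
    then have eq: "entry (?X * ?X' - ?Z * ?Z') j l = entry (?X * (?Q * ?X')) j l + entry ((?X - ?Z) * (?P * ?X')) j l + entry (?Z * (?P * (?X' - ?Z'))) j l"
      by (metis entry_add entry_diff zz)
    have 1: "ennreal (cmod (entry (?X * (?Q * ?X')) j l)) \<le> (\<Sum>e\<in>E. hkernel \<mu> \<mu>' e (j - s i e) (l - s i e))"
    proof -
      have "ennreal (cmod (entry (?X * (?Q * ?X')) j l)) \<le> esum (\<lambda>x. ennreal (cmod (entry ?X j x)) * ennreal (cmod (entry (?Q * ?X') x l)))"
        by (rule entry_times_le)
      also have "\<dots> \<le> esum (\<lambda>x. \<Sum>e\<in>E. if \<not> inside e (x - s i e) then \<mu> (j - x) * \<mu>' (x - l) else 0)"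
      proof (rule esum_mono)
        fix x
        show "ennreal (cmod (entry ?X j x)) * ennreal (cmod (entry (?Q * ?X') x l)) \<le> (\<Sum>e\<in>E. if \<not> inside e (x - s i e) then \<mu> (j - x) * \<mu>' (x - l) else 0)"
        proof (cases "x \<in> ?J i")
          case True
          then show ?thesis by (simp add: entry_proj_left)
        next
          case False
          \<comment> \<open>A point outside the interval violates the condition at one of its end
            points, and the term is charged to that end.\<close>
          then obtain e where e: "e \<in> E" "\<not> inside e (x - s i e)" by (auto simp: cells_def)
          have "ennreal (cmod (entry ?X j x)) * ennreal (cmod (entry (?Q * ?X') x l)) \<le> \<mu> (j - x) * \<mu>' (x - l)"
            using False by (auto simp: entry_proj_left intro!: mult_mono ldomD[OF m(3)] ldomD[OF m'(3)])
          also have "\<dots> = (if \<not> inside e (x - s i e) then \<mu> (j - x) * \<mu>' (x - l) else 0)" using e by simp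
          also have "\<dots> \<le> (\<Sum>e\<in>E. if \<not> inside e (x - s i e) then \<mu> (j - x) * \<mu>' (x - l) else 0)"
            by (rule member_le_sum) (use e in auto)
          finally show ?thesis .
        qed
      qed
      also have "\<dots> = (\<Sum>e\<in>E. esum (\<lambda>x. if \<not> inside e (x - s i e) then \<mu> (j - x) * \<mu>' (x - l) else 0))"
        by (rule esum_sum)
      also have "\<dots> = (\<Sum>e\<in>E. hkernel \<mu> \<mu>' e (j - s i e) (l - s i e))"
      proof (rule sum.cong[OF refl])
        fix e assume "e \<in> E"
        then have "inside e (j - s i e)" "inside e (l - s i e)" using j l by (auto simp: cells_def)
        moreover have "esum (\<lambda>x. if \<not> inside e (x - s i e) then \<mu> (j - x) * \<mu>' (x - l) else 0)
           = esum (\<lambda>x. if \<not> inside e x then \<mu> (j - s i e - x) * \<mu>' (x - (l - s i e)) else 0)"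
          using esum_minus_right[of "\<lambda>x. if \<not> inside e x then \<mu> (j - s i e - x) * \<mu>' (x - (l - s i e)) else 0" "s i e"]
          by (simp only: diff_diff_same)
        ultimately show "esum (\<lambda>x. if \<not> inside e (x - s i e) then \<mu> (j - x) * \<mu>' (x - l) else 0) = hkernel \<mu> \<mu>' e (j - s i e) (l - s i e)"
          by (simp add: hkernel_def)
      qed
      finally show ?thesis .
    qed
    have 2: "ennreal (cmod (entry ((?X - ?Z) * (?P * ?X')) j l)) \<le> (\<Sum>e\<in>E. k2 e (j - s i e) (l - s i e))"
    proof -
      have "ennreal (cmod (entry ((?X - ?Z) * (?P * ?X')) j l)) \<le> esum (\<lambda>x. ennreal (cmod (entry (?X - ?Z) j x)) * ennreal (cmod (entry (?P * ?X') x l)))"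
        by (rule entry_times_le)
      also have "\<dots> \<le> esum (\<lambda>x. \<Sum>e\<in>E. k e (j - s i e) (x - s i e) * \<mu>' (x - l))"
        unfolding sum_distrib_right[symmetric]
        by (rule esum_mono) (auto simp: entry_proj_left intro!: mult_mono m(5) ldomD[OF m'(3)] j)
      also have "\<dots> = (\<Sum>e\<in>E. esum (\<lambda>x. k e (j - s i e) (x - s i e) * \<mu>' (x - l)))"
        by (rule esum_sum)
      also have "\<dots> = (\<Sum>e\<in>E. k2 e (j - s i e) (l - s i e))"
      proof (rule sum.cong[OF refl])
        fix e
        show "esum (\<lambda>x. k e (j - s i e) (x - s i e) * \<mu>' (x - l)) = k2 e (j - s i e) (l - s i e)"
          using esum_minus_right[of "\<lambda>x. k e (j - s i e) x * \<mu>' (x - (l - s i e))" "s i e"]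
          by (simp only: k2_def diff_diff_same)
      qed
      finally show ?thesis .
    qed
    have 3: "ennreal (cmod (entry (?Z * (?P * (?X' - ?Z'))) j l)) \<le> (\<Sum>e\<in>E. k3 e (j - s i e) (l - s i e))"
    proof -
      have "ennreal (cmod (entry (?Z * (?P * (?X' - ?Z'))) j l)) \<le> esum (\<lambda>x. ennreal (cmod (entry ?Z j x)) * ennreal (cmod (entry (?P * (?X' - ?Z')) x l)))"
        by (rule entry_times_le)
      also have "\<dots> \<le> esum (\<lambda>x. \<Sum>e\<in>E. \<mu> (j - x) * k' e (x - s i e) (l - s i e))"
        unfolding sum_distrib_left[symmetric]
        by (rule esum_mono) (auto simp: entry_proj_left intro!: mult_mono m'(5) ldomD[OF m(3)] l)
      also have "\<dots> = (\<Sum>e\<in>E. esum (\<lambda>x. \<mu> (j - x) * k' e (x - s i e) (l - s i e)))"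
        by (rule esum_sum)
      also have "\<dots> = (\<Sum>e\<in>E. k3 e (j - s i e) (l - s i e))"
      proof (rule sum.cong[OF refl])
        fix e
        show "esum (\<lambda>x. \<mu> (j - x) * k' e (x - s i e) (l - s i e)) = k3 e (j - s i e) (l - s i e)"
          using esum_minus_right[of "\<lambda>x. \<mu> (j - s i e - x) * k' e x (l - s i e)" "s i e"]
          by (simp only: k3_def diff_diff_same)
      qed
      finally show ?thesis .
    qed
    have tri: "cmod (a + b + d) \<le> cmod a + cmod b + cmod d" for a b d
      by (metis add_mono norm_triangle_ineq order_refl order_trans)
    have "ennreal (cmod (entry (?X * ?X' - ?Z * ?Z') j l)) \<le> ennreal (cmod (entry (?X * (?Q * ?X')) j l) + cmod (entry ((?X - ?Z) * (?P * ?X')) j l) + cmod (entry (?Z * (?P * (?X' - ?Z'))) j l))"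
      unfolding eq by (rule ennreal_leI[OF tri])
    also have "\<dots> = ennreal (cmod (entry (?X * (?Q * ?X')) j l)) + ennreal (cmod (entry ((?X - ?Z) * (?P * ?X')) j l)) + ennreal (cmod (entry (?Z * (?P * (?X' - ?Z'))) j l))"
      by simp
    also have "\<dots> \<le> (\<Sum>e\<in>E. hkernel \<mu> \<mu>' e (j - s i e) (l - s i e)) + (\<Sum>e\<in>E. k2 e (j - s i e) (l - s i e)) + (\<Sum>e\<in>E. k3 e (j - s i e) (l - s i e))"
      by (intro add_mono 1 2 3)
    also have "\<dots> = (\<Sum>e\<in>E. K e (j - s i e) (l - s i e))" by (simp add: K_def sum.distrib)
    finally show ?thesis .
  qed
  show ?thesis unfolding Dom_def Domk_def
    using c c' wc kn comm D ldom_mult[OF m(3) m'(3)]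
    by (intro conjI exI[of _ "conv \<mu> \<mu>'"] exI[of _ K]) (auto simp: mult.assoc)
qed

text \<open>The majorant of the unit has norm 1, which must be at most c / 4; hence the constant 4.
  The bounds are chosen before the index, so products and series remain uniform in it.\<close>

lemma gauge_Dom: "gauge (Dom E (s :: 'i \<Rightarrow> bool \<Rightarrow> int)) 4"
proof
  show "Dom E s (\<lambda>_. 1) 4"
    unfolding Dom_def Domk_def
    by (intro conjI exI[of _ "\<lambda>n. if n = 0 then 1 else 0"] exI[of _ "\<lambda>e i j. 0"])
       (auto simp: ldom_one wnorm_delta knorm_def entry_zero)
next
  fix F F' :: "'i \<times> bool \<Rightarrow> int bop" and c c' assume "Dom E s F c" "Dom E s F' c'"
  then show "Dom E s (\<lambda>i. F i * F' i) (c * c')" by (rule Dom_mult)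
next
  fix F :: "'i \<times> bool \<Rightarrow> int bop" and c t :: real assume "Dom E s F c" and t: "0 \<le> t"
  then obtain \<mu> k where c: "0 \<le> c" and "Domk E s F c \<mu> k"
    unfolding Dom_def by blast
  note m = DomkD[OF this(2)]
  have "ldom (\<lambda>n. ennreal t * \<mu> n) (t *\<^sub>R F x)" for x
    using m(3)[of x] t by (simp add: ldom_def entry_scaleR ennreal_mult mult_left_mono)
  moreover have "wnorm (\<lambda>n. ennreal t * \<mu> n) \<le> ennreal (t * c / 4)"
    using mult_left_mono[OF m(1), of "ennreal t"] t c by (simp add: wnorm_scale ennreal_mult[symmetric])
  moreover have "(\<Sum>e\<in>E. knorm (\<lambda>a b. ennreal t * k e a b)) \<le> ennreal (t * c / 4)"
    using mult_left_mono[OF m(2), of "ennreal t"] t c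
    by (simp add: knorm_def esum_cmult sum_distrib_left[symmetric] ennreal_mult[symmetric])
  moreover have "proj (cells E (s i)) * t *\<^sub>R F (i, False) = t *\<^sub>R F (i, False) * proj (cells E (s i))" for i
    by (simp add: m(4))
  moreover have "ennreal (cmod (entry (t *\<^sub>R F (i, True) - t *\<^sub>R F (i, False)) j l)) \<le> (\<Sum>e\<in>E. ennreal t * k e (j - s i e) (l - s i e))"
    if "j \<in> cells E (s i)" "l \<in> cells E (s i)" for i j l
    using mult_left_mono[OF m(5)[OF that], of "ennreal t"] t
    by (simp add: scaleR_diff_right[symmetric] entry_scaleR ennreal_mult sum_distrib_left[symmetric])
  ultimately show "Dom E s (\<lambda>i. t *\<^sub>R F i) (t * c)"
    unfolding Dom_def Domk_def using t c
    by (intro conjI exI[of _ "\<lambda>n. ennreal t * \<mu> n"] exI[of _ "\<lambda>e a b. ennreal t * k e a b"]) auto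
next
  fix F :: "nat \<Rightarrow> 'i \<times> bool \<Rightarrow> int bop" and c S
  assume "\<And>n. Dom E s (F n) (c n)" and sc: "summable c" and S: "\<And>i. (\<lambda>k. F k i) sums S i"
  then have c: "\<And>n. 0 \<le> c n" and "\<forall>n. \<exists>\<mu> k. Domk E s (F n) (c n) \<mu> k"
    unfolding Dom_def by blast+
  then obtain \<mu> k where "\<And>n. Domk E s (F n) (c n) (\<mu> n) (k n)" by metis
  note m = DomkD[OF this]
  have sc4: "summable (\<lambda>n. c n / 4)" "suminf c / 4 = (\<Sum>n. c n / 4)"
    using sc by (simp_all add: suminf_divide)
  have "wnorm (\<lambda>x. \<Sum>n. \<mu> n x) \<le> ennreal (suminf c / 4)"
    unfolding wnorm_suminf sc4 by (rule suminf_le_ennreal) (use m c sc4 in auto)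
  moreover have "(\<Sum>e\<in>E. knorm (\<lambda>a b. \<Sum>n. k n e a b)) \<le> ennreal (suminf c / 4)"
  proof -
    have "(\<Sum>e\<in>E. knorm (\<lambda>a b. \<Sum>n. k n e a b)) = (\<Sum>e\<in>E. \<Sum>n. knorm (k n e))"
      by (simp add: knorm_def esum_suminf)
    also have "\<dots> = (\<Sum>n. \<Sum>e\<in>E. knorm (k n e))"
      by (rule suminf_sum[symmetric]) (rule summableI)
    also have "\<dots> \<le> ennreal (suminf c / 4)"
      unfolding sc4 by (rule suminf_le_ennreal) (use m c sc4 in auto)
    finally show ?thesis .
  qed
  moreover have "proj (cells E (s i)) * S (i, False) = S (i, False) * proj (cells E (s i))" for i
  proof -
    have "(\<lambda>n. proj (cells E (s i)) * F n (i, False)) sums (proj (cells E (s i)) * S (i, False))"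
      by (intro sums_mult S)
    moreover have "(\<lambda>n. proj (cells E (s i)) * F n (i, False)) sums (S (i, False) * proj (cells E (s i)))"
      unfolding m(4) by (intro sums_mult2 S)
    ultimately show ?thesis by (rule sums_unique2)
  qed
  moreover have "ennreal (cmod (entry (S (i, True) - S (i, False)) j l)) \<le> (\<Sum>e\<in>E. \<Sum>n. k n e (j - s i e) (l - s i e))"
    if jl: "j \<in> cells E (s i)" "l \<in> cells E (s i)" for i j l
  proof -
    have "ennreal (cmod (entry (S (i, True) - S (i, False)) j l)) \<le> (\<Sum>n. \<Sum>e\<in>E. k n e (j - s i e) (l - s i e))"
      by (rule entry_sums_le[OF sums_diff[OF S S]]) (rule m(5)[OF jl])
    also have "\<dots> = (\<Sum>e\<in>E. \<Sum>n. k n e (j - s i e) (l - s i e))"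
      by (rule suminf_sum) (rule summableI)
    finally show ?thesis .
  qed
  ultimately show "Dom E s S (suminf c)"
    unfolding Dom_def Domk_def using suminf_nonneg[OF sc c] ldom_sums[OF m(3) S]
    by (intro conjI exI[of _ "\<lambda>x. \<Sum>n. \<mu> n x"] exI[of _ "\<lambda>e a b. \<Sum>n. k n e a b"]) auto
qed (auto simp: Dom_def)

text \<open>On the interval a compression coincides with the operator itself, so its error kernel is
  zero. Errors arise only through products.\<close>

lemma Dom_compression:
  assumes "\<And>i. ldom \<mu> (B i)" "wnorm \<mu> < Orderings.top"
  shows "\<exists>c. Dom E s (\<lambda>(i, b). if b then B i else proj (cells E (s i)) * B i * proj (cells E (s i))) c"
proof (rule exI[of _ "4 * enn2real (wnorm \<mu>)"])
  show "Dom E s (\<lambda>(i, b). if b then B i else proj (cells E (s i)) * B i * proj (cells E (s i))) (4 * enn2real (wnorm \<mu>))"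
    unfolding Dom_def Domk_def using assms(2)
    by (intro conjI exI[of _ \<mu>] exI[of _ "\<lambda>e i j. 0"])
       (auto simp: assms(1) ldom_proj knorm_def entry_diff entry_proj_left entry_proj_right proj_idem proj_idem' mult.assoc[symmetric] mult.assoc[of _ "proj J" "proj J" for J])
qed

end

section \<open>The weight\<close>

text \<open>The minimum is the product of its powers with exponents \<alpha> and \<beta>, since
  these add up to 1. Here the normalisation of the exponents enters.\<close>

lemma min_le_powr:
  assumes "a > 0" "b > 0" "\<alpha> \<ge> 0" "\<beta> \<ge> 0" "\<alpha> + \<beta> = (1::real)"
  shows "min a b \<le> (1 + a) powr \<alpha> * (1 + b) powr \<beta>"
proof -
  have "min a b = min a b powr \<alpha> * min a b powr \<beta>"
    using assms by (simp add: powr_add[symmetric])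
  also have "\<dots> \<le> (1 + a) powr \<alpha> * (1 + b) powr \<beta>"
    using assms by (intro mult_mono powr_mono2) auto
  finally show ?thesis .
qed

text \<open>For equal signs this is 1 + |m + n| <= (1 + |m|)(1 + |n|). For opposite signs m + n has
  the sign of one summand and at most its modulus, so the weight of that summand suffices and the
  other weight is at least 1.\<close>

lemma alpha_weight_submult:
  assumes "\<alpha>1 \<ge> 0" "\<alpha>2 \<ge> 0"
  shows "alpha_weight \<alpha>1 \<alpha>2 (m + n) \<le> alpha_weight \<alpha>1 \<alpha>2 m * alpha_weight \<alpha>1 \<alpha>2 n"
proof -
  have ge1: "1 \<le> (1 + \<bar>real_of_int x\<bar>) powr a" if "a \<ge> 0" for x a
    using that by (intro ge_one_powr_ge_zero) auto
  have sub: "(1 + \<bar>real_of_int (x + y)\<bar>) powr a \<le> (1 + \<bar>real_of_int x\<bar>) powr a * (1 + \<bar>real_of_int y\<bar>) powr a" if "a \<ge> 0" for x y a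
  proof -
    have "0 \<le> \<bar>real_of_int x\<bar> * \<bar>real_of_int y\<bar>" by simp
    then have "1 + \<bar>real_of_int (x + y)\<bar> \<le> (1 + \<bar>real_of_int x\<bar>) * (1 + \<bar>real_of_int y\<bar>)"
      using abs_triangle_ineq[of "real_of_int x" "real_of_int y"]
      unfolding of_int_add distrib_left distrib_right mult_1_left mult_1_right by linarith
    then show ?thesis using that by (subst powr_mult[symmetric]) (auto intro!: powr_mono2)
  qed
  have small: "(1 + \<bar>real_of_int z\<bar>) powr a \<le> (1 + \<bar>real_of_int x\<bar>) powr a * (1 + \<bar>real_of_int y\<bar>) powr b"
    if "\<bar>z\<bar> \<le> \<bar>x\<bar>" "a \<ge> 0" "b \<ge> 0" for x y z a b
  proof -
    have "(1 + \<bar>real_of_int z\<bar>) powr a * 1 \<le> (1 + \<bar>real_of_int x\<bar>) powr a * (1 + \<bar>real_of_int y\<bar>) powr b"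
      using that by (intro mult_mono powr_mono2 ge1) auto
    then show ?thesis by simp
  qed
  have eq: "alpha_weight \<alpha>1 \<alpha>2 k = (if 0 \<le> k then (1 + \<bar>real_of_int k\<bar>) powr \<alpha>1 else (1 + \<bar>real_of_int k\<bar>) powr \<alpha>2)" for k
    by (simp add: alpha_weight_def)
  consider "0 \<le> m" "0 \<le> n" | "m < 0" "n < 0" | "0 \<le> m" "n < 0" "0 \<le> m + n" | "0 \<le> m" "n < 0" "m + n < 0"
    | "m < 0" "0 \<le> n" "0 \<le> m + n" | "m < 0" "0 \<le> n" "m + n < 0" by linarith
  then show ?thesis
  proof cases
    case 1 then show ?thesis using sub[OF assms(1), of m n] by (simp add: eq)
  next
    case 2 then show ?thesis using sub[OF assms(2), of m n] by (simp add: eq)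
  next
    case 3 then show ?thesis using small[of "m + n" m \<alpha>1 \<alpha>2 n] assms by (simp add: eq)
  next
    case 4 then show ?thesis using small[of "m + n" n \<alpha>2 \<alpha>1 m] assms by (simp add: eq mult.commute)
  next
    case 5 then show ?thesis using small[of "m + n" n \<alpha>1 \<alpha>2 m] assms by (simp add: eq mult.commute)
  next
    case 6 then show ?thesis using small[of "m + n" m \<alpha>2 \<alpha>1 n] assms by (simp add: eq)
  qed
qed

lemma esum_count_int:
  "esum (\<lambda>x. if a \<le> x \<and> x < b then 1 else 0) = ennreal (real_of_int (max 0 (b - a)))"
proof -
  have "esum (\<lambda>x. if a \<le> x \<and> x < b then 1 else 0 :: ennreal) = (\<Sum>x\<in>{a..<b}. if a \<le> x \<and> x < b then 1 else 0)"
    by (rule esum_finite_support) auto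
  also have "\<dots> = of_nat (nat (b - a))" by (simp add: sum.If_cases Int_def)
  also have "\<dots> = ennreal (real (nat (b - a)))" by (rule ennreal_of_nat_eq_real_of_nat)
  also have "real (nat (b - a)) = real_of_int (max 0 (b - a))" by simp
  finally show ?thesis .
qed

lemma weight_alpha:
  assumes "\<alpha>1 \<ge> 0" "\<alpha>2 \<ge> 0" "\<alpha>1 + \<alpha>2 = 1"
  shows "weight (\<lambda>n. ennreal (alpha_weight \<alpha>1 \<alpha>2 n))"
proof
  let ?w = "alpha_weight \<alpha>1 \<alpha>2"
  have ge1: "1 \<le> ?w n" for n
    unfolding alpha_weight_def using assms by (auto intro!: ge_one_powr_ge_zero)
  then have ge0: "0 \<le> ?w n" for n by (meson order_trans zero_le_one)
  show "1 \<le> ennreal (?w n)" for n using ge1[of n] by (metis ennreal_1 ennreal_leI)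
  show "ennreal (?w 0) = 1" by (simp add: alpha_weight_def)
  show "ennreal (?w (m + n)) \<le> ennreal (?w m) * ennreal (?w n)" for m n
    using alpha_weight_submult[OF assms(1,2), of m n] ge0 by (simp add: ennreal_mult[symmetric] ennreal_leI)
  show "esum (\<lambda>x. if x < 0 \<and> 0 \<le> x + m \<and> 0 \<le> x - n then 1 else 0) \<le> ennreal (?w m) * ennreal (?w n)" for m n
  proof -
    \<comment> \<open>The points counted form the integer interval from max (-m) n up to -1. Its
      length is min m (-n) if m > 0 and n < 0, and otherwise it is empty.\<close>
    have "(\<lambda>x. if x < 0 \<and> 0 \<le> x + m \<and> 0 \<le> x - n then 1 else 0 :: ennreal) = (\<lambda>x. if max (- m) n \<le> x \<and> x < 0 then 1 else 0)"
      by (intro ext if_cong) auto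
    then have "esum (\<lambda>x. if x < 0 \<and> 0 \<le> x + m \<and> 0 \<le> x - n then 1 else 0) = ennreal (real_of_int (max 0 (0 - max (- m) n)))"
      by (simp only: esum_count_int)
    also have "\<dots> \<le> ennreal (?w m * ?w n)"
    proof (rule ennreal_leI)
      show "real_of_int (max 0 (0 - max (- m) n)) \<le> ?w m * ?w n"
      proof (cases "m > 0 \<and> n < 0")
        case True
        then have "real_of_int (max 0 (0 - max (- m) n)) = min (real_of_int m) (real_of_int (- n))" by auto
        also have "\<dots> \<le> (1 + real_of_int m) powr \<alpha>1 * (1 + real_of_int (- n)) powr \<alpha>2"
          using True assms by (intro min_le_powr) auto
        finally show ?thesis using True by (simp add: alpha_weight_def)
      next
        case False
        then have "max 0 (0 - max (- m) n) = 0" by auto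
        then show ?thesis using ge0[of m] ge0[of n] by (simp del: max_def)
      qed
    qed
    finally show ?thesis using ge0 by (simp add: ennreal_mult)
  qed
  show "esum (\<lambda>x. if 0 \<le> x \<and> x + m < 0 \<and> x - n < 0 then 1 else 0) \<le> ennreal (?w m) * ennreal (?w n)" for m n
  proof -
    have "(\<lambda>x. if 0 \<le> x \<and> x + m < 0 \<and> x - n < 0 then 1 else 0 :: ennreal) = (\<lambda>x. if 0 \<le> x \<and> x < min (- m) n then 1 else 0)"
      by (intro ext if_cong) auto
    then have "esum (\<lambda>x. if 0 \<le> x \<and> x + m < 0 \<and> x - n < 0 then 1 else 0) = ennreal (real_of_int (max 0 (min (- m) n - 0)))"
      by (simp only: esum_count_int)
    also have "\<dots> \<le> ennreal (?w m * ?w n)"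
    proof (rule ennreal_leI)
      show "real_of_int (max 0 (min (- m) n - 0)) \<le> ?w m * ?w n"
      proof (cases "m < 0 \<and> n > 0")
        case True
        then have "real_of_int (max 0 (min (- m) n - 0)) = min (real_of_int (- m)) (real_of_int n)" by auto
        also have "\<dots> \<le> (1 + real_of_int (- m)) powr \<alpha>2 * (1 + real_of_int n) powr \<alpha>1"
          using True assms by (intro min_le_powr) auto
        finally show ?thesis using True by (simp add: alpha_weight_def)
      next
        case False
        then have "max 0 (min (- m) n - 0) = 0" by auto
        then show ?thesis using ge0[of m] ge0[of n] by simp
      qed
    qed
    finally show ?thesis using ge0 by (simp add: ennreal_mult)
  qed
qed

section \<open>Compressed products of exponentials\<close>

text \<open>The operator under the determinant of \<Theta>1, written on the whole line with P X P in
  place of T(X). For P = 1 it is the identity.\<close>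

definition ratioL :: "int bop \<Rightarrow> int bop list \<Rightarrow> int bop" where
  "ratioL P Bs = P * exp_prod Bs * P * exp_prod (map (\<lambda>B. - (P * B * P)) (rev Bs))"

text \<open>The operator under the determinant of \<Theta>2, again on the whole line; the inverse of
  the product is written as the product of the inverse exponentials in reverse order.\<close>

definition ratioR :: "int bop \<Rightarrow> int bop list \<Rightarrow> int bop" where
  "ratioR P Bs = exp_prod (map (\<lambda>B. P * B * P) Bs) * (P * exp_prod (map uminus (rev Bs)) * P)"

context weight
begin

definition tame :: "('i \<Rightarrow> int bop) \<Rightarrow> bool" where
  "tame B \<longleftrightarrow> (\<exists>\<mu>. wnorm \<mu> < Orderings.top \<and> (\<forall>i. ldom \<mu> (B i)))"

lemma tame_uminus: "tame B \<Longrightarrow> tame (\<lambda>i. - B i)"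
  by (simp add: tame_def ldom_uminus)

lemma tame_Dom:
  assumes "tame B"
  shows "\<exists>c. Dom E s (\<lambda>(i, b). if b then B i else proj (cells E (s i)) * B i * proj (cells E (s i))) c"
  using assms Dom_compression unfolding tame_def by blast

text \<open>Without end points the interval is the whole line, and the gauge \<open>Dom\<close>
  records just the Laurent majorant.\<close>

lemma tame_exp_prod:
  assumes "\<And>B. B \<in> set Bs \<Longrightarrow> tame (B :: 'i \<Rightarrow> int bop)"
  shows "tame (\<lambda>i. exp_prod (map (\<lambda>B. B i) Bs))"
proof -
  define s :: "'i \<Rightarrow> bool \<Rightarrow> int" where "s = (\<lambda>_ _. 0)"
  interpret gauge "Dom {} s" 4 by (rule gauge_Dom)
  define pr where "pr B = (\<lambda>(i, b). if b then B i else proj (cells {} (s i)) * B i * proj (cells {} (s i)))" for B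
  have "\<exists>c. Dom {} s (\<lambda>x. exp_prod (map (\<lambda>B. B x) (map pr Bs))) c"
    by (rule exp_prod) (auto simp: pr_def intro!: tame_Dom assms)
  then obtain c \<mu> k where "Domk {} s (\<lambda>x. exp_prod (map (\<lambda>B. B x) (map pr Bs))) c \<mu> k"
    unfolding Dom_def by blast
  note m = DomkD[OF this]
  have "ldom \<mu> (exp_prod (map (\<lambda>B. B i) Bs))" for i
    using m(3)[of "(i, True)"] by (simp add: pr_def o_def)
  moreover have "wnorm \<mu> < Orderings.top" using m(1) by (rule le_less_trans) simp
  ultimately show ?thesis unfolding tame_def by blast
qed

text \<open>The ratio is the compressed component of a product of families whose full component
  telescopes to 1. Its defect is thus the difference controlled by the gauge, with kernels
  \<open>k e\<close> that do not depend on \<open>i\<close>.\<close>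

lemma ratioL_ratioR_dominated:
  fixes Bs :: "('i \<Rightarrow> int bop) list"
  assumes B: "\<And>B. B \<in> set Bs \<Longrightarrow> tame B"
  shows "\<exists>k. (\<Sum>e\<in>E. knorm (k e)) < Orderings.top \<and> (\<forall>i. \<forall>j\<in>cells E (s i). \<forall>l\<in>cells E (s i).
    ennreal (cmod (entry (1 - ratioL (proj (cells E (s i))) (map (\<lambda>B. B i) Bs)) j l)) \<le> (\<Sum>e\<in>E. k e (j - s i e) (l - s i e)))"
   (is "\<exists>k. ?A k")
  and "\<exists>k. (\<Sum>e\<in>E. knorm (k e)) < Orderings.top \<and> (\<forall>i. \<forall>j\<in>cells E (s i). \<forall>l\<in>cells E (s i).
    ennreal (cmod (entry (1 - ratioR (proj (cells E (s i))) (map (\<lambda>B. B i) Bs)) j l)) \<le> (\<Sum>e\<in>E. k e (j - s i e) (l - s i e)))"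
   (is "\<exists>k. ?B k")
proof -
  interpret gauge "Dom E s" 4 by (rule gauge_Dom)
  define pr where "pr B = (\<lambda>(i, b). if b then B i else proj (cells E (s i)) * B i * proj (cells E (s i)))" for B
  define neg where "neg = map (\<lambda>B i. - B i) (rev Bs)"
  have neg: "B \<in> set neg \<Longrightarrow> tame B" for B
    using assms tame_uminus by (auto simp: neg_def)
  define C where "C i = exp_prod (map (\<lambda>B. B i) Bs)" for i
  define C' where "C' i = exp_prod (map (\<lambda>B. B i) neg)" for i
  have C: "tame C" "tame C'" unfolding C_def C'_def by (intro tame_exp_prod B neg; assumption)+
  have C'_eq: "C' i = exp_prod (map uminus (rev (map (\<lambda>B. B i) Bs)))" for i
    by (simp add: C'_def neg_def rev_map o_def)
  have e1: "\<exists>c. Dom E s (\<lambda>x. exp_prod (map (\<lambda>B. B x) (map pr Bs))) c"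
    by (rule exp_prod) (auto simp: pr_def intro!: tame_Dom assms)
  have e2: "\<exists>c. Dom E s (\<lambda>x. exp_prod (map (\<lambda>B. B x) (map pr neg))) c"
    by (rule exp_prod) (auto simp: pr_def intro!: tame_Dom neg)
  have p: "\<exists>c. Dom E s (pr C) c" "\<exists>c. Dom E s (pr C') c"
    unfolding pr_def by (intro tame_Dom C)+
  have fin: "x < Orderings.top" if "x \<le> ennreal c" for x c using that by (rule le_less_trans) simp
  obtain c where "Dom E s (\<lambda>x. pr C x * exp_prod (map (\<lambda>B. B x) (map pr neg))) c"
    using p(1) e2 mult by blast
  then obtain \<mu> k where "Domk E s (\<lambda>x. pr C x * exp_prod (map (\<lambda>B. B x) (map pr neg))) c \<mu> k"
    unfolding Dom_def by blast
  note m = DomkD[OF this]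
  have t: "pr C (i, True) * exp_prod (map (\<lambda>B. B (i, True)) (map pr neg)) = 1" for i
  proof -
    have "exp_prod (map (\<lambda>B. B (i, True)) (map pr neg)) = C' i" by (simp add: pr_def C'_def o_def)
    then show ?thesis unfolding C'_eq using exp_prod_inverse by (simp add: pr_def C_def)
  qed
  have f: "pr C (i, False) * exp_prod (map (\<lambda>B. B (i, False)) (map pr neg)) = ratioL (proj (cells E (s i))) (map (\<lambda>B. B i) Bs)" for i
    by (simp add: pr_def C_def ratioL_def neg_def o_def rev_map)
  have "?A k" using m(5) fin[OF m(2)] unfolding t f by blast
  then show "\<exists>k. ?A k" by blast
  obtain c where "Dom E s (\<lambda>x. exp_prod (map (\<lambda>B. B x) (map pr Bs)) * pr C' x) c"
    using p(2) e1 mult by blast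
  then obtain \<mu> k where "Domk E s (\<lambda>x. exp_prod (map (\<lambda>B. B x) (map pr Bs)) * pr C' x) c \<mu> k"
    unfolding Dom_def by blast
  note m = DomkD[OF this]
  have t: "exp_prod (map (\<lambda>B. B (i, True)) (map pr Bs)) * pr C' (i, True) = 1" for i
  proof -
    have "exp_prod (map (\<lambda>B. B (i, True)) (map pr Bs)) = C i" by (simp add: pr_def C_def o_def)
    then show ?thesis using exp_prod_inverse by (simp add: pr_def C_def C'_eq)
  qed
  have f: "exp_prod (map (\<lambda>B. B (i, False)) (map pr Bs)) * pr C' (i, False) = ratioR (proj (cells E (s i))) (map (\<lambda>B. B i) Bs)" for i
    by (simp add: pr_def C'_eq ratioR_def o_def)
  have "?B k" using m(5) fin[OF m(2)] unfolding t f by blast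
  then show "\<exists>k. ?B k" by blast
qed

lemma Conv_proj:
  assumes "\<And>j. \<forall>\<^sub>F n in sequentially. j \<in> J (Some n) \<longleftrightarrow> j \<in> J None"
  shows "\<exists>c. Conv (\<lambda>i. proj (J i)) c"
proof (rule ConvI)
  show "ldom (\<lambda>n. if n = 0 then 1 else 0) (proj (J i))" for i
    by (simp add: ldom_def entry_proj)
  show "wnorm (\<lambda>n. if n = 0 then 1 else 0) < Orderings.top" by (simp add: wnorm_delta)
  show "(\<lambda>n. entry (proj (J (Some n))) j l) \<longlonglongrightarrow> entry (proj (J None)) j l" for j l
    by (rule tendsto_eventually, rule eventually_mono[OF assms[of j]]) (auto simp: entry_proj)
qed

lemma Conv_mult': "\<exists>c. Conv F c \<Longrightarrow> \<exists>c. Conv F' c \<Longrightarrow> \<exists>c. Conv (\<lambda>i. F i * F' i) c"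
  using gauge.mult[OF gauge_Conv] by blast

lemma Conv_uminus': "\<exists>c. Conv F c \<Longrightarrow> \<exists>c. Conv (\<lambda>i. - F i) c"
  unfolding Conv_def ldom_uminus entry_uminus by (metis tendsto_minus)

lemma Conv_exp_prod':
  "(\<And>B. B \<in> set Bs \<Longrightarrow> \<exists>c. Conv B c) \<Longrightarrow> \<exists>c. Conv (\<lambda>i. exp_prod (map (\<lambda>B. B i) Bs)) c"
  by (rule gauge.exp_prod[OF gauge_Conv])

lemma ratioL_ratioR_Conv:
  fixes Bs :: "(nat option \<Rightarrow> int bop) list"
  assumes B: "\<And>B. B \<in> set Bs \<Longrightarrow> \<exists>c. Conv B c"
    and J: "\<And>j. \<forall>\<^sub>F n in sequentially. j \<in> J (Some n) \<longleftrightarrow> j \<in> J None"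
  shows "\<exists>c. Conv (\<lambda>i. ratioL (proj (J i)) (map (\<lambda>B. B i) Bs)) c"
    and "\<exists>c. Conv (\<lambda>i. ratioR (proj (J i)) (map (\<lambda>B. B i) Bs)) c"
proof -
  note P = Conv_proj[of J, OF J]
  have PBP: "\<exists>c. Conv (\<lambda>i. proj (J i) * B i * proj (J i)) c" if "\<exists>c. Conv B c" for B
    by (intro Conv_mult' P that)
  have "\<exists>c. Conv (\<lambda>i. exp_prod (map (\<lambda>B. B i) (map (\<lambda>B i. - (proj (J i) * B i * proj (J i))) (rev Bs)))) c"
    by (rule Conv_exp_prod') (auto intro!: Conv_uminus' PBP intro: B)
  then have 1: "\<exists>c. Conv (\<lambda>i. exp_prod (map (\<lambda>B. - (proj (J i) * B * proj (J i))) (rev (map (\<lambda>B. B i) Bs)))) c"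
    by (simp add: o_def rev_map)
  have "\<exists>c. Conv (\<lambda>i. exp_prod (map (\<lambda>B. B i) (map (\<lambda>B i. proj (J i) * B i * proj (J i)) Bs))) c"
    by (rule Conv_exp_prod') (auto intro!: PBP intro: B)
  then have 2: "\<exists>c. Conv (\<lambda>i. exp_prod (map (\<lambda>B. proj (J i) * B * proj (J i)) (map (\<lambda>B. B i) Bs))) c"
    by (simp add: o_def)
  have "\<exists>c. Conv (\<lambda>i. exp_prod (map (\<lambda>B. B i) (map (\<lambda>B i. - B i) (rev Bs)))) c"
    by (rule Conv_exp_prod') (auto intro!: Conv_uminus' intro: B)
  then have 3: "\<exists>c. Conv (\<lambda>i. exp_prod (map uminus (rev (map (\<lambda>B. B i) Bs)))) c"
    by (simp add: o_def rev_map)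
  show "\<exists>c. Conv (\<lambda>i. ratioL (proj (J i)) (map (\<lambda>B. B i) Bs)) c"
    unfolding ratioL_def by (intro Conv_mult' P 1 Conv_exp_prod' B)
  show "\<exists>c. Conv (\<lambda>i. ratioR (proj (J i)) (map (\<lambda>B. B i) Bs)) c"
    unfolding ratioR_def by (intro Conv_mult' P 2 3)
qed

end

section \<open>Two distant corners\<close>

lemma knorm_tail_tendsto_0:
  assumes "knorm k < Orderings.top"
  shows "(\<lambda>m. knorm (\<lambda>i j. if i \<in> {- int m..<int m} \<and> j \<in> {- int m..<int m} then 0 else k i j)) \<longlonglongrightarrow> 0"
proof -
  have eq: "knorm k = (\<integral>\<^sup>+x. k (fst x) (snd x) \<partial>count_space UNIV)" for k
    unfolding knorm_def esum_prod by (simp add: esum_def case_prod_unfold)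
  let ?u = "\<lambda>m x. if fst x \<in> {- int m..<int m} \<and> snd x \<in> {- int m..<int m} then 0 else k (fst x) (snd x)"
  have "(\<lambda>m. \<integral>\<^sup>+x. ?u m x \<partial>count_space UNIV) \<longlonglongrightarrow> (\<integral>\<^sup>+x. 0 \<partial>count_space (UNIV :: (int \<times> int) set))"
  proof (rule nn_integral_dominated_convergence[where w = "\<lambda>x. k (fst x) (snd x)"])
    show "(\<integral>\<^sup>+x. k (fst x) (snd x) \<partial>count_space UNIV) < \<infinity>" using assms by (simp add: eq)
    show "AE x in count_space UNIV. (\<lambda>m. ?u m x) \<longlonglongrightarrow> 0"
    proof (rule AE_I2)
      fix x :: "int \<times> int"
      have "\<forall>\<^sub>F m in sequentially. ?u m x = 0"
        unfolding eventually_sequentially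
        by (rule exI[of _ "nat (max \<bar>fst x\<bar> \<bar>snd x\<bar> + 1)"]) auto
      then show "(\<lambda>m. ?u m x) \<longlonglongrightarrow> 0" by (rule tendsto_eventually)
    qed
  qed auto
  then show ?thesis by (simp add: eq)
qed

lemma knorm_shift: "knorm (\<lambda>i j. k (i - a) (j - b)) = knorm k"
  unfolding knorm_def
  using esum_minus_right[of "\<lambda>i. esum (\<lambda>j. k i j)" a] by (simp add: esum_minus_right[of "k _"])

lemma sum_enn2real_le_knorm:
  assumes "finite F" "knorm k < Orderings.top"
  shows "(\<Sum>i\<in>F. \<Sum>j\<in>F. enn2real (k i j)) \<le> enn2real (knorm k)"
proof -
  obtain r :: "int \<Rightarrow> real" where r: "\<And>i j. k i j < Orderings.top"
    using kernel_row_sums[OF assms(2)[unfolded knorm_def]] by metis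
  have "ennreal (\<Sum>i\<in>F. \<Sum>j\<in>F. enn2real (k i j)) = (\<Sum>i\<in>F. \<Sum>j\<in>F. k i j)"
    using r by (simp add: sum_ennreal[symmetric] sum_nonneg)
  also have "\<dots> \<le> knorm k"
    unfolding knorm_def by (intro order_trans[OF sum_mono[OF sum_le_esum] sum_le_esum] assms)
  finally have "enn2real (ennreal (\<Sum>i\<in>F. \<Sum>j\<in>F. enn2real (k i j))) \<le> enn2real (knorm k)"
    using assms by (intro enn2real_mono)
  then show ?thesis by (simp add: sum_nonneg)
qed

lemma knorm_add: "knorm (\<lambda>i j. k i j + l i j) = knorm k + knorm l"
  by (simp add: knorm_def esum_add)

lemma knorm_mono: "(\<And>i j. k i j \<le> l i j) \<Longrightarrow> knorm k \<le> knorm l"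
  unfolding knorm_def by (intro esum_mono)

lemma le_knorm: "k i j \<le> knorm k"
  unfolding knorm_def using esum_ge_point[of "k i" j] esum_ge_point[of "\<lambda>i. esum (k i)" i] order_trans by blast

lemma kernel_det_shift:
  fixes k :: "int \<Rightarrow> int \<Rightarrow> complex"
  shows "kernel_det (\<lambda>i j. k (i + a) (j + a)) = kernel_det k"
proof -
  have "inj (\<lambda>i. i + a)" by (simp add: inj_def)
  moreover have "range (\<lambda>i. i + a) = UNIV"
    by (rule surjI[of _ "\<lambda>x. x - a"]) simp
  ultimately show ?thesis using kernel_det_inj[of "\<lambda>i. i + a" k] by simp
qed

text \<open>Translation by \<open>h n\<close> moves the block to the fixed finite set
  \<open>B\<close>, where a constant is a summable majorant.\<close>

lemma kernel_det_block_tendsto: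
  fixes K :: "nat \<Rightarrow> int \<Rightarrow> int \<Rightarrow> complex"
  assumes B: "finite B" and bound: "\<And>n i j. ennreal (cmod (K n i j)) \<le> c" "c < Orderings.top"
    and lim: "\<And>i j. (\<lambda>n. K n (i + h n) (j + h n)) \<longlonglongrightarrow> L i j"
  shows "(\<lambda>n. kernel_det (\<lambda>i j. if i - h n \<in> B \<and> j - h n \<in> B then K n i j else 0))
     \<longlonglongrightarrow> kernel_det (\<lambda>i j. if i \<in> B \<and> j \<in> B then L i j else 0)"
proof -
  have eq: "kernel_det (\<lambda>i j. if i - h n \<in> B \<and> j - h n \<in> B then K n i j else 0)
      = kernel_det (\<lambda>i j. if i \<in> B \<and> j \<in> B then K n (i + h n) (j + h n) else 0)" for n
    using kernel_det_shift[of "\<lambda>i j. if i - h n \<in> B \<and> j - h n \<in> B then K n i j else 0" "h n"] by simp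
  show ?thesis unfolding eq
  proof (rule kernel_det_dominated_convergence)
    show "(\<lambda>n. if i \<in> B \<and> j \<in> B then K n (i + h n) (j + h n) else 0) \<longlonglongrightarrow> (if i \<in> B \<and> j \<in> B then L i j else 0)" for i j
      using lim[of i j] by (cases "i \<in> B \<and> j \<in> B") auto
    show "ennreal (cmod (if i \<in> B \<and> j \<in> B then K n (i + h n) (j + h n) else 0)) \<le> (if i \<in> B \<and> j \<in> B then c else 0)" for n i j
      using bound by simp
    have "esum (\<lambda>j. if i \<in> B \<and> j \<in> B then c else 0) = (if i \<in> B then of_nat (card B) * c else 0)" for i
      by (subst esum_finite_support[OF B]) auto
    then have "esum (\<lambda>i. esum (\<lambda>j. if i \<in> B \<and> j \<in> B then c else 0)) = of_nat (card B) * (of_nat (card B) * c)"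
      by (simp, subst esum_finite_support[OF B]) auto
    also have "\<dots> < Orderings.top" using bound(2) by (simp add: ennreal_mult_less_top of_nat_less_top)
    finally show "esum (\<lambda>i. esum (\<lambda>j. if i \<in> B \<and> j \<in> B then c else 0)) < Orderings.top" .
  qed
qed

lemma kernel_det_truncate_tendsto:
  fixes L :: "int \<Rightarrow> int \<Rightarrow> complex"
  assumes "\<And>i j. ennreal (cmod (L i j)) \<le> l i j" "knorm l < Orderings.top"
    and ev: "\<And>i j. L i j \<noteq> 0 \<Longrightarrow> \<forall>\<^sub>F m in sequentially. i \<in> B m \<and> j \<in> B m"
  shows "(\<lambda>m. kernel_det (\<lambda>i j. if i \<in> B m \<and> j \<in> B m then L i j else 0)) \<longlonglongrightarrow> kernel_det L"
proof (rule kernel_det_dominated_convergence)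
  show "(\<lambda>m. if i \<in> B m \<and> j \<in> B m then L i j else 0) \<longlonglongrightarrow> L i j" for i j
  proof (cases "L i j = 0")
    case False
    show ?thesis by (rule tendsto_eventually, rule eventually_mono[OF ev[OF False]]) simp
  next
    case True
    then have "(\<lambda>m. if i \<in> B m \<and> j \<in> B m then L i j else 0) = (\<lambda>m. 0)" by auto
    with True show ?thesis by (simp only: tendsto_const)
  qed
  show "ennreal (cmod (if i \<in> B m \<and> j \<in> B m then L i j else 0)) \<le> l i j" for m i j
    using assms(1) by simp
  show "esum (\<lambda>i. esum (\<lambda>j. l i j)) < Orderings.top" using assms(2) by (simp add: knorm_def)
qed

text \<open>Let k and l be the kernel cut to the two blocks. As \<open>A\<close> and
  \<open>B\<close> are disjoint, kl = 0 and (1 + k)(1 + l) = 1 + k + l.\<close>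

lemma kernel_det_two_blocks:
  fixes K :: "int \<Rightarrow> int \<Rightarrow> complex"
  assumes F: "finite A" "finite B" "A \<inter> B = {}"
  shows "kernel_det (\<lambda>i j. if i \<in> A \<and> j \<in> A \<or> i \<in> B \<and> j \<in> B then K i j else 0)
    = kernel_det (\<lambda>i j. if i \<in> A \<and> j \<in> A then K i j else 0) * kernel_det (\<lambda>i j. if i \<in> B \<and> j \<in> B then K i j else 0)"
proof -
  let ?k = "\<lambda>i j. if i \<in> A \<and> j \<in> A then K i j else 0" and ?l = "\<lambda>i j. if i \<in> B \<and> j \<in> B then K i j else 0"
  have "(\<Sum>x\<in>A \<union> B. ?k i x * ?l x j) = 0" for i j
    by (rule sum.neutral) (use F in auto)
  then have "(\<lambda>i j. ?k i j + ?l i j + (\<Sum>x\<in>A \<union> B. ?k i x * ?l x j)) = (\<lambda>i j. if i \<in> A \<and> j \<in> A \<or> i \<in> B \<and> j \<in> B then K i j else 0)"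
    using F(3) by (intro ext) auto
  moreover have "kernel_det (\<lambda>i j. ?k i j + ?l i j + (\<Sum>x\<in>A \<union> B. ?k i x * ?l x j)) = kernel_det ?k * kernel_det ?l"
    by (rule kernel_det_mult_int) (use F in auto)
  ultimately show ?thesis by simp
qed

text \<open>Keeping only a block of fixed size m at each end changes the determinant by an amount
  that is small uniformly in n, since the bound consists of two fixed kernels translated to the
  ends. For fixed m the blocks become disjoint as n grows, so their determinants multiply, and each
  converges.\<close>

lemma kernel_det_two_corners:
  fixes K :: "nat \<Rightarrow> int \<Rightarrow> int \<Rightarrow> complex"
  assumes supp: "\<And>n i j. K n i j \<noteq> 0 \<Longrightarrow> i \<in> {h1 n..<h2 n} \<and> j \<in> {h1 n..<h2 n}"
    and bound: "\<And>n i j. ennreal (cmod (K n i j)) \<le> k1 (i - h1 n) (j - h1 n) + k2 (i - h2 n) (j - h2 n)"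
    and fin: "knorm k1 < Orderings.top" "knorm k2 < Orderings.top"
    and lim1: "\<And>i j. (\<lambda>n. K n (i + h1 n) (j + h1 n)) \<longlonglongrightarrow> L1 i j"
    and lim2: "\<And>i j. (\<lambda>n. K n (i + h2 n) (j + h2 n)) \<longlonglongrightarrow> L2 i j"
    and L1: "\<And>i j. ennreal (cmod (L1 i j)) \<le> l1 i j" "knorm l1 < Orderings.top"
    and L2: "\<And>i j. ennreal (cmod (L2 i j)) \<le> l2 i j" "knorm l2 < Orderings.top"
    and s1: "\<And>i j. L1 i j \<noteq> 0 \<Longrightarrow> 0 \<le> i \<and> 0 \<le> j" and s2: "\<And>i j. L2 i j \<noteq> 0 \<Longrightarrow> i < 0 \<and> j < 0"
    and h: "filterlim (\<lambda>n. h2 n - h1 n) at_top sequentially"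
  shows "(\<lambda>n. kernel_det (K n)) \<longlonglongrightarrow> kernel_det L1 * kernel_det L2"
proof (rule LIMSEQ_I)
  fix e :: real assume e: "0 < e"
  define B1 where "B1 m = {0..<int m}" for m
  define B2 where "B2 m = {- int m..<0}" for m
  define T where "T k m = knorm (\<lambda>i j. if i \<in> {- int m..<int m} \<and> j \<in> {- int m..<int m} then 0 else k i j)" for k m
  define W where "W = enn2real (knorm k1 + knorm k2)"
  define D where "D m = enn2real (T k1 m + T k2 m)" for m
  define M where "M m = kernel_det (\<lambda>i j. if i \<in> B1 m \<and> j \<in> B1 m then L1 i j else 0) * kernel_det (\<lambda>i j. if i \<in> B2 m \<and> j \<in> B2 m then L2 i j else 0)" for m
  have Tfin: "T k m < Orderings.top" if "knorm k < Orderings.top" for k m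
    unfolding T_def by (rule le_less_trans[OF knorm_mono that]) simp
  have "(\<lambda>m. T k1 m + T k2 m) \<longlonglongrightarrow> 0 + 0"
    unfolding T_def by (intro tendsto_add knorm_tail_tendsto_0 fin)
  then have "D \<longlonglongrightarrow> enn2real 0"
    unfolding D_def by (intro tendsto_enn2real) auto
  then have "(\<lambda>m. exp W * (exp (D m) - 1)) \<longlonglongrightarrow> exp W * (exp 0 - 1)"
    by (intro tendsto_intros) simp
  then have ev1: "\<forall>\<^sub>F m in sequentially. exp W * (exp (D m) - 1) < e / 3"
    by (rule order_tendstoD(2)) (use e in simp)
  have "M \<longlonglongrightarrow> kernel_det L1 * kernel_det L2"
    unfolding M_def
  proof (intro tendsto_mult kernel_det_truncate_tendsto)
    show "\<forall>\<^sub>F m in sequentially. i \<in> B1 m \<and> j \<in> B1 m" if "L1 i j \<noteq> 0" for i j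
      unfolding eventually_sequentially using s1[OF that]
      by (intro exI[of _ "nat (max i j + 1)"]) (auto simp: B1_def)
    show "\<forall>\<^sub>F m in sequentially. i \<in> B2 m \<and> j \<in> B2 m" if "L2 i j \<noteq> 0" for i j
      unfolding eventually_sequentially using s2[OF that]
      by (intro exI[of _ "nat (max (- i) (- j))"]) (auto simp: B2_def)
  qed (rule L1 L2)+
  then have ev2: "\<forall>\<^sub>F m in sequentially. dist (M m) (kernel_det L1 * kernel_det L2) < e / 3"
    using e by (intro tendstoD) auto
  \<comment> \<open>The block size is fixed before \<open>n\<close>, so that both the truncation
    error and the distance of the truncated limit from the limit are below e / 3.\<close>
  obtain m where m: "exp W * (exp (D m) - 1) < e / 3" "dist (M m) (kernel_det L1 * kernel_det L2) < e / 3"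
    using eventually_happens[OF eventually_conj[OF ev1 ev2]] by auto
  define A where "A n = kernel_det (\<lambda>i j. if i - h1 n \<in> B1 m \<and> j - h1 n \<in> B1 m then K n i j else 0)
     * kernel_det (\<lambda>i j. if i - h2 n \<in> B2 m \<and> j - h2 n \<in> B2 m then K n i j else 0)" for n
  have kc: "ennreal (cmod (K n i j)) \<le> knorm k1 + knorm k2" for n i j
    by (rule order_trans[OF bound]) (intro add_mono le_knorm)
  have "A \<longlonglongrightarrow> M m"
    unfolding A_def M_def
    by (intro tendsto_mult kernel_det_block_tendsto[OF _ kc] lim1 lim2) (use fin in \<open>auto simp: B1_def B2_def\<close>)
  then have ev3: "\<forall>\<^sub>F n in sequentially. dist (A n) (M m) < e / 3"
    using e by (intro tendstoD) auto
  have ev4: "\<forall>\<^sub>F n in sequentially. 2 * int m \<le> h2 n - h1 n"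
    using h by (simp add: filterlim_at_top)
  have close: "cmod (kernel_det (K n) - A n) \<le> exp W * (exp (D m) - 1)" if n: "2 * int m \<le> h2 n - h1 n" for n
  proof -
    define F1 where "F1 = {i. i - h1 n \<in> B1 m}"
    define F2 where "F2 = {i. i - h2 n \<in> B2 m}"
    have F1: "F1 = {h1 n..<h1 n + int m}" and F2: "F2 = {h2 n - int m..<h2 n}"
      by (auto simp: F1_def F2_def B1_def B2_def)
    have disj: "F1 \<inter> F2 = {}" using n by (auto simp: F1 F2)
    define L where "L i j = (if i \<in> F1 \<and> j \<in> F1 \<or> i \<in> F2 \<and> j \<in> F2 then K n i j else 0)" for i j
    have A_eq: "A n = kernel_det L"
    proof -
      have "i - h1 n \<in> B1 m \<longleftrightarrow> i \<in> F1" "i - h2 n \<in> B2 m \<longleftrightarrow> i \<in> F2" for i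
        by (simp_all add: F1_def F2_def)
      moreover have "finite F1" "finite F2" by (simp_all add: F1 F2)
      ultimately show ?thesis unfolding A_def L_def using kernel_det_two_blocks[OF _ _ disj, of "K n"] by simp
    qed
    define t where "t k = (\<lambda>i j. if i \<in> {- int m..<int m} \<and> j \<in> {- int m..<int m} then 0 else (k i j :: ennreal))" for k
    let ?J = "{h1 n..<h2 n}"
    let ?w = "\<lambda>i j. k1 (i - h1 n) (j - h1 n) + k2 (i - h2 n) (j - h2 n)"
    let ?d = "\<lambda>i j. t k1 (i - h1 n) (j - h1 n) + t k2 (i - h2 n) (j - h2 n)"
    have kw: "knorm ?w = knorm k1 + knorm k2" unfolding knorm_add knorm_shift ..
    have kd: "knorm ?d = T k1 m + T k2 m"
      unfolding knorm_add knorm_shift by (simp only: T_def t_def)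
    have kwf: "knorm ?w < Orderings.top" unfolding kw using fin by simp
    have kdf: "knorm ?d < Orderings.top" unfolding kd using Tfin fin by simp
    have wK: "cmod (K n i j) \<le> enn2real (?w i j)" for i j
      using enn2real_mono[OF bound le_less_trans[OF le_knorm kwf]] by simp
    have wL: "cmod (L i j) \<le> enn2real (?w i j)" for i j
      using wK[of i j] by (simp add: L_def)
    have dKL: "cmod (K n i j - L i j) \<le> enn2real (?d i j)" for i j
    proof (cases "K n i j = L i j")
      case False
      then have nb: "\<not> (i \<in> F1 \<and> j \<in> F1)" "\<not> (i \<in> F2 \<and> j \<in> F2)" "K n i j \<noteq> 0" "L i j = 0"
        by (auto simp: L_def split: if_splits)
      have ij: "i \<in> ?J" "j \<in> ?J" using supp[OF nb(3)] by auto
      \<comment> \<open>Inside the interval, offsets from the left end are nonnegative and those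
        from the right end negative, so the removed squares of side 2m meet it exactly in the two
        blocks. Outside the blocks neither tail is cut.\<close>
      have "?d i j = ?w i j"
        using nb(1,2) ij by (auto simp: t_def F1 F2)
      then show ?thesis using wK[of i j] nb(4) by simp
    qed simp
    have "cmod (kernel_det (K n) - kernel_det L) \<le> exp W * (exp (D m) - 1)"
    proof (rule kernel_det_lipschitz[OF _ _ _ wK wL dKL])
      show "finite ?J" by simp
      show "K n i j = 0" if "i \<notin> ?J" for i j using supp[of n i j] that by blast
      then show "L i j = 0" if "i \<notin> ?J" for i j using that by (simp add: L_def)
      show "(\<Sum>i\<in>?J. \<Sum>j\<in>?J. enn2real (?w i j)) \<le> W"
        using sum_enn2real_le_knorm[OF _ kwf, of ?J] by (simp add: W_def kw)
      show "(\<Sum>i\<in>?J. \<Sum>j\<in>?J. enn2real (?d i j)) \<le> D m"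
        using sum_enn2real_le_knorm[OF _ kdf, of ?J] by (simp add: D_def kd)
    qed
    then show ?thesis by (simp add: A_eq)
  qed
  have "\<forall>\<^sub>F n in sequentially. norm (kernel_det (K n) - kernel_det L1 * kernel_det L2) < e"
    using ev3 ev4
  proof eventually_elim
    case (elim n)
    have "norm (kernel_det (K n) - kernel_det L1 * kernel_det L2) \<le> norm (kernel_det (K n) - A n) + dist (A n) (M m) + dist (M m) (kernel_det L1 * kernel_det L2)"
      using norm_triangle_ineq[of "kernel_det (K n) - A n" "A n - M m"]
        norm_triangle_ineq[of "kernel_det (K n) - M m" "M m - kernel_det L1 * kernel_det L2"]
      by (simp add: dist_norm)
    then show ?case using close[OF elim(2)] elim(1) m by linarith
  qed
  then show "\<exists>no. \<forall>n\<ge>no. norm (kernel_det (K n) - kernel_det L1 * kernel_det L2) < e"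
    by (simp add: eventually_sequentially)
qed

section \<open>Operators with finitely many rows\<close>

text \<open>Only the rows are restricted. Such operators form a right ideal, so the property
  survives multiplication from the right by any operator.\<close>

definition rsupp :: "'a set \<Rightarrow> 'a bop \<Rightarrow> bool" where
  "rsupp F X \<longleftrightarrow> proj F * X = X"

lemma rsupp_iff: "rsupp F X \<longleftrightarrow> (\<forall>i j. i \<notin> F \<longrightarrow> entry X i j = 0)"
proof
  assume *: "rsupp F X"
  show "\<forall>i j. i \<notin> F \<longrightarrow> entry X i j = 0"
  proof (intro allI impI)
    fix i j assume "i \<notin> F"
    then have "entry (proj F * X) i j = 0" by (simp add: entry_proj_left)
    then show "entry X i j = 0" using * by (simp add: rsupp_def)
  qed
next
  assume "\<forall>i j. i \<notin> F \<longrightarrow> entry X i j = 0"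
  then show "rsupp F X" unfolding rsupp_def by (intro bop_eqI) (auto simp: entry_proj_left)
qed

lemma rsupp_mult: "rsupp F X \<Longrightarrow> rsupp F (X * Y)"
  by (simp add: rsupp_def flip: mult.assoc)

lemma rsupp_add: "rsupp F X \<Longrightarrow> rsupp F Y \<Longrightarrow> rsupp F (X + Y)"
  by (simp add: rsupp_def distrib_left)

lemma rsupp_uminus: "rsupp F X \<Longrightarrow> rsupp F (- X)"
  by (simp add: rsupp_def)

lemma rsupp_proj_mult: "rsupp F X \<Longrightarrow> rsupp F (proj J * X)"
  by (auto simp: rsupp_iff entry_proj_left)

lemma rsupp_times_minus_one: "rsupp F (X - 1) \<Longrightarrow> rsupp F (Y - 1) \<Longrightarrow> rsupp F (X * Y - 1)"
proof -
  assume "rsupp F (X - 1)" "rsupp F (Y - 1)"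
  then have "rsupp F ((X - 1) * Y + (Y - 1))" by (intro rsupp_add rsupp_mult)
  then show ?thesis by (simp add: algebra_simps)
qed

lemma rsupp_exp: "rsupp F X \<Longrightarrow> rsupp F (exp X - 1)"
  by (simp add: rsupp_iff entry_exp_minus_one_zero_row)

lemma rsupp_exp_prod: "(\<And>B. B \<in> set Bs \<Longrightarrow> rsupp F B) \<Longrightarrow> rsupp F (exp_prod Bs - 1)"
proof (induction Bs)
  case Nil
  then show ?case by (simp add: rsupp_def)
qed (auto intro!: rsupp_times_minus_one rsupp_exp)

lemma op_det_mult':
  fixes X Y :: "int bop"
  shows "finite F \<Longrightarrow> rsupp F (X - 1) \<Longrightarrow> rsupp F (Y - 1) \<Longrightarrow> op_det (X * Y) = op_det X * op_det Y"
  by (rule op_det_mult) (auto simp: rsupp_iff)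

lemma op_det_exp_prod:
  fixes Bs :: "int bop list"
  assumes F: "finite F" and "\<And>B. B \<in> set Bs \<Longrightarrow> rsupp F B"
  shows "op_det (exp_prod Bs) = exp (sum_list (map (\<lambda>B. \<Sum>i\<in>F. entry B i i) Bs))"
  using assms(2)
proof (induction Bs)
  case Nil
  have "op_det (exp (0 :: int bop)) = exp (\<Sum>i\<in>F. entry (0 :: int bop) i i)"
    by (rule op_det_exp[OF F]) (simp add: entry_zero)
  then show ?case by (simp add: entry_zero)
next
  case (Cons B Bs)
  have "op_det (exp B * exp_prod Bs) = op_det (exp B) * op_det (exp_prod Bs)"
    using Cons.prems by (intro op_det_mult'[OF F] rsupp_exp rsupp_exp_prod) auto
  also have "op_det (exp B) = exp (\<Sum>i\<in>F. entry B i i)"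
    using Cons.prems[of B] by (intro op_det_exp[OF F]) (simp add: rsupp_iff)
  finally show ?case using Cons by (simp add: exp_add)
qed

text \<open>Outside \<open>J\<close> both operators have the rows of the identity, hence they are
  block triangular and only the block on \<open>J\<close> enters the determinant.\<close>

lemma op_det_eqI:
  assumes "rsupp J (X - 1)" "rsupp J (Y - 1)"
    "\<And>i j. i \<in> J \<Longrightarrow> j \<in> J \<Longrightarrow> entry X i j = entry Y i j"
  shows "op_det X = op_det Y"
  unfolding op_det_def by (rule kernel_det_cong_support[of J]) (use assms in \<open>auto simp: rsupp_iff entry_diff\<close>)

section \<open>Corner determinants and traces\<close>

lemma mult_exp_annihilate_right:
  fixes Q Y :: "'b::{real_normed_algebra_1,banach}"
  assumes "Y * Q = 0" shows "exp Y * Q = Q"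
proof -
  have "(\<lambda>n. (Y ^ n /\<^sub>R fact n) * Q) sums (exp Y * Q)"
    unfolding exp_def by (intro sums_mult2 summable_sums summable_exp_generic)
  moreover have "(\<lambda>n. (Y ^ n /\<^sub>R fact n) * Q) = (\<lambda>n. if n = 0 then Q else 0)"
  proof
    fix n show "(Y ^ n /\<^sub>R fact n) * Q = (if n = 0 then Q else 0)"
      using assms by (cases n) (auto simp: power_commutes[symmetric] mult.assoc simp del: power_Suc simp: power_Suc2)
  qed
  moreover have "(\<lambda>n. if n = 0 then Q else 0) sums Q" using sums_single[of 0 "\<lambda>_. Q"] by simp
  ultimately show ?thesis using sums_unique2 by metis
qed

lemma exp_prod_annihilate_left:
  "(\<And>B. B \<in> set Bs \<Longrightarrow> Q * B = 0) \<Longrightarrow> Q * exp_prod Bs = Q"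
  by (induction Bs) (auto simp: mult_exp_annihilate_left simp flip: mult.assoc)

lemma exp_prod_annihilate_right:
  "(\<And>B. B \<in> set Bs \<Longrightarrow> B * Q = 0) \<Longrightarrow> exp_prod Bs * Q = Q"
  by (induction Bs) (auto simp: mult_exp_annihilate_right mult.assoc)

lemma compl_proj_mult: "(1 - proj J) * (proj J * X) = 0"
  by (simp add: left_diff_distrib proj_idem')

lemma mult_compl_proj: "X * proj J * (1 - proj J) = 0"
  by (simp add: right_diff_distrib proj_idem mult.assoc)

text \<open>With P the projection onto \<open>J\<close>, both (1 - P)PXP and PXP(1 - P) vanish, so
  only the constant term of each exponential series acts on the complement of
  \<open>J\<close>.\<close>

lemma exp_prod_compressed_compl:
  assumes "\<And>B. B \<in> set Bs \<Longrightarrow> \<exists>X. B = proj J * X * proj J"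
  shows "(1 - proj J) * exp_prod Bs = 1 - proj J" "exp_prod Bs * (1 - proj J) = 1 - proj J"
    "proj J * exp_prod Bs = exp_prod Bs * proj J"
proof -
  show 1: "(1 - proj J) * exp_prod Bs = 1 - proj J"
    by (rule exp_prod_annihilate_left) (use assms in \<open>force simp: compl_proj_mult mult.assoc\<close>)
  show 2: "exp_prod Bs * (1 - proj J) = 1 - proj J"
    by (rule exp_prod_annihilate_right) (use assms in \<open>force simp: mult_compl_proj\<close>)
  show "proj J * exp_prod Bs = exp_prod Bs * proj J"
  proof -
    have "proj J * exp_prod Bs = exp_prod Bs - (1 - proj J) * exp_prod Bs"
      "exp_prod Bs * proj J = exp_prod Bs - exp_prod Bs * (1 - proj J)"
      by (simp_all add: left_diff_distrib right_diff_distrib)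
    then show ?thesis by (simp only: 1 2)
  qed
qed

text \<open>The defect of the ratio on \<open>J\<close>, extended by zero to the whole line so that
  determinants for varying \<open>J\<close> can be compared.\<close>

definition cornerL :: "int set \<Rightarrow> int bop list \<Rightarrow> int \<Rightarrow> int \<Rightarrow> complex" where
  "cornerL J Bs i j = (if i \<in> J \<and> j \<in> J then entry (ratioL (proj J) Bs - 1) i j else 0)"

definition cornerR :: "int set \<Rightarrow> int bop list \<Rightarrow> int \<Rightarrow> int \<Rightarrow> complex" where
  "cornerR J Bs i j = (if i \<in> J \<and> j \<in> J then entry (ratioR (proj J) Bs - 1) i j else 0)"

lemma sum_list_uminus: "sum_list (map (\<lambda>x. - f x) xs) = - sum_list (map f xs :: complex list)"
  by (induction xs) auto

text \<open>With Q = 1 - P and E the product of exponentials, QE = Q gives (PAP + Q)E = ratio + Q.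
  The determinant splits, and that of E is the exponential of minus the sum of the traces.\<close>

lemma kernel_det_cornerL:
  assumes F: "finite F" and A: "rsupp F (proj J * (exp_prod Bs - 1) * proj J)"
    and B: "\<And>B. B \<in> set Bs \<Longrightarrow> rsupp F (proj J * B * proj J)"
  shows "kernel_det (cornerL J Bs) = op_det (proj J * exp_prod Bs * proj J + (1 - proj J)) *
    exp (- sum_list (map (\<lambda>B. \<Sum>i\<in>F. entry (proj J * B * proj J) i i) Bs))"
proof -
  let ?P = "proj J" and ?L = "map (\<lambda>B. - (proj J * B * proj J)) (rev Bs)"
  let ?A = "exp_prod Bs" and ?E = "exp_prod ?L"
  have Lsh: "\<exists>X. B = proj J * X * proj J" if B': "B \<in> set ?L" for B
  proof -
    obtain C where "B = - (proj J * C * proj J)" using B' by auto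
    then have "B = proj J * (- C) * proj J" by simp
    then show ?thesis by blast
  qed
  have E: "(1 - ?P) * ?E = 1 - ?P" by (rule exp_prod_compressed_compl(1)[OF Lsh])
  have G: "(?P * ?A * ?P + (1 - ?P)) * ?E = ratioL ?P Bs + (1 - ?P)"
    unfolding ratioL_def distrib_right E ..
  have "kernel_det (cornerL J Bs) = op_det (ratioL ?P Bs + (1 - ?P))"
    unfolding op_det_def
  proof (rule kernel_det_cong_support[of J])
    show "entry (ratioL ?P Bs + (1 - ?P) - 1) i j = 0" if "i \<notin> J" for i j
      using that by (simp add: ratioL_def entry_diff entry_add entry_proj_left entry_proj mult.assoc)
    show "cornerL J Bs i j = entry (ratioL ?P Bs + (1 - ?P) - 1) i j" if "i \<in> J" "j \<in> J" for i j
      using that by (simp add: cornerL_def entry_diff entry_add entry_proj entry_one)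
  qed (simp add: cornerL_def)
  also have "\<dots> = op_det (?P * ?A * ?P + (1 - ?P)) * op_det ?E"
    unfolding G[symmetric]
  proof (rule op_det_mult'[OF F])
    have "?P * ?A * ?P + (1 - ?P) - 1 = ?P * (?A - 1) * ?P"
      by (simp add: algebra_simps proj_idem)
    then show "rsupp F (?P * ?A * ?P + (1 - ?P) - 1)" using A by simp
    show "rsupp F (?E - 1)" by (rule rsupp_exp_prod) (use B rsupp_uminus in auto)
  qed
  also have "op_det ?E = exp (sum_list (map (\<lambda>B. \<Sum>i\<in>F. entry B i i) ?L))"
    by (rule op_det_exp_prod[OF F]) (use B rsupp_uminus in auto)
  also have "sum_list (map (\<lambda>B. \<Sum>i\<in>F. entry B i i) ?L) = - sum_list (map (\<lambda>B. \<Sum>i\<in>F. entry (proj J * B * proj J) i i) Bs)"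
    by (simp add: o_def entry_uminus sum_negf sum_list_uminus rev_map[symmetric] sum_list_rev)
  finally show ?thesis .
qed

lemma kernel_det_cornerR:
  fixes Bs :: "int bop list"
  defines "C \<equiv> exp_prod (map uminus (rev Bs))"
  assumes F: "finite F" and A: "rsupp F (proj J * (C - 1) * proj J)"
    and B: "\<And>B. B \<in> set Bs \<Longrightarrow> rsupp F (proj J * B * proj J)"
  shows "kernel_det (cornerR J Bs) = exp (sum_list (map (\<lambda>B. \<Sum>i\<in>F. entry (proj J * B * proj J) i i) Bs)) *
    op_det (proj J * C * proj J + (1 - proj J))"
proof -
  let ?P = "proj J" and ?L = "map (\<lambda>B. proj J * B * proj J) Bs"
  let ?E = "exp_prod ?L"
  have Lsh: "\<exists>X. B = proj J * X * proj J" if "B \<in> set ?L" for B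
    using that by auto
  have E: "?E * (1 - ?P) = 1 - ?P" by (rule exp_prod_compressed_compl(2)[OF Lsh])
  have PE: "?P * ?E = ?E * ?P" by (rule exp_prod_compressed_compl(3)[OF Lsh])
  have G: "?E * (?P * C * ?P + (1 - ?P)) = ratioR ?P Bs + (1 - ?P)"
    unfolding ratioR_def C_def distrib_left E ..
  \<comment> \<open>No projection stands at the left of \<open>ratioR\<close>. Commuting P past the
    exponentials shows that its rows outside \<open>J\<close> vanish all the same.\<close>
  have G': "ratioR ?P Bs = ?P * (?E * C * ?P)"
    unfolding ratioR_def C_def by (simp add: PE flip: mult.assoc)
  have "kernel_det (cornerR J Bs) = op_det (ratioR ?P Bs + (1 - ?P))"
    unfolding op_det_def
  proof (rule kernel_det_cong_support[of J])
    show "entry (ratioR ?P Bs + (1 - ?P) - 1) i j = 0" if "i \<notin> J" for i j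
      unfolding G' using that by (simp add: entry_diff entry_add entry_proj_left entry_proj)
    show "cornerR J Bs i j = entry (ratioR ?P Bs + (1 - ?P) - 1) i j" if "i \<in> J" "j \<in> J" for i j
      using that by (simp add: cornerR_def entry_diff entry_add entry_proj entry_one)
  qed (simp add: cornerR_def)
  also have "\<dots> = op_det ?E * op_det (?P * C * ?P + (1 - ?P))"
    unfolding G[symmetric]
  proof (rule op_det_mult'[OF F])
    have "?P * C * ?P + (1 - ?P) - 1 = ?P * (C - 1) * ?P"
      by (simp add: algebra_simps proj_idem)
    then show "rsupp F (?P * C * ?P + (1 - ?P) - 1)" using A by simp
    show "rsupp F (?E - 1)" by (rule rsupp_exp_prod) (use B in auto)
  qed
  also have "op_det ?E = exp (sum_list (map (\<lambda>B. \<Sum>i\<in>F. entry B i i) ?L))"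
    by (rule op_det_exp_prod[OF F]) (use B in auto)
  finally show ?thesis by (simp add: o_def)
qed

lemma entry_sum_list: "entry (sum_list Bs) i j = sum_list (map (\<lambda>B. entry B i j) Bs)"
  by (induction Bs) (auto simp: entry_zero entry_add)

lemma sum_sum_list: "(\<Sum>i\<in>F. sum_list (map (\<lambda>B. f B i) Bs)) = sum_list (map (\<lambda>B. \<Sum>i\<in>F. f B i) Bs)"
  by (induction Bs) (auto simp: sum.distrib)

text \<open>A compression to a finite interval has finitely many rows, so
  \<open>kernel_det_cornerL\<close> applies with the interval as \<open>F\<close> and can be solved
  for the determinant of the section. The traces of the compressions add up to that of the
  sum.\<close>

lemma det_finite_section:
  "Determinant.det (finite_section a b (exp_prod Bs)) =
     kernel_det (cornerL {a..<b} Bs) * exp (\<Sum>i\<in>{a..<b}. entry (sum_list Bs) i i)"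
proof -
  let ?J = "{a..<b}" and ?A = "exp_prod Bs"
  let ?P = "proj ?J"
  define f where "f i = a + int i" for i
  define n where "n = nat (b - a)"
  have f: "inj f" by (auto simp: f_def inj_def)
  have fJ: "f i \<in> ?J \<longleftrightarrow> i < n" for i by (auto simp: f_def n_def)
  have fr: "i \<notin> range f \<Longrightarrow> i \<notin> ?J" for i
  proof
    assume "i \<notin> range f" "i \<in> ?J"
    moreover from this have "i = f (nat (i - a))" by (simp add: f_def)
    ultimately show False by blast
  qed
  define K where "K = entry (?P * ?A * ?P + (1 - ?P) - 1)"
  have k: "K i j = (if i \<in> ?J \<and> j \<in> ?J then entry ?A i j else 0) - (if i = j \<and> i \<in> ?J then 1 else 0)" for i j
    by (simp add: K_def entry_diff entry_add entry_proj_left entry_proj_right entry_proj)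
  have "op_det (?P * ?A * ?P + (1 - ?P)) = kernel_det (\<lambda>i j. K (f i) (f j))"
    unfolding op_det_def K_def[symmetric] by (rule kernel_det_inj[OF f]) (auto simp: k dest: fr)
  also have "\<dots> = Determinant.det (mat n n (\<lambda>(i, j). (if i = j then 1 else 0) + K (f i) (f j)))"
    by (rule kernel_det_eq_det) (simp add: k fJ del: atLeastLessThan_iff)
  also have "mat n n (\<lambda>(i, j). (if i = j then 1 else 0) + K (f i) (f j)) = finite_section a b ?A"
    unfolding finite_section_def n_def[symmetric] f_def[symmetric]
    by (rule cong_mat) (auto simp: k fJ inj_eq[OF f] simp del: atLeastLessThan_iff)
  finally have d: "op_det (?P * ?A * ?P + (1 - ?P)) = Determinant.det (finite_section a b ?A)" .
  have r: "rsupp ?J (?P * X * Y)" for X Y by (simp add: rsupp_def proj_idem flip: mult.assoc)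
  have "kernel_det (cornerL ?J Bs) = op_det (?P * ?A * ?P + (1 - ?P)) *
     exp (- sum_list (map (\<lambda>B. \<Sum>i\<in>?J. entry (?P * B * ?P) i i) Bs))"
    by (rule kernel_det_cornerL) (auto simp: r)
  also have "sum_list (map (\<lambda>B. \<Sum>i\<in>?J. entry (?P * B * ?P) i i) Bs) = (\<Sum>i\<in>?J. entry (sum_list Bs) i i)"
    unfolding entry_sum_list sum_sum_list
    by (intro arg_cong[of _ _ sum_list] map_cong refl sum.cong) (auto simp: entry_proj_left entry_proj_right)
  finally show ?thesis by (simp add: d exp_minus)
qed

section \<open>Jacobi's identity for complementary minors\<close>

text \<open>
  For complementary projections \<open>P\<close>, \<open>Q\<close> and \<open>b = a\<^sup>-\<^sup>1\<close> one has \<open>(Q a + P) b = Q + P b\<close>.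
\<close>

lemma Jacobi_finite:
  fixes Bs :: "int bop list"
  assumes F: "finite F" and B: "\<And>B. B \<in> set Bs \<Longrightarrow> rsupp F B"
  shows "kernel_det (cornerL {..<0} Bs) = kernel_det (cornerR {0..} Bs)"
proof -
  let ?Q = "proj {..<0::int}" and ?P = "proj {0::int..}"
  let ?a = "exp_prod Bs" and ?b = "exp_prod (map uminus (rev Bs))"
  have PQ: "1 - ?Q = ?P" "1 - ?P = ?Q"
    using proj_compl[of "{..<0::int}"] proj_compl[of "{0::int..}"]
    by (simp_all add: Compl_lessThan Compl_atLeast)
  have a: "rsupp F (?a - 1)" by (rule rsupp_exp_prod[OF B])
  have b: "rsupp F (?b - 1)" by (rule rsupp_exp_prod) (use B rsupp_uminus in auto)
  have sp: "?Q + ?P = 1" using PQ by (metis add_diff_cancel_left' diff_add_cancel add.commute)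
  have e1: "?Q * ?a + ?P - 1 = ?Q * (?a - 1)" using sp by (simp add: algebra_simps)
  have e2: "?Q * ?a * ?Q + ?P - 1 = ?Q * ((?a - 1) * ?Q)" using sp by (simp add: algebra_simps proj_idem)
  have e3: "?Q + ?P * ?b - 1 = ?P * (?b - 1)" using sp by (simp add: algebra_simps)
  have e4: "?P * ?b * ?P + ?Q - 1 = ?P * ((?b - 1) * ?P)" using sp by (simp add: algebra_simps proj_idem)
  have "kernel_det (cornerL {..<0} Bs) = op_det (?Q * ?a * ?Q + (1 - ?Q)) * exp (- sum_list (map (\<lambda>B. \<Sum>i\<in>F. entry (?Q * B * ?Q) i i) Bs))"
  proof (rule kernel_det_cornerL[OF F])
    show "rsupp F (?Q * (?a - 1) * ?Q)" by (rule rsupp_mult, rule rsupp_proj_mult, rule a)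
    show "rsupp F (?Q * B * ?Q)" if "B \<in> set Bs" for B by (rule rsupp_mult, rule rsupp_proj_mult, rule B[OF that])
  qed
  \<comment> \<open>The two operators differ only in columns outside the left half-line, while all
    rows outside it are rows of the identity.\<close>
  also have "op_det (?Q * ?a * ?Q + (1 - ?Q)) = op_det (?Q * ?a + ?P)"
    unfolding PQ
  proof (rule op_det_eqI[of "{..<0}"])
    show "rsupp {..<0} (?Q * ?a * ?Q + ?P - 1)" "rsupp {..<0} (?Q * ?a + ?P - 1)"
      unfolding e1 e2 by (simp_all add: rsupp_def proj_idem')
  qed (simp add: entry_add entry_proj_right)
  finally have L: "kernel_det (cornerL {..<0} Bs) = op_det (?Q * ?a + ?P) * exp (- sum_list (map (\<lambda>B. \<Sum>i\<in>F. entry (?Q * B * ?Q) i i) Bs))" .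
  have "kernel_det (cornerR {0..} Bs) = exp (sum_list (map (\<lambda>B. \<Sum>i\<in>F. entry (?P * B * ?P) i i) Bs)) * op_det (?P * ?b * ?P + (1 - ?P))"
  proof (rule kernel_det_cornerR[OF F])
    show "rsupp F (?P * (?b - 1) * ?P)" by (rule rsupp_mult, rule rsupp_proj_mult, rule b)
    show "rsupp F (?P * B * ?P)" if "B \<in> set Bs" for B by (rule rsupp_mult, rule rsupp_proj_mult, rule B[OF that])
  qed
  also have "op_det (?P * ?b * ?P + (1 - ?P)) = op_det (?Q + ?P * ?b)"
    unfolding PQ
  proof (rule op_det_eqI[of "{0..}"])
    show "rsupp {0..} (?P * ?b * ?P + ?Q - 1)" "rsupp {0..} (?Q + ?P * ?b - 1)"
      unfolding e3 e4 by (simp_all add: rsupp_def proj_idem')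
  qed (simp add: entry_add entry_proj_right)
  also have "?Q + ?P * ?b = (?Q * ?a + ?P) * ?b"
    by (simp add: distrib_right mult.assoc exp_prod_inverse)
  also have "op_det ((?Q * ?a + ?P) * ?b) = op_det (?Q * ?a + ?P) * op_det ?b"
    by (rule op_det_mult'[OF F _ b]) (unfold e1, intro rsupp_proj_mult a)
  also have "op_det ?b = exp (sum_list (map (\<lambda>B. \<Sum>i\<in>F. entry B i i) (map uminus (rev Bs))))"
    by (rule op_det_exp_prod[OF F]) (use B rsupp_uminus in auto)
  also have "sum_list (map (\<lambda>B. \<Sum>i\<in>F. entry B i i) (map uminus (rev Bs))) = - sum_list (map (\<lambda>B. \<Sum>i\<in>F. entry B i i) Bs)"
    by (simp add: o_def entry_uminus sum_negf sum_list_uminus rev_map[symmetric] sum_list_rev)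
  \<comment> \<open>The trace splits over the two half-lines. The right part cancels the factor in
    front of the right corner, and the left part is the one in \<open>L\<close>.\<close>
  also have "sum_list (map (\<lambda>B. \<Sum>i\<in>F. entry B i i) Bs)
      = sum_list (map (\<lambda>B. \<Sum>i\<in>F. entry (?Q * B * ?Q) i i) Bs) + sum_list (map (\<lambda>B. \<Sum>i\<in>F. entry (?P * B * ?P) i i) Bs)"
    unfolding sum_list_addf[symmetric] sum.distrib[symmetric]
    by (intro arg_cong[of _ _ sum_list] map_cong refl sum.cong) (auto simp: entry_proj_left entry_proj_right)
  finally show ?thesis unfolding L by (simp add: exp_add exp_diff exp_minus field_simps)
qed

section \<open>Corner kernels: uniform majorants and limits\<close>

context weight
begin

lemma cells_simps:
  "cells {True} s = {s True..}" "cells {False} s = {..<s False}" "cells UNIV s = {s True..<s False}"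
  by (auto simp: cells_def inside_def UNIV_bool)

lemma tame_const: "tame (\<lambda>_::unit. B) \<Longrightarrow> tame (\<lambda>_::'i. B)"
  by (simp add: tame_def)

lemma corners_dominated:
  fixes Bs :: "('i \<Rightarrow> int bop) list"
  assumes "\<And>B. B \<in> set Bs \<Longrightarrow> tame B"
  shows "\<exists>k. (\<Sum>e\<in>E. knorm (k e)) < Orderings.top \<and>
     (\<forall>i j l. ennreal (cmod (cornerL (cells E (s i)) (map (\<lambda>B. B i) Bs) j l)) \<le> (\<Sum>e\<in>E. k e (j - s i e) (l - s i e)))"
   and "\<exists>k. (\<Sum>e\<in>E. knorm (k e)) < Orderings.top \<and>
     (\<forall>i j l. ennreal (cmod (cornerR (cells E (s i)) (map (\<lambda>B. B i) Bs) j l)) \<le> (\<Sum>e\<in>E. k e (j - s i e) (l - s i e)))"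
proof -
  have m: "cmod (entry (X - 1) j l) = cmod (entry (1 - X) j l)" for X :: "int bop" and j l
    by (simp add: entry_diff norm_minus_commute)
  obtain k where k: "(\<Sum>e\<in>E. knorm (k e)) < Orderings.top" "\<And>i j l. j \<in> cells E (s i) \<Longrightarrow> l \<in> cells E (s i) \<Longrightarrow>
    ennreal (cmod (entry (1 - ratioL (proj (cells E (s i))) (map (\<lambda>B. B i) Bs)) j l)) \<le> (\<Sum>e\<in>E. k e (j - s i e) (l - s i e))"
    using ratioL_ratioR_dominated(1)[of Bs E s, OF assms] by blast
  then show "\<exists>k. (\<Sum>e\<in>E. knorm (k e)) < Orderings.top \<and>
     (\<forall>i j l. ennreal (cmod (cornerL (cells E (s i)) (map (\<lambda>B. B i) Bs) j l)) \<le> (\<Sum>e\<in>E. k e (j - s i e) (l - s i e)))"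
    by (intro exI[of _ k]) (auto simp: cornerL_def m)
  obtain k where k: "(\<Sum>e\<in>E. knorm (k e)) < Orderings.top" "\<And>i j l. j \<in> cells E (s i) \<Longrightarrow> l \<in> cells E (s i) \<Longrightarrow>
    ennreal (cmod (entry (1 - ratioR (proj (cells E (s i))) (map (\<lambda>B. B i) Bs)) j l)) \<le> (\<Sum>e\<in>E. k e (j - s i e) (l - s i e))"
    using ratioL_ratioR_dominated(2)[of Bs E s, OF assms] by blast
  then show "\<exists>k. (\<Sum>e\<in>E. knorm (k e)) < Orderings.top \<and>
     (\<forall>i j l. ennreal (cmod (cornerR (cells E (s i)) (map (\<lambda>B. B i) Bs) j l)) \<le> (\<Sum>e\<in>E. k e (j - s i e) (l - s i e)))"
    by (intro exI[of _ k]) (auto simp: cornerR_def m)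
qed

lemma corners_Conv:
  fixes Bs :: "(nat option \<Rightarrow> int bop) list"
  assumes B: "\<And>B. B \<in> set Bs \<Longrightarrow> \<exists>c. Conv B c"
    and J: "\<And>j. \<forall>\<^sub>F n in sequentially. j \<in> J (Some n) \<longleftrightarrow> j \<in> J None"
  shows "(\<lambda>n. cornerL (J (Some n)) (map (\<lambda>B. B (Some n)) Bs) j l) \<longlonglongrightarrow> cornerL (J None) (map (\<lambda>B. B None) Bs) j l"
    and "(\<lambda>n. cornerR (J (Some n)) (map (\<lambda>B. B (Some n)) Bs) j l) \<longlonglongrightarrow> cornerR (J None) (map (\<lambda>B. B None) Bs) j l"
proof -
  have ev: "\<forall>\<^sub>F n in sequentially. (j \<in> J (Some n) \<and> l \<in> J (Some n)) = (j \<in> J None \<and> l \<in> J None)"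
    using J[of j] J[of l] by eventually_elim auto
  have gen: "(\<lambda>n. if j \<in> J (Some n) \<and> l \<in> J (Some n) then entry (X (Some n) - 1) j l else 0)
      \<longlonglongrightarrow> (if j \<in> J None \<and> l \<in> J None then entry (X None - 1) j l else 0)" if X: "\<exists>c. Conv X c" for X
  proof -
    obtain c where "Conv X c" using X by blast
    from ConvD[OF this] have "(\<lambda>n. entry (X (Some n) - 1) j l) \<longlonglongrightarrow> entry (X None - 1) j l"
      unfolding entry_diff by (intro tendsto_intros)
    then have "(\<lambda>n. if j \<in> J None \<and> l \<in> J None then entry (X (Some n) - 1) j l else 0)
      \<longlonglongrightarrow> (if j \<in> J None \<and> l \<in> J None then entry (X None - 1) j l else 0)" by auto
    then show ?thesis
      by (rule Lim_transform_eventually) (use ev in \<open>auto elim!: eventually_mono\<close>)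
  qed
  show "(\<lambda>n. cornerL (J (Some n)) (map (\<lambda>B. B (Some n)) Bs) j l) \<longlonglongrightarrow> cornerL (J None) (map (\<lambda>B. B None) Bs) j l"
    using gen[OF ratioL_ratioR_Conv(1)[OF B J]] by (simp add: cornerL_def)
  show "(\<lambda>n. cornerR (J (Some n)) (map (\<lambda>B. B (Some n)) Bs) j l) \<longlonglongrightarrow> cornerR (J None) (map (\<lambda>B. B None) Bs) j l"
    using gen[OF ratioL_ratioR_Conv(2)[OF B J]] by (simp add: cornerR_def)
qed

text \<open>Each exponent is cut to a finite square, where the finite identity holds. The
  truncations share the Laurent majorant of the original operator, so both corner kernels have
  summable majorants and their determinants converge.\<close>

lemma Jacobi:
  assumes B: "\<And>B. B \<in> set Bs \<Longrightarrow> tame (\<lambda>_::unit. B)"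
  shows "kernel_det (cornerL {..<0} Bs) = kernel_det (cornerR {0..} Bs)"
proof -
  define T :: "int bop \<Rightarrow> nat option \<Rightarrow> int bop" where
    "T B = (\<lambda>i. case i of None \<Rightarrow> B | Some m \<Rightarrow> proj {- int m..<int m} * B * proj {- int m..<int m})" for B
  have T: "\<exists>c. Conv (T B) c" if B': "B \<in> set Bs" for B
  proof -
    obtain \<mu> where \<mu>: "wnorm \<mu> < Orderings.top" "ldom \<mu> B" using B[OF B'] by (auto simp: tame_def)
    show ?thesis
    proof (rule ConvI[OF _ \<mu>(1)])
      show "ldom \<mu> (T B i)" for i using \<mu>(2) by (auto simp: T_def ldom_proj split: option.split)
      fix j l
      have "\<forall>\<^sub>F n in sequentially. entry (T B (Some n)) j l = entry (T B None) j l"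
        unfolding eventually_sequentially
        by (rule exI[of _ "nat (max \<bar>j\<bar> \<bar>l\<bar> + 1)"]) (auto simp: T_def entry_proj_left entry_proj_right)
      then show "(\<lambda>n. entry (T B (Some n)) j l) \<longlonglongrightarrow> entry (T B None) j l" by (rule tendsto_eventually)
    qed
  qed
  have tT: "tame (T B)" if B: "B \<in> set Bs" for B
  proof -
    obtain c where "Conv (T B) c" using T[OF B] by blast
    then obtain \<mu> where "wnorm \<mu> \<le> ennreal c" "\<And>i. ldom \<mu> (T B i)" unfolding Conv_def by blast
    then show ?thesis unfolding tame_def using le_less_trans[of "wnorm \<mu>" "ennreal c" Orderings.top] by auto
  qed
  let ?Ts = "map T Bs"
  have tT': "B \<in> set ?Ts \<Longrightarrow> tame B" for B using tT by auto
  have mS: "map (\<lambda>B. B None) ?Ts = Bs" by (simp add: T_def o_def)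
  have cT: "B \<in> set ?Ts \<Longrightarrow> \<exists>c. Conv B c" for B using T by auto
  have fin: "kernel_det (cornerL {..<0} (map (\<lambda>B. B (Some m)) ?Ts)) = kernel_det (cornerR {0..} (map (\<lambda>B. B (Some m)) ?Ts))" for m
    by (rule Jacobi_finite[of "{- int m..<int m}"]) (auto simp: T_def rsupp_def proj_idem simp flip: mult.assoc)
  obtain k where k: "(\<Sum>e\<in>{False}. knorm (k e)) < Orderings.top"
     "\<And>i j l. ennreal (cmod (cornerL (cells {False} (\<lambda>_. 0)) (map (\<lambda>B. B i) ?Ts) j l)) \<le> (\<Sum>e\<in>{False}. k e (j - 0) (l - 0))"
    using corners_dominated(1)[of ?Ts "{False}" "\<lambda>_ _. 0", OF tT'] by blast
  have 1: "(\<lambda>m. kernel_det (cornerL {..<0} (map (\<lambda>B. B (Some m)) ?Ts))) \<longlonglongrightarrow> kernel_det (cornerL {..<0} (map (\<lambda>B. B None) ?Ts))"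
  proof (rule kernel_det_dominated_convergence)
    show "(\<lambda>m. cornerL {..<0} (map (\<lambda>B. B (Some m)) ?Ts) i j) \<longlonglongrightarrow> cornerL {..<0} (map (\<lambda>B. B None) ?Ts) i j" for i j
      using corners_Conv(1)[of ?Ts "\<lambda>_. {..<0}" i j, OF cT] by simp
    show "ennreal (cmod (cornerL {..<0} (map (\<lambda>B. B (Some m)) ?Ts) i j)) \<le> k False i j" for m i j
      using k(2)[of "Some m" i j] by (simp add: cells_simps)
    show "esum (\<lambda>i. esum (k False i)) < Orderings.top" using k(1) by (simp add: knorm_def)
  qed
  obtain k where k: "(\<Sum>e\<in>{True}. knorm (k e)) < Orderings.top"
     "\<And>i j l. ennreal (cmod (cornerR (cells {True} (\<lambda>_. 0)) (map (\<lambda>B. B i) ?Ts) j l)) \<le> (\<Sum>e\<in>{True}. k e (j - 0) (l - 0))"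
    using corners_dominated(2)[of ?Ts "{True}" "\<lambda>_ _. 0", OF tT'] by blast
  have 2: "(\<lambda>m. kernel_det (cornerR {0..} (map (\<lambda>B. B (Some m)) ?Ts))) \<longlonglongrightarrow> kernel_det (cornerR {0..} (map (\<lambda>B. B None) ?Ts))"
  proof (rule kernel_det_dominated_convergence)
    show "(\<lambda>m. cornerR {0..} (map (\<lambda>B. B (Some m)) ?Ts) i j) \<longlonglongrightarrow> cornerR {0..} (map (\<lambda>B. B None) ?Ts) i j" for i j
      using corners_Conv(2)[of ?Ts "\<lambda>_. {0..}" i j, OF cT] by simp
    show "ennreal (cmod (cornerR {0..} (map (\<lambda>B. B (Some m)) ?Ts) i j)) \<le> k True i j" for m i j
      using k(2)[of "Some m" i j] by (simp add: cells_simps)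
    show "esum (\<lambda>i. esum (k True i)) < Orderings.top" using k(1) by (simp add: knorm_def)
  qed
  show ?thesis
    using LIMSEQ_unique[OF 1 2[folded fin]] unfolding mS .
qed

end

section \<open>Compression and translation\<close>

text \<open>An identity between the entries of all powers passes to the exponential series. The map
  \<open>f\<close> is the inclusion of the naturals for compressions and a shift for
  translations.\<close>

lemma entry_exp_transfer:
  assumes "\<And>k i j. entry (Y ^ k) i j = entry (X ^ k) (f i) (f j)"
  shows "entry (exp Y) i j = entry (exp X) (f i) (f j)"
proof -
  have "(\<lambda>k. entry (Y ^ k /\<^sub>R fact k) i j) sums entry (exp Y) i j"
    by (rule entry_sums[OF exp_converges])
  moreover have "(\<lambda>k. entry (X ^ k /\<^sub>R fact k) (f i) (f j)) sums entry (exp X) (f i) (f j)"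
    by (rule entry_sums[OF exp_converges])
  ultimately show ?thesis using sums_unique2 by (simp add: entry_scaleR assms)
qed

lemma compression_mult: "compression A * compression B = compression (A * proj {0..} * B)"
proof (rule bop_eqI)
  fix i j
  have "entry (compression (A * proj {0..} * B)) i j = (\<Sum>\<^sub>\<infinity>l. (if l \<in> {0..} then entry A (int i) l else 0) * entry B l (int j))"
    by (simp add: entry_compression entry_times[of "A * proj {0..}"] entry_proj_right)
  also have "\<dots> = infsum (\<lambda>l. entry A (int i) l * entry B l (int j)) (range int)"
  proof (rule infsum_cong_neutral)
    fix l :: int assume "l \<in> UNIV - range int"
    then have "l \<notin> {0..}" by (metis DiffD2 atLeast_iff int_nat_eq rangeI)
    then show "(if l \<in> {0..} then entry A (int i) l else 0) * entry B l (int j) = 0" by simp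
  qed auto
  also have "\<dots> = (\<Sum>\<^sub>\<infinity>l. entry A (int i) (int l) * entry B (int l) (int j))"
    by (subst infsum_reindex) (auto simp: o_def)
  also have "\<dots> = entry (compression A * compression B) i j"
    by (simp add: entry_times entry_compression)
  finally show "entry (compression A * compression B) i j = entry (compression (A * proj {0..} * B)) i j" by simp
qed

lemma compression_proj_left: "compression (proj {0..} * A) = compression A"
  by (rule bop_eqI) (simp add: entry_compression entry_proj_left)

lemma compression_one: "compression 1 = 1"
  by (rule bop_eqI) (simp add: entry_compression entry_one)

lemma compression_uminus: "compression (- A) = - compression A"
  by (rule bop_eqI) (simp add: entry_compression entry_uminus)

text \<open>Powers of the compression are compressions of powers of PBP, in which the projections
  between the factors are already present.\<close>

lemma compression_exp: "exp (compression B) = compression (exp (proj {0..} * B * proj {0..}))"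
proof (rule bop_eqI)
  fix i j
  have "compression B ^ k = compression ((proj {0..} * B * proj {0..}) ^ k)" for k
  proof (induction k)
    case (Suc k)
    then show ?case
      using compression_mult[of B "(proj {0..} * B * proj {0..}) ^ k"]
        compression_proj_left[of "B * proj {0..} * (proj {0..} * B * proj {0..}) ^ k"]
      by (simp add: mult.assoc)
  qed (simp add: compression_one)
  then show "entry (exp (compression B)) i j = entry (compression (exp (proj {0..} * B * proj {0..}))) i j"
    unfolding entry_compression by (intro entry_exp_transfer) (simp add: entry_compression)
qed

lemma compression_mult_commute:
  assumes "proj {0..} * A = A * proj {0..}"
  shows "compression A * compression B = compression (A * B)"
  unfolding compression_mult assms[symmetric] mult.assoc compression_proj_left ..

lemma compression_exp_prod:
  "exp_prod (map compression Bs) = compression (exp_prod (map (\<lambda>B. proj {0..} * B * proj {0..}) Bs))"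
proof (induction Bs)
  case (Cons B Bs)
  have "proj {0..} * exp_prod [proj {0..} * B * proj {0..}] = exp_prod [proj {0..} * B * proj {0..}] * proj {0..}"
    by (rule exp_prod_compressed_compl(3)) auto
  then show ?case using Cons by (simp add: compression_exp compression_mult_commute)
qed (simp add: compression_one)

lemma compression_ratioL:
  "compression (exp_prod Bs) * exp_prod (map (\<lambda>B. - compression B) (rev Bs)) = compression (ratioL (proj {0..}) Bs)"
proof -
  have "exp_prod (map (\<lambda>B. - compression B) (rev Bs)) = exp_prod (map compression (map uminus (rev Bs)))"
    by (simp add: o_def compression_uminus)
  also have "\<dots> = compression (exp_prod (map (\<lambda>B. - (proj {0..} * B * proj {0..})) (rev Bs)))"
    unfolding compression_exp_prod by (simp add: o_def)
  finally show ?thesis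
    by (simp add: compression_mult ratioL_def mult.assoc compression_proj_left)
qed

lemma compression_ratioR:
  "exp_prod (map compression Bs) * compression (exp_prod (map uminus (rev Bs))) = compression (ratioR (proj {0..}) Bs)"
  unfolding compression_exp_prod compression_mult ratioR_def
  by (rule bop_eqI) (simp add: entry_compression entry_proj_right flip: mult.assoc)

context weight
begin

text \<open>The summable majorant supplies the trace class condition under which
  \<open>fredholm_det\<close> is the sum of minors. That sum is then reindexed along the inclusion
  of the naturals in the integers.\<close>

lemma fredholm_det_corner:
  assumes k: "\<And>i j. ennreal (cmod (corner i j)) \<le> k i j" "knorm k < Orderings.top"
    and c: "corner = (\<lambda>i j. if i \<in> {0..} \<and> j \<in> {0..} then entry (G - 1) i j else 0)"
  shows "fredholm_det (compression G) = kernel_det corner"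
proof -
  have e: "entry (compression G - 1) i j = corner (int i) (int j)" for i j
    by (simp add: c entry_diff entry_compression entry_one)
  have "esum (\<lambda>i. esum (\<lambda>j. ennreal (cmod (entry (compression G - 1) i j)))) \<le> esum (\<lambda>i. esum (\<lambda>j. k (int i) (int j)))"
    unfolding e by (intro esum_mono k)
  also have "\<dots> \<le> esum (\<lambda>i. esum (k (int i)))"
    by (intro esum_mono esum_inj_le) simp
  also have "\<dots> \<le> knorm k"
    unfolding knorm_def by (rule esum_inj_le) simp
  also note k(2)
  finally have "fredholm_det (compression G) = op_det (compression G)" by (rule fredholm_det_eq_op_det)
  also have "\<dots> = kernel_det (\<lambda>i j. corner (int i) (int j))"
    unfolding op_det_def e ..
  also have "\<dots> = kernel_det corner"
  proof (rule kernel_det_inj[symmetric])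
    fix i j :: int assume "i \<notin> range int"
    then have "i \<notin> {0..}" by (metis atLeast_iff int_nat_eq rangeI)
    then show "corner i j = 0" by (simp add: c)
  qed simp
  finally show ?thesis .
qed

lemma fredholm_det_corners:
  assumes "\<And>B. B \<in> set Bs \<Longrightarrow> tame (\<lambda>_::unit. B)"
  shows "fredholm_det (compression (exp_prod Bs) * exp_prod (map (\<lambda>B. - compression B) (rev Bs))) = kernel_det (cornerL {0..} Bs)"
    and "fredholm_det (exp_prod (map compression Bs) * compression (exp_prod (map uminus (rev Bs)))) = kernel_det (cornerR {0..} Bs)"
proof -
  let ?Bs = "map (\<lambda>B (_::unit). B) Bs"
  have B: "B \<in> set ?Bs \<Longrightarrow> tame B" for B using assms by auto
  have eq: "map (\<lambda>B. B ()) ?Bs = Bs" by (simp add: o_def)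
  obtain k where k: "(\<Sum>e\<in>{True}. knorm (k e)) < Orderings.top"
     "\<And>i j l. ennreal (cmod (cornerL (cells {True} (\<lambda>_. 0)) (map (\<lambda>B. B i) ?Bs) j l)) \<le> (\<Sum>e\<in>{True}. k e (j - 0) (l - 0))"
    using corners_dominated(1)[of ?Bs "{True}" "\<lambda>_ _. 0", OF B] by blast
  show "fredholm_det (compression (exp_prod Bs) * exp_prod (map (\<lambda>B. - compression B) (rev Bs))) = kernel_det (cornerL {0..} Bs)"
    unfolding compression_ratioL
  proof (rule fredholm_det_corner)
    show "ennreal (cmod (cornerL {0..} Bs i j)) \<le> k True i j" for i j
      using k(2)[of "()" i j] unfolding eq by (simp add: cells_simps)
  qed (use k(1) in \<open>auto simp: cornerL_def[abs_def]\<close>)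
  obtain k where k: "(\<Sum>e\<in>{True}. knorm (k e)) < Orderings.top"
     "\<And>i j l. ennreal (cmod (cornerR (cells {True} (\<lambda>_. 0)) (map (\<lambda>B. B i) ?Bs) j l)) \<le> (\<Sum>e\<in>{True}. k e (j - 0) (l - 0))"
    using corners_dominated(2)[of ?Bs "{True}" "\<lambda>_ _. 0", OF B] by blast
  show "fredholm_det (exp_prod (map compression Bs) * compression (exp_prod (map uminus (rev Bs)))) = kernel_det (cornerR {0..} Bs)"
    unfolding compression_ratioR
  proof (rule fredholm_det_corner)
    show "ennreal (cmod (cornerR {0..} Bs i j)) \<le> k True i j" for i j
      using k(2)[of "()" i j] unfolding eq by (simp add: cells_simps)
  qed (use k(1) in \<open>auto simp: cornerR_def[abs_def]\<close>)
qed

end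

section \<open>Translation to the end points of the interval\<close>

definition translate :: "int \<Rightarrow> int bop \<Rightarrow> int bop" where
  "translate h X = shift_op (- h) * X * shift_op h"

lemma entry_translate: "entry (translate h X) i j = entry X (i + h) (j + h)"
  by (simp add: translate_def entry_shift_left entry_shift_right)

lemma translate_mult: "translate h (X * Y) = translate h X * translate h Y"
proof -
  have "shift_op h * shift_op (- h) = 1"
    by (rule bop_eqI) (simp add: entry_shift_left entry_shift_op entry_one)
  then have "shift_op h * (shift_op (- h) * Z) = Z" for Z by (simp flip: mult.assoc)
  then show ?thesis by (simp add: translate_def mult.assoc)
qed

lemma translate_one: "translate h 1 = 1"
  by (rule bop_eqI) (simp add: entry_translate entry_one)

lemma translate_uminus: "translate h (- X) = - translate h X"
  by (simp add: translate_def)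

lemma translate_power: "translate h X ^ k = translate h (X ^ k)"
  by (induction k) (simp_all add: translate_one translate_mult)

lemma translate_exp: "translate h (exp X) = exp (translate h X)"
  by (rule bop_eqI) (simp add: entry_translate entry_exp_transfer[where f = "\<lambda>i. i + h" and X = X] translate_power)

lemma translate_exp_prod: "translate h (exp_prod Bs) = exp_prod (map (translate h) Bs)"
  by (induction Bs) (simp_all add: translate_one translate_mult translate_exp)

lemma translate_proj: "translate h (proj J) = proj {i. i + h \<in> J}"
  by (rule bop_eqI) (simp add: entry_translate entry_proj)

lemma translate_ratioL: "translate h (ratioL (proj J) Bs) = ratioL (proj {i. i + h \<in> J}) (map (translate h) Bs)"
  by (simp add: ratioL_def translate_mult translate_exp_prod translate_proj translate_uminus o_def rev_map)

lemma cornerL_shift: "cornerL J Bs (i + h) (j + h) = cornerL {i. i + h \<in> J} (map (translate h) Bs) i j"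
  by (simp add: cornerL_def translate_ratioL[symmetric] entry_diff entry_one entry_translate)

context weight
begin

lemma ldom_translate: "ldom \<mu> (translate h X) \<longleftrightarrow> ldom \<mu> X"
proof
  assume X: "ldom \<mu> (translate h X)"
  show "ldom \<mu> X"
    unfolding ldom_def using X[unfolded ldom_def entry_translate]
    by (metis add_diff_cancel_right diff_add_cancel)
next
  assume X: "ldom \<mu> X"
  show "ldom \<mu> (translate h X)"
    unfolding ldom_def entry_translate
  proof (intro allI)
    fix i j show "ennreal (cmod (entry X (i + h) (j + h))) \<le> \<mu> (i - j)"
      using ldomD[OF X, of "i + h" "j + h"] by simp
  qed
qed

text \<open>\<open>V1 A\<close> and \<open>V2 A\<close> stand for the limit operators of
  \<open>A\<close> at the two ends. The majorant comes from the constant family \<open>A\<close>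
  over the moving intervals, the entrywise limits from translated operators on translated
  intervals.\<close>

lemma kernel_det_cornerL_limit:
  assumes h: "filterlim (\<lambda>n. h2 n - h1 n) at_top sequentially"
    and A: "\<And>A. A \<in> set As \<Longrightarrow> tame (\<lambda>_::unit. A)"
    and C1: "\<And>A. A \<in> set As \<Longrightarrow> \<exists>c. Conv (\<lambda>i. case i of None \<Rightarrow> V1 A | Some n \<Rightarrow> translate (h1 n) A) c"
    and C2: "\<And>A. A \<in> set As \<Longrightarrow> \<exists>c. Conv (\<lambda>i. case i of None \<Rightarrow> V2 A | Some n \<Rightarrow> translate (h2 n) A) c"
  shows "(\<lambda>n. kernel_det (cornerL {h1 n..<h2 n} As)) \<longlonglongrightarrow> kernel_det (cornerL {0..} (map V1 As)) * kernel_det (cornerL {..<0} (map V2 As))"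
proof -
  define s where "s n e = (if e then h1 n else h2 n)" for n :: nat and e
  have sJ: "cells UNIV (s n) = {h1 n..<h2 n}" for n by (simp add: cells_simps s_def)
  let ?As = "map (\<lambda>A (_::nat). A) As"
  have "B \<in> set ?As \<Longrightarrow> tame B" for B using A tame_const by auto
  from corners_dominated(1)[of ?As UNIV s, OF this]
  obtain k where k: "(\<Sum>e\<in>UNIV. knorm (k e)) < Orderings.top"
     "\<And>i j l. ennreal (cmod (cornerL {h1 i..<h2 i} As j l)) \<le> (\<Sum>e\<in>UNIV. k e (j - s i e) (l - s i e))"
    by (auto simp: sJ o_def)
  \<comment> \<open>The limit operator is the \<open>None\<close> member of a convergent family and
    so has the common majorant.\<close>
  have tV: "tame (\<lambda>_::unit. V A)" if VA: "A \<in> set As" "\<exists>c. Conv (\<lambda>i. case i of None \<Rightarrow> V A | Some n \<Rightarrow> translate (h n) A) c" for V A and h :: "nat \<Rightarrow> int"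
  proof -
    obtain c where "Conv (\<lambda>i. case i of None \<Rightarrow> V A | Some n \<Rightarrow> translate (h n) A) c" using VA by blast
    then obtain \<mu> where \<mu>: "wnorm \<mu> \<le> ennreal c" "\<And>i. ldom \<mu> (case i of None \<Rightarrow> V A | Some n \<Rightarrow> translate (h n) A)"
      unfolding Conv_def by blast
    have "ldom \<mu> (V A)" using \<mu>(2)[of None] by simp
    moreover have "wnorm \<mu> < Orderings.top" using \<mu>(1) by (rule le_less_trans) simp
    ultimately show ?thesis unfolding tame_def by blast
  qed
  have hs: "\<forall>\<^sub>F n in sequentially. c \<le> h2 n - h1 n" for c
    using h by (simp add: filterlim_at_top)
  have lim1: "(\<lambda>n. cornerL {h1 n..<h2 n} As (i + h1 n) (j + h1 n)) \<longlonglongrightarrow> cornerL {0..} (map V1 As) i j" for i j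
  proof -
    \<comment> \<open>Seen from its left end the interval exhausts the right half-line; seen from
      its right end, in \<open>lim2\<close>, it exhausts the left one.\<close>
    define J where "J i = (case i of None \<Rightarrow> {0..} | Some n \<Rightarrow> {i. i + h1 n \<in> {h1 n..<h2 n}})" for i
    define Fs where "Fs = map (\<lambda>A i. case i of None \<Rightarrow> V1 A | Some n \<Rightarrow> translate (h1 n) A) As"
    have "\<forall>\<^sub>F n in sequentially. j \<in> J (Some n) \<longleftrightarrow> j \<in> J None" for j
      using hs[of "j + 1"] by eventually_elim (auto simp: J_def)
    moreover have "B \<in> set Fs \<Longrightarrow> \<exists>c. Conv B c" for B using C1 by (auto simp: Fs_def)
    ultimately have "(\<lambda>n. cornerL (J (Some n)) (map (\<lambda>B. B (Some n)) Fs) i j) \<longlonglongrightarrow> cornerL (J None) (map (\<lambda>B. B None) Fs) i j"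
      by (intro corners_Conv(1))
    then show ?thesis by (simp only: cornerL_shift) (simp add: J_def Fs_def o_def)
  qed
  have lim2: "(\<lambda>n. cornerL {h1 n..<h2 n} As (i + h2 n) (j + h2 n)) \<longlonglongrightarrow> cornerL {..<0} (map V2 As) i j" for i j
  proof -
    define J where "J i = (case i of None \<Rightarrow> {..<0} | Some n \<Rightarrow> {i. i + h2 n \<in> {h1 n..<h2 n}})" for i
    define Fs where "Fs = map (\<lambda>A i. case i of None \<Rightarrow> V2 A | Some n \<Rightarrow> translate (h2 n) A) As"
    have "\<forall>\<^sub>F n in sequentially. j \<in> J (Some n) \<longleftrightarrow> j \<in> J None" for j
      using hs[of "- j"] by eventually_elim (auto simp: J_def)
    moreover have "B \<in> set Fs \<Longrightarrow> \<exists>c. Conv B c" for B using C2 by (auto simp: Fs_def)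
    ultimately have "(\<lambda>n. cornerL (J (Some n)) (map (\<lambda>B. B (Some n)) Fs) i j) \<longlonglongrightarrow> cornerL (J None) (map (\<lambda>B. B None) Fs) i j"
      by (intro corners_Conv(1))
    then show ?thesis by (simp only: cornerL_shift) (simp add: J_def Fs_def o_def)
  qed
  let ?V1 = "map (\<lambda>A (_::unit). V1 A) As" and ?V2 = "map (\<lambda>A (_::unit). V2 A) As"
  have "tame (\<lambda>_::unit. V1 A)" if "A \<in> set As" for A by (rule tV[of A V1 h1, OF that C1[OF that]])
  then have "B \<in> set ?V1 \<Longrightarrow> tame B" for B by auto
  from corners_dominated(1)[of ?V1 "{True}" "\<lambda>_ _. 0", OF this]
  obtain l1 where l1: "knorm (l1 True) < Orderings.top" "\<And>j l. ennreal (cmod (cornerL {0..} (map V1 As) j l)) \<le> l1 True j l"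
    by (auto simp: cells_simps o_def)
  have "tame (\<lambda>_::unit. V2 A)" if "A \<in> set As" for A by (rule tV[of A V2 h2, OF that C2[OF that]])
  then have "B \<in> set ?V2 \<Longrightarrow> tame B" for B by auto
  from corners_dominated(1)[of ?V2 "{False}" "\<lambda>_ _. 0", OF this]
  obtain l2 where l2: "knorm (l2 False) < Orderings.top" "\<And>j l. ennreal (cmod (cornerL {..<0} (map V2 As) j l)) \<le> l2 False j l"
    by (auto simp: cells_simps o_def)
  show ?thesis
  proof (rule kernel_det_two_corners[OF _ _ _ _ lim1 lim2 l1(2,1) l2(2,1) _ _ h])
    show "ennreal (cmod (cornerL {h1 n..<h2 n} As i j)) \<le> k True (i - h1 n) (j - h1 n) + k False (i - h2 n) (j - h2 n)" for n i j
      using k(2)[of n i j] by (simp add: UNIV_bool s_def add.commute)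
    show "knorm (k True) < Orderings.top" "knorm (k False) < Orderings.top"
      using k(1) by (auto simp: UNIV_bool)
  qed (auto simp: cornerL_def split: if_splits)
qed

end

section \<open>Absolutely convergent double sums\<close>

lemma esum_pair_summable:
  fixes f :: "'a \<Rightarrow> 'b \<Rightarrow> 'c::banach"
  assumes "esum (\<lambda>x. esum (\<lambda>y. ennreal (norm (f x y)))) < Orderings.top"
  shows "(\<lambda>(x, y). f x y) summable_on UNIV" "(\<lambda>y. f x y) summable_on UNIV"
    "(\<lambda>x. infsum (f x) UNIV) summable_on UNIV"
proof -
  show "(\<lambda>(x, y). f x y) summable_on UNIV"
    using assms esum_summable(2)[of "\<lambda>(x, y). f x y"] by (simp add: esum_prod case_prod_unfold)
  show "(\<lambda>y. f x y) summable_on UNIV" for x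
    by (rule esum_summable(2)) (rule le_less_trans[OF esum_ge_point[of "\<lambda>x. esum (\<lambda>y. ennreal (norm (f x y)))"] assms])
  have "esum (\<lambda>x. ennreal (norm (infsum (f x) UNIV))) < Orderings.top"
    by (rule le_less_trans[OF esum_mono assms]) (rule esum_infsum_norm_le)
  then show "(\<lambda>x. infsum (f x) UNIV) summable_on UNIV" by (rule esum_summable(2))
qed

lemma infsum_pair_esum:
  fixes f :: "'a \<Rightarrow> 'b \<Rightarrow> 'c::banach"
  assumes "esum (\<lambda>x. esum (\<lambda>y. ennreal (norm (f x y)))) < Orderings.top"
  shows "(\<Sum>\<^sub>\<infinity>x. \<Sum>\<^sub>\<infinity>y. f x y) = (\<Sum>\<^sub>\<infinity>(x, y). f x y)"
  using infsum_Sigma'_banach[of f UNIV "\<lambda>_. UNIV"] esum_pair_summable(1)[OF assms] by simp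

lemma infsum_swap_esum:
  fixes f :: "'a \<Rightarrow> 'b \<Rightarrow> 'c::banach"
  assumes "esum (\<lambda>x. esum (\<lambda>y. ennreal (norm (f x y)))) < Orderings.top"
  shows "(\<Sum>\<^sub>\<infinity>x. \<Sum>\<^sub>\<infinity>y. f x y) = (\<Sum>\<^sub>\<infinity>y. \<Sum>\<^sub>\<infinity>x. f x y)"
  using infsum_swap_banach[of f UNIV UNIV] esum_pair_summable(1)[OF assms] by simp

lemma infsum_shift:
  fixes f :: "'a::ab_group_add \<Rightarrow> 'b::{comm_monoid_add,t2_space}"
  shows "(\<Sum>\<^sub>\<infinity>x. f (x - a)) = infsum f UNIV" "(\<Sum>\<^sub>\<infinity>x. f (a - x)) = infsum f UNIV"
proof -
  have "bij (\<lambda>x. x - a)" by (rule bij_betw_byWitness[where f' = "\<lambda>x. x + a"]) auto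
  then show "(\<Sum>\<^sub>\<infinity>x. f (x - a)) = infsum f UNIV" by (rule infsum_reindex_bij_betw)
  have "bij (\<lambda>x. a - x)" by (rule bij_betw_byWitness[where f' = "\<lambda>x. a - x"]) auto
  then show "(\<Sum>\<^sub>\<infinity>x. f (a - x)) = infsum f UNIV" by (rule infsum_reindex_bij_betw)
qed

lemma has_sum_sum_finite:
  fixes f :: "'i \<Rightarrow> 'a \<Rightarrow> complex"
  assumes "finite I" "\<And>i. i \<in> I \<Longrightarrow> (f i has_sum s i) A"
  shows "((\<lambda>x. \<Sum>i\<in>I. f i x) has_sum (\<Sum>i\<in>I. s i)) A"
  using assms by (induction I rule: finite_induct) (auto intro!: has_sum_add)

section \<open>Characters\<close>

lemma echar_add: "echar (\<xi> + \<eta>) k = echar \<xi> k * echar \<eta> k"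
  by transfer (simp add: exp_add[symmetric] algebra_simps)

lemma echar_plus: "echar \<xi> (k + l) = echar \<xi> k * echar \<xi> l"
  by transfer (simp add: exp_add[symmetric] algebra_simps)

lemma echar_zero [simp]: "echar 0 k = 1"
  by transfer simp

lemma echar_at_zero [simp]: "echar \<xi> 0 = 1"
  by transfer simp

lemma cmod_echar [simp]: "cmod (echar \<xi> k) = 1"
proof transfer
  fix x :: real and k :: int
  have "2 * of_real pi * \<i> * of_int k * of_real x = \<i> * of_real (2 * pi * of_int k * x)" by simp
  then show "cmod (exp (2 * of_real pi * \<i> * of_int k * of_real x)) = 1" by (simp only: norm_exp_i_times)
qed

lemma echar_power: "echar \<xi> (int n) = echar \<xi> 1 ^ n"
  by (induction n) (simp_all add: echar_plus)

text \<open>For the representative y with |y| <= 1/2 the right-hand side is 2 |sin t| with t = pi y.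
  As |t| <= 2, the bound |sin t - t| <= |t|^3 / 6 gives |sin t| >= |t| / 3, and |t| >= 2 |y|
  completes the estimate.\<close>

lemma rz_norm_le: "rz_norm \<xi> \<le> cmod (1 - echar \<xi> 1)"
proof -
  obtain x where x: "\<xi> = abs_rmodz x" by (metis Quotient3_abs_rep Quotient3_rmodz)
  define y where "y = x - of_int (round x)"
  have y2: "\<bar>y\<bar> \<le> 1 / 2" using of_int_round_abs_le[of x] by (simp add: y_def abs_minus_commute)
  have xy: "\<xi> = abs_rmodz y" unfolding x by (simp add: rmodz.abs_eq_iff y_def)
  have "rz_norm \<xi> = (INF n::int. \<bar>y - of_int n\<bar>)" unfolding xy by (rule rz_norm.abs_eq)
  also have "\<dots> \<le> \<bar>y - of_int 0\<bar>"
    by (rule cINF_lower) (auto intro: bdd_belowI[of _ 0])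
  finally have 1: "rz_norm \<xi> \<le> \<bar>y\<bar>" by simp
  define t where "t = pi * y"
  have "\<bar>t\<bar> = pi * \<bar>y\<bar>" by (simp add: t_def abs_mult)
  also have "\<dots> \<le> 4 * (1 / 2)" using y2 pi_less_4 by (intro mult_mono) auto
  finally have t2: "\<bar>t\<bar> \<le> 2" by simp
  have "\<bar>sin t - t\<bar> \<le> \<bar>t\<bar> ^ 3 / 6"
    using Maclaurin_sin_bound[of t 3] by (simp add: sin_coeff_def eval_nat_numeral)
  also have "\<dots> \<le> \<bar>t\<bar> * 4 / 6"
  proof -
    have "\<bar>t\<bar> ^ 2 \<le> 2 ^ 2" using t2 by (intro power_mono) auto
    then have "\<bar>t\<bar> * \<bar>t\<bar> ^ 2 \<le> \<bar>t\<bar> * 4" by (intro mult_left_mono) auto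
    then show ?thesis by (simp add: eval_nat_numeral)
  qed
  finally have "\<bar>t\<bar> / 3 \<le> \<bar>sin t\<bar>" by linarith
  moreover have "2 * \<bar>y\<bar> \<le> \<bar>t\<bar>" using pi_ge_two by (simp add: t_def abs_mult mult_right_mono)
  ultimately have 2: "\<bar>y\<bar> \<le> 2 * \<bar>sin t\<bar>" by linarith
  have "echar \<xi> 1 = exp (\<i> * of_real (2 * pi * y))"
    unfolding xy echar.abs_eq by (simp add: mult_ac)
  then have "cmod (1 - echar \<xi> 1) = 2 * \<bar>sin t\<bar>"
    using dist_exp_i_1[of "2 * pi * y"] by (simp add: norm_minus_commute t_def)
  then show ?thesis using 1 2 by linarith
qed

text \<open>A finite geometric sum. Its two boundary terms become the exponents in \<Theta>1 and
  \<Theta>2.\<close>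

lemma sum_echar_int:
  assumes "echar \<xi> 1 \<noteq> 1" "a \<le> b"
  shows "(\<Sum>i\<in>{a..<b}. echar \<xi> i) = (echar \<xi> a - echar \<xi> b) / (1 - echar \<xi> 1)"
  using assms(2)
proof (induction b rule: int_ge_induct)
  case (step b)
  have "{a..<b + 1} = insert b {a..<b}" using step by auto
  then have "(\<Sum>i\<in>{a..<b + 1}. echar \<xi> i) = echar \<xi> b + (echar \<xi> a - echar \<xi> b) / (1 - echar \<xi> 1)"
    using step by simp
  also have "\<dots> = (echar \<xi> a - echar \<xi> (b + 1)) / (1 - echar \<xi> 1)"
    using assms(1) by (simp add: echar_plus divide_simps) (simp add: algebra_simps)
  finally show ?case .
qed simp

section \<open>Almost periodic coefficients\<close>

locale apw =
  fixes \<Xi> :: "rmodz set" and \<beta> :: "rmodz \<Rightarrow> real"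
  assumes subgroup: "add_subgroup \<Xi>" and adm: "admissible \<Xi> \<beta>" and comp: "compatible \<Xi> \<beta>"
begin

lemma zero_in: "0 \<in> \<Xi>" and add_in: "x \<in> \<Xi> \<Longrightarrow> y \<in> \<Xi> \<Longrightarrow> x + y \<in> \<Xi>" and minus_in: "x \<in> \<Xi> \<Longrightarrow> - x \<in> \<Xi>"
  using subgroup by (auto simp: add_subgroup_def)

lemma diff_in: "x \<in> \<Xi> \<Longrightarrow> y \<in> \<Xi> \<Longrightarrow> x - y \<in> \<Xi>"
  using add_in[of x "- y"] minus_in[of y] by simp

lemma beta_ge_1: "\<xi> \<in> \<Xi> \<Longrightarrow> 1 \<le> \<beta> \<xi>"
  using adm zero_in unfolding admissible_def by (metis add.right_neutral)

lemma beta_add: "\<xi> \<in> \<Xi> \<Longrightarrow> \<eta> \<in> \<Xi> \<Longrightarrow> \<beta> (\<xi> + \<eta>) \<le> \<beta> \<xi> * \<beta> \<eta>"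
  using adm unfolding admissible_def by blast

text \<open>The infimum may be infinite, so a real \<delta> strictly below it is taken. The bound
  compensates the small divisors in the exponents of \<Theta>1 and \<Theta>2.\<close>

lemma compatible_bound:
  "\<exists>\<delta>>0. \<forall>\<xi>\<in>\<Xi> - {0}. \<delta> \<le> \<beta> \<xi> * cmod (1 - echar \<xi> 1)"
proof -
  obtain \<delta> where \<delta>: "0 < ereal \<delta>" "ereal \<delta> < (INF \<xi>\<in>\<Xi> - {0}. ereal (\<beta> \<xi> * rz_norm \<xi>))"
    using ereal_dense2 comp unfolding compatible_def by blast
  have "\<delta> \<le> \<beta> \<xi> * cmod (1 - echar \<xi> 1)" if \<xi>: "\<xi> \<in> \<Xi> - {0}" for \<xi>
  proof -
    have "ereal \<delta> \<le> ereal (\<beta> \<xi> * rz_norm \<xi>)"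
      using order_trans[OF less_imp_le[OF \<delta>(2)] INF_lower[OF \<xi>]] .
    then have "\<delta> \<le> \<beta> \<xi> * rz_norm \<xi>" by simp
    also have "\<dots> \<le> \<beta> \<xi> * cmod (1 - echar \<xi> 1)"
      using beta_ge_1[of \<xi>] \<xi> rz_norm_le by (intro mult_left_mono) auto
    finally show ?thesis .
  qed
  then show ?thesis using \<delta>(1) by auto
qed

lemma echar_ne_1: "\<xi> \<in> \<Xi> \<Longrightarrow> \<xi> \<noteq> 0 \<Longrightarrow> echar \<xi> 1 \<noteq> 1"
  using compatible_bound by force

lemma mean_echar:
  assumes "\<xi> \<in> \<Xi>"
  shows "(\<lambda>n. (\<Sum>k<n. echar \<xi> (int k)) / of_nat n) \<longlonglongrightarrow> (if \<xi> = 0 then 1 else 0)"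
proof (cases "\<xi> = 0")
  case True
  have "\<forall>\<^sub>F n in sequentially. (\<Sum>k<n. echar \<xi> (int k)) / of_nat n = 1"
    unfolding eventually_sequentially by (rule exI[of _ 1]) (simp add: True)
  then show ?thesis using True by (simp add: tendsto_eventually)
next
  case False
  let ?z = "echar \<xi> 1"
  have z: "?z \<noteq> 1" using echar_ne_1 assms False by blast
  have b: "cmod ((\<Sum>k<n. echar \<xi> (int k)) / of_nat n) \<le> 2 / cmod (1 - ?z) * inverse (real n)" for n
  proof -
    have "(\<Sum>k<n. echar \<xi> (int k)) = (1 - ?z ^ n) / (1 - ?z)"
      using z by (simp add: echar_power sum_gp_strict)
    moreover have "cmod (1 - ?z ^ n) \<le> 2"
      using norm_triangle_ineq4[of 1 "?z ^ n"] by (simp add: norm_power)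
    moreover have "cmod ((1 - ?z ^ n) / (1 - ?z) / of_nat n) = cmod (1 - ?z ^ n) * (inverse (cmod (1 - ?z)) * inverse (real n))"
      by (simp add: norm_divide norm_mult norm_inverse divide_inverse mult.assoc)
    ultimately show ?thesis
      using mult_right_mono[of "cmod (1 - ?z ^ n)" 2 "inverse (cmod (1 - ?z)) * inverse (real n)"]
      by (simp add: divide_inverse mult.assoc)
  qed
  have "(\<lambda>n. (\<Sum>k<n. echar \<xi> (int k)) / of_nat n) \<longlonglongrightarrow> 0"
  proof (rule Lim_null_comparison)
    show "\<forall>\<^sub>F n in sequentially. cmod ((\<Sum>k<n. echar \<xi> (int k)) / of_nat n) \<le> 2 / cmod (1 - ?z) * inverse (real n)"
      using b by (rule always_eventually[OF allI])
    show "(\<lambda>n. 2 / cmod (1 - ?z) * inverse (real n)) \<longlonglongrightarrow> 0"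
      by (rule tendsto_mult_right_zero) (rule lim_inverse_n)
  qed
  then show ?thesis using False by simp
qed

lemma expansion_coeff_le:
  assumes "apw_expansion \<Xi> \<beta> a c" shows "cmod (c \<xi>) \<le> \<beta> \<xi> * cmod (c \<xi>)"
proof (cases "\<xi> \<in> \<Xi>")
  case True
  show ?thesis using mult_right_mono[OF beta_ge_1[OF True], of "cmod (c \<xi>)"] by simp
next
  case False
  then show ?thesis using assms by (simp add: apw_expansion_def)
qed

text \<open>The Bohr-Fourier formula: the mean of a character is 1 or 0 according to whether it is
  trivial, and the weighted coefficients dominate the sum. It makes the coefficients unique, as the
  \<open>THE\<close> in \<open>apw_coeff\<close> requires, and gives the mean value for \<eta> =
  0.\<close>

lemma expansion_mean:
  assumes e: "apw_expansion \<Xi> \<beta> a c" and \<eta>: "\<eta> \<in> \<Xi>"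
  shows "(\<lambda>n. (\<Sum>k<n. a (int k) * echar (- \<eta>) (int k)) / of_nat n) \<longlonglongrightarrow> c \<eta>"
proof -
  define m where "m n \<xi> = (\<Sum>k<n. echar (\<xi> - \<eta>) (int k)) / of_nat n" for n \<xi>
  have hs: "((\<lambda>\<xi>. c \<xi> * m n \<xi>) has_sum (\<Sum>k<n. a (int k) * echar (- \<eta>) (int k)) / of_nat n) \<Xi>" for n
  proof -
    have "((\<lambda>\<xi>. \<Sum>k<n. c \<xi> * echar \<xi> (int k) * echar (- \<eta>) (int k)) has_sum (\<Sum>k<n. a (int k) * echar (- \<eta>) (int k))) \<Xi>"
      using e by (intro has_sum_sum_finite has_sum_cmult_left) (auto simp: apw_expansion_def)
    from has_sum_cmult_left[OF this, of "inverse (of_nat n)"] show ?thesis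
      by (simp add: m_def divide_inverse sum_distrib_left echar_add[of _ "- \<eta>", simplified] mult_ac sum_distrib_right)
  qed
  have "(\<lambda>n. \<Sum>\<^sub>\<infinity>\<xi>\<in>\<Xi>. c \<xi> * m n \<xi>) \<longlonglongrightarrow> (\<Sum>\<^sub>\<infinity>\<xi>\<in>\<Xi>. c \<xi> * (if \<xi> - \<eta> = 0 then 1 else 0))"
  proof (rule infsum_dominated_convergence(1))
    show "(\<lambda>n. c \<xi> * m n \<xi>) \<longlonglongrightarrow> c \<xi> * (if \<xi> - \<eta> = 0 then 1 else 0)" if "\<xi> \<in> \<Xi>" for \<xi>
      unfolding m_def by (intro tendsto_mult tendsto_const mean_echar diff_in that \<eta>)
    show "cmod (c \<xi> * m n \<xi>) \<le> \<beta> \<xi> * cmod (c \<xi>)" if "\<xi> \<in> \<Xi>" for n \<xi>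
    proof -
      have "cmod (m n \<xi>) \<le> 1"
      proof (cases "n = 0")
        case False
        have "cmod (\<Sum>k<n. echar (\<xi> - \<eta>) (int k)) \<le> (\<Sum>k<n. cmod (echar (\<xi> - \<eta>) (int k)))" by (rule norm_sum)
        then show ?thesis using False by (simp add: m_def norm_divide)
      qed (simp add: m_def)
      then have "cmod (c \<xi> * m n \<xi>) \<le> cmod (c \<xi>) * 1"
        unfolding norm_mult by (intro mult_left_mono) auto
      then show ?thesis using expansion_coeff_le[OF e, of \<xi>] by simp
    qed
    show "(\<lambda>\<xi>. \<beta> \<xi> * cmod (c \<xi>)) summable_on \<Xi>" using e by (simp add: apw_expansion_def)
  qed
  also have "(\<Sum>\<^sub>\<infinity>\<xi>\<in>\<Xi>. c \<xi> * (if \<xi> - \<eta> = 0 then 1 else 0)) = (\<Sum>\<^sub>\<infinity>\<xi>\<in>{\<eta>}. c \<xi>)"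
    by (rule infsum_cong_neutral) (use \<eta> in auto)
  finally show ?thesis using infsumI[OF hs] by simp
qed

lemma apw_coeff_eq: "apw_expansion \<Xi> \<beta> a c \<Longrightarrow> apw_coeff \<Xi> \<beta> a = c"
  unfolding apw_coeff_def
proof (rule the_equality)
  fix c' assume c: "apw_expansion \<Xi> \<beta> a c" and c': "apw_expansion \<Xi> \<beta> a c'"
  show "c' = c"
  proof
    fix \<xi> show "c' \<xi> = c \<xi>"
    proof (cases "\<xi> \<in> \<Xi>")
      case True
      show ?thesis using LIMSEQ_unique[OF expansion_mean[OF c' True] expansion_mean[OF c True]] .
    qed (use c c' in \<open>auto simp: apw_expansion_def\<close>)
  qed
qed

lemma mean_value_eq: "apw_expansion \<Xi> \<beta> a c \<Longrightarrow> mean_value a = c 0"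
  using expansion_mean[OF _ zero_in, of a c] unfolding mean_value_def by (simp add: limI)

lemma esum_expansion:
  assumes "apw_expansion \<Xi> \<beta> a c"
  shows "esum (\<lambda>\<xi>. ennreal (\<beta> \<xi> * cmod (c \<xi>))) = ennreal (apw_norm \<Xi> \<beta> a)"
proof -
  have n: "0 \<le> \<beta> \<xi> * cmod (c \<xi>)" for \<xi> using expansion_coeff_le[OF assms, of \<xi>] norm_ge_zero order_trans by blast
  have z: "\<beta> \<xi> * cmod (c \<xi>) = 0" if "\<xi> \<notin> \<Xi>" for \<xi> using assms that by (simp add: apw_expansion_def)
  have "(\<lambda>\<xi>. \<beta> \<xi> * cmod (c \<xi>)) summable_on UNIV \<longleftrightarrow> (\<lambda>\<xi>. \<beta> \<xi> * cmod (c \<xi>)) summable_on \<Xi>"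
    by (rule summable_on_cong_neutral) (use z in auto)
  then have "esum (\<lambda>\<xi>. ennreal (\<beta> \<xi> * cmod (c \<xi>))) = ennreal (\<Sum>\<^sub>\<infinity>\<xi>. \<beta> \<xi> * cmod (c \<xi>))"
    using assms n by (intro esum_ennreal) (auto simp: apw_expansion_def)
  also have "(\<Sum>\<^sub>\<infinity>\<xi>. \<beta> \<xi> * cmod (c \<xi>)) = (\<Sum>\<^sub>\<infinity>\<xi>\<in>\<Xi>. \<beta> \<xi> * cmod (c \<xi>))"
    by (rule infsum_cong_neutral) (use z in auto)
  finally show ?thesis by (simp add: apw_norm_def apw_coeff_eq[OF assms])
qed

lemma apw_expansion_add:
  assumes "apw_expansion \<Xi> \<beta> a c" "apw_expansion \<Xi> \<beta> b d"
  shows "apw_expansion \<Xi> \<beta> (\<lambda>k. a k + b k) (\<lambda>\<xi>. c \<xi> + d \<xi>)"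
  unfolding apw_expansion_def
proof (intro conjI allI impI)
  show "c \<xi> + d \<xi> = 0" if "\<xi> \<notin> \<Xi>" for \<xi> using assms that by (simp add: apw_expansion_def)
  show "(\<lambda>\<xi>. \<beta> \<xi> * cmod (c \<xi> + d \<xi>)) summable_on \<Xi>"
  proof (rule summable_on_comparison_test)
    show "(\<lambda>\<xi>. \<beta> \<xi> * cmod (c \<xi>) + \<beta> \<xi> * cmod (d \<xi>)) summable_on \<Xi>"
      using assms by (intro summable_on_add) (auto simp: apw_expansion_def)
    show "\<beta> \<xi> * cmod (c \<xi> + d \<xi>) \<le> \<beta> \<xi> * cmod (c \<xi>) + \<beta> \<xi> * cmod (d \<xi>)" if "\<xi> \<in> \<Xi>" for \<xi>
      unfolding distrib_left[symmetric] using beta_ge_1[OF that] by (intro mult_left_mono norm_triangle_ineq) auto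
    show "0 \<le> \<beta> \<xi> * cmod (c \<xi> + d \<xi>)" if "\<xi> \<in> \<Xi>" for \<xi> using beta_ge_1[OF that] by simp
  qed
  show "((\<lambda>\<xi>. (c \<xi> + d \<xi>) * echar \<xi> k) has_sum a k + b k) \<Xi>" for k
    unfolding distrib_right using assms by (intro has_sum_add) (auto simp: apw_expansion_def)
qed

lemma apw_expansion_diagonal_sum_list:
  assumes "\<And>A. A \<in> set As \<Longrightarrow> \<exists>c. apw_expansion \<Xi> \<beta> (diagonal 0 A) c"
  shows "\<exists>c. apw_expansion \<Xi> \<beta> (diagonal 0 (sum_list As)) c"
  using assms
proof (induction As)
  case Nil
  have "apw_expansion \<Xi> \<beta> (diagonal 0 0) (\<lambda>_. 0)"
    by (simp add: apw_expansion_def diagonal_def entry_zero)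
  then show ?case by auto
next
  case (Cons A As)
  obtain c where c: "apw_expansion \<Xi> \<beta> (diagonal 0 A) c" using Cons.prems[of A] by auto
  obtain d where d: "apw_expansion \<Xi> \<beta> (diagonal 0 (sum_list As)) d" using Cons by auto
  from apw_expansion_add[OF c d] show ?case by (auto simp: diagonal_def[abs_def] entry_add)
qed

text \<open>The zero character contributes the length of the interval times \<open>c 0\<close>,
  which is subtracted. Each other character leaves one boundary term at either end, converging by
  fractality, and compatibility dominates the divided coefficients by the weighted ones.\<close>

lemma trace_limit:
  assumes e: "apw_expansion \<Xi> \<beta> a c" and h: "\<And>n. h1 n \<le> h2 n"
    and f: "fractal \<Xi> h1 \<tau>1" "fractal \<Xi> h2 \<tau>2"
  shows "(\<lambda>n. (\<Sum>i\<in>{h1 n..<h2 n}. a i) - of_int (h2 n - h1 n) * c 0) \<longlonglongrightarrow>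
     (\<Sum>\<^sub>\<infinity>\<xi>\<in>\<Xi> - {0}. c \<xi> * (\<tau>1 \<xi> / (1 - echar \<xi> 1))) + (\<Sum>\<^sub>\<infinity>\<xi>\<in>\<Xi> - {0}. c \<xi> * (- \<tau>2 \<xi> / (1 - echar \<xi> 1)))"
proof -
  obtain \<delta> where \<delta>: "0 < \<delta>" "\<And>\<xi>. \<xi> \<in> \<Xi> - {0} \<Longrightarrow> \<delta> \<le> \<beta> \<xi> * cmod (1 - echar \<xi> 1)"
    using compatible_bound by blast
  define b where "b \<xi> = 1 / \<delta> * (\<beta> \<xi> * cmod (c \<xi>))" for \<xi>
  have sb: "b summable_on \<Xi> - {0}"
  proof -
    have "(\<lambda>\<xi>. \<beta> \<xi> * cmod (c \<xi>)) summable_on \<Xi> - {0}"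
      using e by (auto simp: apw_expansion_def intro: summable_on_subset)
    then show ?thesis unfolding b_def by (rule summable_on_cmult_right)
  qed
  have bb: "cmod (c \<xi> / (1 - echar \<xi> 1)) \<le> b \<xi>" if \<xi>: "\<xi> \<in> \<Xi> - {0}" for \<xi>
  proof -
    have p: "0 < cmod (1 - echar \<xi> 1)" using echar_ne_1[of \<xi>] \<xi> by auto
    have "\<delta> * cmod (c \<xi>) \<le> \<beta> \<xi> * cmod (1 - echar \<xi> 1) * cmod (c \<xi>)"
      by (intro mult_right_mono \<delta> \<xi>) simp
    then show ?thesis using p \<delta>(1) by (simp add: b_def norm_divide field_simps)
  qed
  have part: "(\<lambda>n. \<Sum>\<^sub>\<infinity>\<xi>\<in>\<Xi> - {0}. c \<xi> * (echar \<xi> (h n) / (1 - echar \<xi> 1))) \<longlonglongrightarrow> (\<Sum>\<^sub>\<infinity>\<xi>\<in>\<Xi> - {0}. c \<xi> * (\<tau> \<xi> / (1 - echar \<xi> 1)))"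
    and part_s: "\<And>n. (\<lambda>\<xi>. c \<xi> * (echar \<xi> (h n) / (1 - echar \<xi> 1))) summable_on \<Xi> - {0}"
    if f: "fractal \<Xi> h \<tau>" for h \<tau>
  proof -
    have l: "(\<lambda>n. c \<xi> * (echar \<xi> (h n) / (1 - echar \<xi> 1))) \<longlonglongrightarrow> c \<xi> * (\<tau> \<xi> / (1 - echar \<xi> 1))" if "\<xi> \<in> \<Xi> - {0}" for \<xi>
      using f that echar_ne_1[of \<xi>] by (intro tendsto_intros) (auto simp: fractal_def)
    have bd: "cmod (c \<xi> * (echar \<xi> (h n) / (1 - echar \<xi> 1))) \<le> b \<xi>" if "\<xi> \<in> \<Xi> - {0}" for \<xi> n
      using bb[OF that] by (simp add: norm_mult norm_divide)
    show "(\<lambda>n. \<Sum>\<^sub>\<infinity>\<xi>\<in>\<Xi> - {0}. c \<xi> * (echar \<xi> (h n) / (1 - echar \<xi> 1))) \<longlonglongrightarrow> (\<Sum>\<^sub>\<infinity>\<xi>\<in>\<Xi> - {0}. c \<xi> * (\<tau> \<xi> / (1 - echar \<xi> 1)))"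
      and "\<And>n. (\<lambda>\<xi>. c \<xi> * (echar \<xi> (h n) / (1 - echar \<xi> 1))) summable_on \<Xi> - {0}"
      using infsum_dominated_convergence[OF l bd sb] by blast+
  qed
  have eq: "(\<Sum>i\<in>{h1 n..<h2 n}. a i) - of_int (h2 n - h1 n) * c 0 =
     (\<Sum>\<^sub>\<infinity>\<xi>\<in>\<Xi> - {0}. c \<xi> * (echar \<xi> (h1 n) / (1 - echar \<xi> 1))) - (\<Sum>\<^sub>\<infinity>\<xi>\<in>\<Xi> - {0}. c \<xi> * (echar \<xi> (h2 n) / (1 - echar \<xi> 1)))" for n
  proof -
    let ?g = "\<lambda>\<xi>. \<Sum>i\<in>{h1 n..<h2 n}. c \<xi> * echar \<xi> i"
    have hs: "(?g has_sum (\<Sum>i\<in>{h1 n..<h2 n}. a i)) \<Xi>"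
      using e by (intro has_sum_sum_finite) (auto simp: apw_expansion_def)
    have ins: "insert 0 (\<Xi> - {0}) = \<Xi>" using zero_in by auto
    have sg: "?g summable_on \<Xi> - {0}"
      by (rule summable_on_subset[OF has_sum_imp_summable[OF hs]]) auto
    have "(\<Sum>i\<in>{h1 n..<h2 n}. a i) = infsum ?g (insert 0 (\<Xi> - {0}))"
      unfolding ins using infsumI[OF hs] by simp
    also have "\<dots> = ?g 0 + infsum ?g (\<Xi> - {0})"
      by (rule infsum_insert[OF sg]) simp
    also have "?g 0 = of_int (h2 n - h1 n) * c 0" using h[of n] by simp
    also have "infsum ?g (\<Xi> - {0}) = (\<Sum>\<^sub>\<infinity>\<xi>\<in>\<Xi> - {0}. c \<xi> * (echar \<xi> (h1 n) / (1 - echar \<xi> 1)) + - (c \<xi> * (echar \<xi> (h2 n) / (1 - echar \<xi> 1))))"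
    proof (rule infsum_cong)
      fix \<xi> assume "\<xi> \<in> \<Xi> - {0}"
      then have "echar \<xi> 1 \<noteq> 1" using echar_ne_1 by auto
      then show "?g \<xi> = c \<xi> * (echar \<xi> (h1 n) / (1 - echar \<xi> 1)) + - (c \<xi> * (echar \<xi> (h2 n) / (1 - echar \<xi> 1)))"
        by (simp add: sum_distrib_left[symmetric] sum_echar_int h diff_divide_distrib right_diff_distrib)
    qed
    also have "\<dots> = (\<Sum>\<^sub>\<infinity>\<xi>\<in>\<Xi> - {0}. c \<xi> * (echar \<xi> (h1 n) / (1 - echar \<xi> 1))) + (\<Sum>\<^sub>\<infinity>\<xi>\<in>\<Xi> - {0}. - (c \<xi> * (echar \<xi> (h2 n) / (1 - echar \<xi> 1))))"
      by (intro infsum_add part_s[OF f(1)] summable_on_uminus[THEN iffD2] part_s[OF f(2)])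
    finally show ?thesis by (simp add: infsum_uminus)
  qed
  have "(\<Sum>\<^sub>\<infinity>\<xi>\<in>\<Xi> - {0}. c \<xi> * (- \<tau>2 \<xi> / (1 - echar \<xi> 1))) = - (\<Sum>\<^sub>\<infinity>\<xi>\<in>\<Xi> - {0}. c \<xi> * (\<tau>2 \<xi> / (1 - echar \<xi> 1)))"
    unfolding infsum_uminus[symmetric] by (intro infsum_cong) simp
  then show ?thesis unfolding eq using tendsto_diff[OF part[OF f(1)] part[OF f(2)]] by simp
qed

section \<open>The algebra of operators with almost periodic diagonals\<close>

text \<open>The norm of the algebra with constant weight 1 in place of \<alpha>. It controls
  expansions of products, while the decay across diagonals is carried by Laurent majorants.\<close>

definition coeff_norm :: "(int \<Rightarrow> rmodz \<Rightarrow> complex) \<Rightarrow> ennreal" where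
  "coeff_norm c = esum (\<lambda>n. esum (\<lambda>\<xi>. ennreal (\<beta> \<xi> * cmod (c n \<xi>))))"

text \<open>The sums run over all frequencies, with coefficients zero off \<Xi>, so that shifts of
  the frequency and interchanges of sums need no restriction to the subgroup.\<close>

definition expands :: "int bop \<Rightarrow> (int \<Rightarrow> rmodz \<Rightarrow> complex) \<Rightarrow> bool" where
  "expands A c \<longleftrightarrow> (\<forall>n \<xi>. \<xi> \<notin> \<Xi> \<longrightarrow> c n \<xi> = 0) \<and> (\<forall>j k. entry A j k = (\<Sum>\<^sub>\<infinity>\<xi>. c (j - k) \<xi> * echar \<xi> j))"

definition APR :: "('i \<Rightarrow> int bop) \<Rightarrow> real \<Rightarrow> bool" where
  "APR F C \<longleftrightarrow> 0 \<le> C \<and> (\<forall>i. \<exists>c. expands (F i) c \<and> coeff_norm c \<le> ennreal C)"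

lemma coeff_le_coeff_norm:
  assumes "\<And>n \<xi>. \<xi> \<notin> \<Xi> \<Longrightarrow> c n \<xi> = 0"
  shows "ennreal (cmod (c n \<xi>)) \<le> ennreal (\<beta> \<xi> * cmod (c n \<xi>))"
proof (cases "\<xi> \<in> \<Xi>")
  case True
  show ?thesis using mult_right_mono[OF beta_ge_1[OF True], of "cmod (c n \<xi>)"] by (intro ennreal_leI) simp
qed (use assms in simp)

lemma coeff_norm_abs: 
  assumes "\<And>n \<xi>. \<xi> \<notin> \<Xi> \<Longrightarrow> c n \<xi> = 0"
  shows "esum (\<lambda>n. esum (\<lambda>\<xi>. ennreal (cmod (c n \<xi>)))) \<le> coeff_norm c"
  unfolding coeff_norm_def by (intro esum_mono coeff_le_coeff_norm assms)

lemma expandsD: "expands A c \<Longrightarrow> \<xi> \<notin> \<Xi> \<Longrightarrow> c n \<xi> = 0"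
  "expands A c \<Longrightarrow> entry A j k = (\<Sum>\<^sub>\<infinity>\<xi>. c (j - k) \<xi> * echar \<xi> j)"
  by (auto simp: expands_def)

text \<open>Moving U_m past multiplication by e_\<eta> produces the factor e_\<eta>(-m). The
  coefficients of a product are therefore a twisted convolution over pairs p = (m, \<xi>), and the
  twist has modulus 1.\<close>

lemma expands_mult:
  assumes A: "expands A c" "coeff_norm c < Orderings.top" and B: "expands B d" "coeff_norm d < Orderings.top"
  shows "\<exists>f. expands (A * B) f \<and> coeff_norm f \<le> coeff_norm c * coeff_norm d"
proof -
  note c0 = expandsD(1)[OF A(1)] and d0 = expandsD(1)[OF B(1)]
  define t where "t n p \<zeta> = c (fst p) (snd p) * d (n - fst p) (\<zeta> - snd p) * echar (\<zeta> - snd p) (- fst p)"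
    for n and p :: "int \<times> rmodz" and \<zeta>
  define f where "f n \<zeta> = (\<Sum>\<^sub>\<infinity>p. t n p \<zeta>)" for n \<zeta>
  let ?b = "\<lambda>c n \<xi>. ennreal (\<beta> \<xi> * cmod (c n \<xi>))"
  have tb: "ennreal (\<beta> \<zeta> * cmod (t n p \<zeta>)) \<le> ?b c (fst p) (snd p) * ?b d (n - fst p) (\<zeta> - snd p)" for n p \<zeta>
  proof (cases "snd p \<in> \<Xi> \<and> \<zeta> - snd p \<in> \<Xi>")
    case True
    have "\<beta> \<zeta> \<le> \<beta> (snd p) * \<beta> (\<zeta> - snd p)" using beta_add[of "snd p" "\<zeta> - snd p"] True by simp
    then have "\<beta> \<zeta> * cmod (t n p \<zeta>) \<le> \<beta> (snd p) * \<beta> (\<zeta> - snd p) * cmod (t n p \<zeta>)"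
      by (rule mult_right_mono) simp
    also have "\<dots> = (\<beta> (snd p) * cmod (c (fst p) (snd p))) * (\<beta> (\<zeta> - snd p) * cmod (d (n - fst p) (\<zeta> - snd p)))"
      by (simp add: t_def norm_mult)
    finally show ?thesis
      using beta_ge_1[of "snd p"] beta_ge_1[of "\<zeta> - snd p"] True by (simp add: ennreal_mult[symmetric] ennreal_leI)
  next
    case False
    then have "t n p \<zeta> = 0" using c0 d0 by (auto simp: t_def)
    then show ?thesis by simp
  qed
  have tot: "esum (\<lambda>n. esum (\<lambda>\<zeta>. esum (\<lambda>p. ?b c (fst p) (snd p) * ?b d (n - fst p) (\<zeta> - snd p)))) = coeff_norm c * coeff_norm d"
  proof -
    have "esum (\<lambda>n. esum (\<lambda>\<zeta>. esum (\<lambda>p. ?b c (fst p) (snd p) * ?b d (n - fst p) (\<zeta> - snd p))))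
       = esum (\<lambda>n. esum (\<lambda>p. esum (\<lambda>\<zeta>. ?b c (fst p) (snd p) * ?b d (n - fst p) (\<zeta> - snd p))))"
      by (subst (2) esum_swap) (rule refl)
    also have "\<dots> = esum (\<lambda>p. esum (\<lambda>n. ?b c (fst p) (snd p) * esum (?b d (n - fst p))))"
      unfolding esum_cmult by (subst esum_swap) (simp add: esum_minus_right[of "?b d _" "snd _"] esum_cmult)
    also have "\<dots> = esum (\<lambda>p. ?b c (fst p) (snd p)) * coeff_norm d"
      unfolding esum_cmult esum_multc[symmetric] coeff_norm_def using esum_minus_right[of "\<lambda>n. esum (?b d n)"] by simp
    also have "esum (\<lambda>p. ?b c (fst p) (snd p)) = coeff_norm c"
      unfolding coeff_norm_def esum_prod by (simp add: case_prod_unfold)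
    finally show ?thesis .
  qed
  have cff: "coeff_norm f \<le> coeff_norm c * coeff_norm d"
  proof -
    have "ennreal (\<beta> \<zeta> * cmod (f n \<zeta>)) \<le> esum (\<lambda>p. ?b c (fst p) (snd p) * ?b d (n - fst p) (\<zeta> - snd p))" for n \<zeta>
    proof (cases "\<zeta> \<in> \<Xi>")
      case True
      have "ennreal (\<beta> \<zeta> * cmod (f n \<zeta>)) = ennreal (\<beta> \<zeta>) * ennreal (cmod (f n \<zeta>))"
        using beta_ge_1[OF True] by (simp add: ennreal_mult)
      also have "\<dots> \<le> ennreal (\<beta> \<zeta>) * esum (\<lambda>p. ennreal (cmod (t n p \<zeta>)))"
        unfolding f_def by (intro mult_left_mono esum_infsum_norm_le) simp
      also have "\<dots> = esum (\<lambda>p. ennreal (\<beta> \<zeta> * cmod (t n p \<zeta>)))"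
        using beta_ge_1[OF True] by (simp add: esum_cmult ennreal_mult)
      also have "\<dots> \<le> esum (\<lambda>p. ?b c (fst p) (snd p) * ?b d (n - fst p) (\<zeta> - snd p))"
        by (intro esum_mono tb)
      finally show ?thesis .
    next
      case False
      have "t n p \<zeta> = 0" for p
        using False c0 d0 add_in[of "snd p" "\<zeta> - snd p"] by (auto simp: t_def)
      then have "f n \<zeta> = 0" by (simp add: f_def)
      then show ?thesis by simp
    qed
    then show ?thesis unfolding tot[symmetric] coeff_norm_def[of f] by (intro esum_mono)
  qed
  have f0: "f n \<zeta> = 0" if "\<zeta> \<notin> \<Xi>" for n \<zeta>
  proof -
    have "t n p \<zeta> = 0" for p
      using that c0 d0 add_in[of "snd p" "\<zeta> - snd p"] by (auto simp: t_def)
    then show ?thesis by (simp add: f_def)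
  qed
  have ent: "entry (A * B) j k = (\<Sum>\<^sub>\<infinity>\<zeta>. f (j - k) \<zeta> * echar \<zeta> j)" for j k
  proof -
    let ?G = "\<lambda>p \<eta>. c (fst p) (snd p) * echar (snd p) j * (d (j - fst p - k) \<eta> * echar \<eta> (j - fst p))"
    have afin: "esum (\<lambda>p. esum (\<lambda>\<eta>. ennreal (cmod (?G p \<eta>)))) < Orderings.top"
    proof -
      have "esum (\<lambda>p. esum (\<lambda>\<eta>. ennreal (cmod (?G p \<eta>)))) = esum (\<lambda>p. ennreal (cmod (c (fst p) (snd p))) * esum (\<lambda>\<eta>. ennreal (cmod (d (j - fst p - k) \<eta>))))"
        by (simp add: norm_mult ennreal_mult esum_cmult)
      also have "\<dots> \<le> esum (\<lambda>p. ennreal (cmod (c (fst p) (snd p))) * coeff_norm d)"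
        by (intro esum_mono mult_left_mono order_trans[OF esum_ge_point[of "\<lambda>n. esum (\<lambda>\<eta>. ennreal (cmod (d n \<eta>)))"] coeff_norm_abs] d0) auto
      also have "\<dots> = esum (\<lambda>n. esum (\<lambda>\<xi>. ennreal (cmod (c n \<xi>)))) * coeff_norm d"
        by (simp add: esum_multc esum_prod case_prod_unfold)
      also have "\<dots> \<le> coeff_norm c * coeff_norm d" by (intro mult_right_mono coeff_norm_abs c0) auto
      also have "\<dots> < Orderings.top" using A B by (simp add: ennreal_mult_less_top)
      finally show ?thesis .
    qed
    have "entry (A * B) j k = (\<Sum>\<^sub>\<infinity>l. (\<Sum>\<^sub>\<infinity>\<xi>. c (j - l) \<xi> * echar \<xi> j) * (\<Sum>\<^sub>\<infinity>\<eta>. d (l - k) \<eta> * echar \<eta> l))"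
      unfolding entry_times expandsD(2)[OF A(1)] expandsD(2)[OF B(1)] ..
    also have "\<dots> = (\<Sum>\<^sub>\<infinity>m. (\<Sum>\<^sub>\<infinity>\<xi>. c m \<xi> * echar \<xi> j) * (\<Sum>\<^sub>\<infinity>\<eta>. d (j - m - k) \<eta> * echar \<eta> (j - m)))"
      using infsum_shift(2)[of "\<lambda>m. (\<Sum>\<^sub>\<infinity>\<xi>. c m \<xi> * echar \<xi> j) * (\<Sum>\<^sub>\<infinity>\<eta>. d (j - m - k) \<eta> * echar \<eta> (j - m))" j] by simp
    also have "\<dots> = (\<Sum>\<^sub>\<infinity>m. \<Sum>\<^sub>\<infinity>\<xi>. \<Sum>\<^sub>\<infinity>\<eta>. ?G (m, \<xi>) \<eta>)"
      by (simp add: infsum_cmult_left' infsum_cmult_right')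
    also have "\<dots> = (\<Sum>\<^sub>\<infinity>(m, \<xi>). \<Sum>\<^sub>\<infinity>\<eta>. ?G (m, \<xi>) \<eta>)"
    proof (rule infsum_pair_esum)
      have "esum (\<lambda>m. esum (\<lambda>\<xi>. ennreal (cmod (\<Sum>\<^sub>\<infinity>\<eta>. ?G (m, \<xi>) \<eta>)))) \<le> esum (\<lambda>m. esum (\<lambda>\<xi>. esum (\<lambda>\<eta>. ennreal (cmod (?G (m, \<xi>) \<eta>)))))"
        by (intro esum_mono esum_infsum_norm_le)
      also have "\<dots> = esum (\<lambda>p. esum (\<lambda>\<eta>. ennreal (cmod (?G p \<eta>))))"
        using esum_prod[of "\<lambda>m \<xi>. esum (\<lambda>\<eta>. ennreal (cmod (?G (m, \<xi>) \<eta>)))"] by (simp add: case_prod_unfold)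
      also note afin
      finally show "esum (\<lambda>m. esum (\<lambda>\<xi>. ennreal (cmod (\<Sum>\<^sub>\<infinity>\<eta>. ?G (m, \<xi>) \<eta>)))) < Orderings.top" .
    qed
    also have "\<dots> = (\<Sum>\<^sub>\<infinity>p. \<Sum>\<^sub>\<infinity>\<zeta>. ?G p (\<zeta> - snd p))"
      by (simp add: case_prod_unfold infsum_shift(1)[of "?G _" "snd _"])
    also have "\<dots> = (\<Sum>\<^sub>\<infinity>\<zeta>. \<Sum>\<^sub>\<infinity>p. ?G p (\<zeta> - snd p))"
    proof (rule infsum_swap_esum)
      show "esum (\<lambda>p. esum (\<lambda>\<zeta>. ennreal (cmod (?G p (\<zeta> - snd p))))) < Orderings.top"
      proof -
        have "esum (\<lambda>\<zeta>. ennreal (cmod (?G p (\<zeta> - snd p)))) = esum (\<lambda>\<eta>. ennreal (cmod (?G p \<eta>)))" for p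
          by (rule esum_minus_right)
        then show ?thesis using afin by simp
      qed
    qed
    also have "\<dots> = (\<Sum>\<^sub>\<infinity>\<zeta>. \<Sum>\<^sub>\<infinity>p. t (j - k) p \<zeta> * echar \<zeta> j)"
    proof (intro infsum_cong)
      fix \<zeta> :: rmodz and p :: "int \<times> rmodz"
      have "echar \<zeta> j = echar (snd p) j * echar (\<zeta> - snd p) j" using echar_add[of "snd p" "\<zeta> - snd p" j] by simp
      moreover have "echar (\<zeta> - snd p) (j - fst p) = echar (\<zeta> - snd p) j * echar (\<zeta> - snd p) (- fst p)"
        using echar_plus[of "\<zeta> - snd p" j "- fst p"] by simp
      moreover have "j - fst p - k = j - k - fst p" by simp
      ultimately show "?G p (\<zeta> - snd p) = t (j - k) p \<zeta> * echar \<zeta> j"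
        by (simp only: t_def mult_ac)
    qed
    also have "\<dots> = (\<Sum>\<^sub>\<infinity>\<zeta>. f (j - k) \<zeta> * echar \<zeta> j)"
      by (simp add: f_def infsum_cmult_left')
    finally show ?thesis .
  qed
  have "expands (A * B) f" using f0 ent by (simp add: expands_def)
  with cff show ?thesis by blast
qed

text \<open>Provides products of exponentials with an expansion. \<open>U_tau\<close> is defined
  through the coefficients, so it can be evaluated on such a product only with this at hand.\<close>

lemma gauge_APR: "gauge (APR :: ('i \<Rightarrow> int bop) \<Rightarrow> real \<Rightarrow> bool) (\<beta> 0)"
proof
  have "expands 1 (\<lambda>n \<xi>. if n = 0 \<and> \<xi> = 0 then 1 else 0)"
    unfolding expands_def
  proof (intro conjI allI impI)
    show "entry 1 j k = (\<Sum>\<^sub>\<infinity>\<xi>. (if j - k = 0 \<and> \<xi> = 0 then 1 else 0) * echar \<xi> j)" for j k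
      by (subst infsum_single[of 0]) (auto simp: entry_one)
  qed (use zero_in in auto)
  moreover have "coeff_norm (\<lambda>n \<xi>. if n = 0 \<and> \<xi> = 0 then 1 else 0) = ennreal (\<beta> 0)"
  proof -
    have "esum (\<lambda>\<xi>. ennreal (\<beta> \<xi> * cmod (if n = 0 \<and> \<xi> = 0 then 1 else 0))) = (if n = 0 then ennreal (\<beta> 0) else 0)" for n :: int
      by (subst esum_finite_support[of "{0}"]) auto
    then show ?thesis unfolding coeff_norm_def by (simp add: esum_delta)
  qed
  ultimately show "APR (\<lambda>_ :: 'i. 1) (\<beta> 0)"
    unfolding APR_def using beta_ge_1[OF zero_in] by fastforce
next
  fix F F' :: "'i \<Rightarrow> int bop" and C C' assume "APR F C" "APR F' C'"
  then have C: "0 \<le> C" "0 \<le> C'" and c: "\<And>i. \<exists>c. expands (F i) c \<and> coeff_norm c \<le> ennreal C" "\<And>i. \<exists>c. expands (F' i) c \<and> coeff_norm c \<le> ennreal C'"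
    by (auto simp: APR_def)
  have "\<exists>f. expands (F i * F' i) f \<and> coeff_norm f \<le> ennreal (C * C')" for i
  proof -
    obtain c d where cd: "expands (F i) c" "coeff_norm c \<le> ennreal C" "expands (F' i) d" "coeff_norm d \<le> ennreal C'" using c by metis
    have "coeff_norm c < Orderings.top" "coeff_norm d < Orderings.top" using cd(2,4) by (auto elim: le_less_trans)
    from expands_mult[OF cd(1) this(1) cd(3) this(2)] obtain f where "expands (F i * F' i) f" "coeff_norm f \<le> coeff_norm c * coeff_norm d" by blast
    moreover have "coeff_norm c * coeff_norm d \<le> ennreal (C * C')" using mult_mono[OF cd(2,4)] C by (simp add: ennreal_mult)
    ultimately show ?thesis using order_trans by blast
  qed
  then show "APR (\<lambda>i. F i * F' i) (C * C')" using C by (simp add: APR_def)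
next
  fix F :: "'i \<Rightarrow> int bop" and C r :: real assume F: "APR F C" and r: "0 \<le> r"
  have "\<exists>f. expands (r *\<^sub>R F i) f \<and> coeff_norm f \<le> ennreal (r * C)" for i
  proof -
    obtain c where c: "expands (F i) c" "coeff_norm c \<le> ennreal C" using F by (auto simp: APR_def)
    have "expands (r *\<^sub>R F i) (\<lambda>n \<xi>. of_real r * c n \<xi>)"
      using c(1) by (simp add: expands_def entry_scaleR scaleR_conv_of_real[where 'a = complex] mult.assoc infsum_cmult_right')
    moreover have "coeff_norm (\<lambda>n \<xi>. of_real r * c n \<xi>) = ennreal r * coeff_norm c"
    proof -
      have "ennreal (\<beta> \<xi> * cmod (of_real r * c n \<xi>)) = ennreal r * ennreal (\<beta> \<xi> * cmod (c n \<xi>))" for n \<xi>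
        using r by (simp add: norm_mult ennreal_mult'[symmetric] mult_ac)
      then show ?thesis by (simp add: coeff_norm_def esum_cmult)
    qed
    ultimately show ?thesis using mult_left_mono[OF c(2), of "ennreal r"] r by (metis ennreal_mult' zero_le)
  qed
  then show "APR (\<lambda>i. r *\<^sub>R F i) (r * C)" using F r by (simp add: APR_def)
next
  fix F :: "nat \<Rightarrow> 'i \<Rightarrow> int bop" and C and S :: "'i \<Rightarrow> int bop"
  assume F: "\<And>k. APR (F k) (C k)" and sC: "summable C" and S: "\<And>i. (\<lambda>k. F k i) sums S i"
  have C: "0 \<le> C k" for k using F by (auto simp: APR_def)
  have "\<exists>f. expands (S i) f \<and> coeff_norm f \<le> ennreal (suminf C)" for i
  proof -
    have "\<forall>k. \<exists>c. expands (F k i) c \<and> coeff_norm c \<le> ennreal (C k)" using F by (auto simp: APR_def)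
    then obtain c where c: "\<And>k. expands (F k i) (c k)" "\<And>k. coeff_norm (c k) \<le> ennreal (C k)" by metis
    note c0 = expandsD(1)[OF c(1)]
    define f where "f n \<xi> = (\<Sum>\<^sub>\<infinity>k. c k n \<xi>)" for n \<xi>
    have tot: "esum (\<lambda>k. coeff_norm (c k)) \<le> ennreal (suminf C)"
      unfolding esum_def nn_integral_count_space_nat by (rule suminf_le_ennreal[OF c(2) C sC])
    have "coeff_norm f \<le> esum (\<lambda>n. esum (\<lambda>\<xi>. esum (\<lambda>k. ennreal (\<beta> \<xi> * cmod (c k n \<xi>)))))"
      unfolding coeff_norm_def
    proof (intro esum_mono)
      fix n \<xi>
      show "ennreal (\<beta> \<xi> * cmod (f n \<xi>)) \<le> esum (\<lambda>k. ennreal (\<beta> \<xi> * cmod (c k n \<xi>)))"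
      proof (cases "\<xi> \<in> \<Xi>")
        case True
        have b: "0 \<le> \<beta> \<xi>" using beta_ge_1[OF True] by simp
        show ?thesis
          using mult_left_mono[OF esum_infsum_norm_le[of "\<lambda>k. c k n \<xi>"], of "ennreal (\<beta> \<xi>)"] b
          by (simp add: f_def ennreal_mult esum_cmult)
      qed (simp add: f_def c0)
    qed
    also have "\<dots> = esum (\<lambda>k. coeff_norm (c k))"
      unfolding coeff_norm_def by (subst (2) esum_swap, subst esum_swap) (rule refl)
    also note tot
    finally have 1: "coeff_norm f \<le> ennreal (suminf C)" .
    have "entry (S i) j l = (\<Sum>\<^sub>\<infinity>\<xi>. f (j - l) \<xi> * echar \<xi> j)" for j l
    proof -
      have afin: "esum (\<lambda>k. esum (\<lambda>\<xi>. ennreal (cmod (c k (j - l) \<xi> * echar \<xi> j)))) < Orderings.top"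
      proof -
        have "esum (\<lambda>k. esum (\<lambda>\<xi>. ennreal (cmod (c k (j - l) \<xi> * echar \<xi> j)))) \<le> esum (\<lambda>k. coeff_norm (c k))"
          by (simp add: norm_mult)
            (intro esum_mono order_trans[OF esum_ge_point[of "\<lambda>n. esum (\<lambda>\<xi>. ennreal (cmod (c _ n \<xi>)))"] coeff_norm_abs] c0)
        also note tot
        finally show ?thesis by (rule le_less_trans) simp
      qed
      have "(\<lambda>k. entry (F k i) j l) sums entry (S i) j l" by (rule entry_sums[OF S])
      moreover have "summable (\<lambda>k. cmod (entry (F k i) j l))"
      proof (rule summable_on_imp_summable, rule esum_summable(1))
        have "esum (\<lambda>k. ennreal (cmod (entry (F k i) j l))) \<le> esum (\<lambda>k. esum (\<lambda>\<xi>. ennreal (cmod (c k (j - l) \<xi> * echar \<xi> j))))"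
          unfolding expandsD(2)[OF c(1)] by (intro esum_mono esum_infsum_norm_le)
        then show "esum (\<lambda>k. ennreal (cmod (entry (F k i) j l))) < Orderings.top" using afin by (rule le_less_trans)
      qed
      ultimately have "entry (S i) j l = (\<Sum>\<^sub>\<infinity>k. entry (F k i) j l)"
        by (intro infsumI[symmetric] norm_summable_imp_has_sum)
      also have "\<dots> = (\<Sum>\<^sub>\<infinity>k. \<Sum>\<^sub>\<infinity>\<xi>. c k (j - l) \<xi> * echar \<xi> j)"
        unfolding expandsD(2)[OF c(1)] ..
      also have "\<dots> = (\<Sum>\<^sub>\<infinity>\<xi>. \<Sum>\<^sub>\<infinity>k. c k (j - l) \<xi> * echar \<xi> j)"
        by (rule infsum_swap_esum[OF afin])
      also have "\<dots> = (\<Sum>\<^sub>\<infinity>\<xi>. f (j - l) \<xi> * echar \<xi> j)" by (simp add: f_def infsum_cmult_left')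
      finally show ?thesis .
    qed
    then have "expands (S i) f" by (simp add: expands_def f_def c0)
    with 1 show ?thesis by blast
  qed
  then show "APR S (suminf C)" using suminf_nonneg[OF sC C] by (simp add: APR_def)
qed (auto simp: APR_def)

end

section \<open>Translations and limit operators\<close>

lemma norm_mult_op_le:
  assumes "\<And>i. cmod (b i) \<le> B" shows "norm (mult_op b) \<le> B"
proof -
  have B: "0 \<le> B" using assms norm_ge_zero order_trans by blast
  have bd: "bounded (range b)" by (rule boundedI[of _ B]) (use assms in auto)
  have "norm (mult_ell2 b x) \<le> B * norm x" for x
    unfolding norm_ell2.rep_eq mult_ell2.rep_eq
    using l2_mult_bounded(2)[of "Rep_ell2 x" b B] Rep_ell2[of x] assms bd by simp
  then show ?thesis
    unfolding norm_bop.rep_eq mult_op.rep_eq using B by (intro norm_blinfun_bound) simp_all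
qed

lemma norm_shift_op_le: "norm (shift_op n) \<le> 1"
proof -
  have "norm (shift_ell2 n x) \<le> 1 * norm x" for x
    unfolding norm_ell2.rep_eq shift_ell2.rep_eq
    using l2_comp_inj(2)[of "Rep_ell2 x" "\<lambda>k. k - n"] Rep_ell2[of x] by (simp add: inj_def)
  then show ?thesis
    unfolding norm_bop.rep_eq shift_op.rep_eq by (intro norm_blinfun_bound) simp_all
qed

lemma bop_inverse_eq: "A * B = 1 \<Longrightarrow> B * A = 1 \<Longrightarrow> bop_inverse A = B"
  unfolding bop_inverse_def
proof (rule the_equality)
  fix C assume "A * B = 1" "B * A = 1" "A * C = 1 \<and> C * A = 1"
  then have "C = C * (A * B)" "C * A = 1" by simp_all
  then show "C = B" by (simp flip: mult.assoc)
qed simp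

context apw
begin

lemma infsum_restrict:
  assumes "\<And>\<xi>. \<xi> \<notin> \<Xi> \<Longrightarrow> f \<xi> = 0" shows "infsum f UNIV = infsum f \<Xi>"
  by (rule infsum_cong_neutral) (use assms in auto)

lemma expands_row_finite:
  assumes "expands A c" "coeff_norm c < Orderings.top"
  shows "esum (\<lambda>\<xi>. ennreal (cmod (c n \<xi>))) < Orderings.top"
  using order_trans[OF esum_ge_point[of "\<lambda>n. esum (\<lambda>\<xi>. ennreal (cmod (c n \<xi>)))" n] coeff_norm_abs[OF expandsD(1)[OF assms(1)]]] assms(2)
  by (rule le_less_trans)

lemma expands_diagonal:
  assumes "expands A c" "coeff_norm c < Orderings.top"
  shows "apw_expansion \<Xi> \<beta> (diagonal n A) (c n)"
  unfolding apw_expansion_def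
proof (intro conjI allI impI)
  note c0 = expandsD(1)[OF assms(1)]
  show "c n \<xi> = 0" if "\<xi> \<notin> \<Xi>" for \<xi> by (rule c0[OF that])
  have "esum (\<lambda>\<xi>. ennreal (\<beta> \<xi> * cmod (c n \<xi>))) < Orderings.top"
    using esum_ge_point[of "\<lambda>n. esum (\<lambda>\<xi>. ennreal (\<beta> \<xi> * cmod (c n \<xi>)))" n] assms(2)
    unfolding coeff_norm_def by (rule le_less_trans)
  moreover have "ennreal (\<beta> \<xi> * cmod (c n \<xi>)) = ennreal (norm (\<beta> \<xi> * cmod (c n \<xi>)))" for \<xi>
    using c0[of \<xi> n] beta_ge_1[of \<xi>] by (cases "\<xi> \<in> \<Xi>") auto
  ultimately have "(\<lambda>\<xi>. \<beta> \<xi> * cmod (c n \<xi>)) summable_on UNIV"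
    by (intro esum_summable(2)) simp
  then show "(\<lambda>\<xi>. \<beta> \<xi> * cmod (c n \<xi>)) summable_on \<Xi>" by (rule summable_on_subset) simp
  fix k
  have "esum (\<lambda>\<xi>. ennreal (norm (c n \<xi> * echar \<xi> k))) < Orderings.top"
    using expands_row_finite[OF assms] by (simp add: norm_mult)
  from esum_summable(2)[OF this] have "(\<lambda>\<xi>. c n \<xi> * echar \<xi> k) summable_on \<Xi>"
    by (rule summable_on_subset) simp
  moreover have "diagonal n A k = (\<Sum>\<^sub>\<infinity>\<xi>\<in>\<Xi>. c n \<xi> * echar \<xi> k)"
    unfolding diagonal_def expandsD(2)[OF assms(1)] by (simp add: infsum_restrict c0)
  ultimately show "((\<lambda>\<xi>. c n \<xi> * echar \<xi> k) has_sum diagonal n A k) \<Xi>" by simp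
qed

text \<open>The double sum defining \<open>U_tau\<close> converges absolutely in operator norm, each
  term being bounded by the modulus of its coefficient, so entries may be taken termwise. Only the
  diagonal n = j - k remains.\<close>

lemma entry_U_tau:
  assumes A: "expands A c" "coeff_norm c < Orderings.top" and \<tau>: "\<And>\<xi>. \<xi> \<in> \<Xi> \<Longrightarrow> cmod (\<tau> \<xi>) = 1"
  shows "entry (U_tau \<Xi> \<beta> \<tau> A) j k = (\<Sum>\<^sub>\<infinity>\<xi>. c (j - k) \<xi> * \<tau> \<xi> * echar \<xi> j)"
proof -
  \<comment> \<open>\<tau> is controlled on \<Xi> only, hence the value 0 elsewhere.\<close>
  define T where "T n \<xi> = (if \<xi> \<in> \<Xi> then mult_op (\<lambda>k. c n \<xi> * \<tau> \<xi> * echar \<xi> k) * shift_op n else 0)" for n \<xi>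
  have U: "U_tau \<Xi> \<beta> \<tau> A = (\<Sum>\<^sub>\<infinity>n. \<Sum>\<^sub>\<infinity>\<xi>. T n \<xi>)"
    unfolding U_tau_def apw_coeff_eq[OF expands_diagonal[OF A]]
    by (simp add: infsum_restrict T_def cong: infsum_cong)
  have bT: "norm (T n \<xi>) \<le> cmod (c n \<xi>)" for n \<xi>
  proof (cases "\<xi> \<in> \<Xi>")
    case True
    have "norm (mult_op (\<lambda>k. c n \<xi> * \<tau> \<xi> * echar \<xi> k) * shift_op n) \<le> cmod (c n \<xi>) * 1"
      by (intro order_trans[OF norm_mult_ineq] mult_mono norm_mult_op_le norm_shift_op_le) (auto simp: norm_mult \<tau> True)
    then show ?thesis by (simp add: T_def True)
  qed (simp add: T_def)
  have fin: "esum (\<lambda>n. esum (\<lambda>\<xi>. ennreal (norm (T n \<xi>)))) < Orderings.top"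
  proof (rule le_less_trans)
    show "esum (\<lambda>n. esum (\<lambda>\<xi>. ennreal (norm (T n \<xi>)))) \<le> coeff_norm c"
      by (rule order_trans[OF _ coeff_norm_abs[OF expandsD(1)[OF A(1)]]]) (intro esum_mono ennreal_leI bT)
  qed (rule A(2))
  have e: "entry (infsum g UNIV) j k = infsum (\<lambda>x. entry (g x) j k) UNIV" if "g summable_on UNIV" for g :: "'x \<Rightarrow> int bop"
    using has_sum_bounded_linear[OF bounded_linear_entry has_sum_infsum[OF that], of j k] by (rule infsumI[symmetric])
  have bd: "bounded (range (\<lambda>k. c n \<xi> * \<tau> \<xi> * echar \<xi> k))" for n \<xi>
    by (rule boundedI[of _ "cmod (c n \<xi> * \<tau> \<xi>)"]) (auto simp: norm_mult)
  have eT: "entry (T n \<xi>) j k = (if n = j - k then c n \<xi> * \<tau> \<xi> * echar \<xi> j else 0)" for n \<xi>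
  proof (cases "\<xi> \<in> \<Xi>")
    case True
    then show ?thesis by (auto simp: T_def entry_mult_op_left[OF bd] entry_shift_op)
  next
    case False
    then show ?thesis by (simp add: T_def entry_zero expandsD(1)[OF A(1)])
  qed
  have "entry (U_tau \<Xi> \<beta> \<tau> A) j k = (\<Sum>\<^sub>\<infinity>n. \<Sum>\<^sub>\<infinity>\<xi>. entry (T n \<xi>) j k)"
    unfolding U by (simp add: e esum_pair_summable(2,3)[OF fin])
  also have "\<dots> = (\<Sum>\<^sub>\<infinity>\<xi>. entry (T (j - k) \<xi>) j k)"
    by (rule infsum_single) (simp add: eT)
  finally show ?thesis by (simp add: eT)
qed

lemma entry_translate_expands:
  assumes "expands A c"
  shows "entry (translate h A) j k = (\<Sum>\<^sub>\<infinity>\<xi>. c (j - k) \<xi> * echar \<xi> h * echar \<xi> j)"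
  unfolding entry_translate expandsD(2)[OF assms] by (simp add: echar_plus mult_ac)

text \<open>Translation by h multiplies the coefficient at \<xi> by e_\<xi>(h), which along a
  fractal sequence tends to \<tau>(\<xi>); the moduli of the coefficients dominate.\<close>

lemma translate_tendsto:
  assumes A: "expands A c" "coeff_norm c < Orderings.top" and \<tau>: "\<tau> \<in> Hom_T \<Xi>" "fractal \<Xi> h \<tau>"
  shows "(\<lambda>n. entry (translate (h n) A) j k) \<longlonglongrightarrow> entry (U_tau \<Xi> \<beta> \<tau> A) j k"
proof -
  have t1: "cmod (\<tau> \<xi>) = 1" if "\<xi> \<in> \<Xi>" for \<xi> using \<tau>(1) that by (simp add: Hom_T_def)
  have U: "entry (U_tau \<Xi> \<beta> \<tau> A) j k = (\<Sum>\<^sub>\<infinity>\<xi>. c (j - k) \<xi> * \<tau> \<xi> * echar \<xi> j)"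
    by (rule entry_U_tau[OF A]) (rule t1)
  show ?thesis
    unfolding entry_translate_expands[OF A(1)] U
  proof (rule esum_dominated_convergence)
    show "(\<lambda>n. c (j - k) \<xi> * echar \<xi> (h n) * echar \<xi> j) \<longlonglongrightarrow> c (j - k) \<xi> * \<tau> \<xi> * echar \<xi> j" for \<xi>
    proof (cases "\<xi> \<in> \<Xi>")
      case True
      then show ?thesis using \<tau>(2) by (intro tendsto_mult tendsto_const) (auto simp: fractal_def)
    qed (simp add: expandsD(1)[OF A(1)])
    show "ennreal (cmod (c (j - k) \<xi> * echar \<xi> (h n) * echar \<xi> j)) \<le> ennreal (cmod (c (j - k) \<xi>))" for n \<xi>
      by (simp add: norm_mult)
    show "esum (\<lambda>\<xi>. ennreal (cmod (c (j - k) \<xi>))) < Orderings.top" by (rule expands_row_finite[OF A])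
  qed
qed

end

locale apw_weight = apw \<Xi> \<beta> + weight w
  for \<Xi> :: "rmodz set" and \<beta> :: "rmodz \<Rightarrow> real" and w :: "int \<Rightarrow> ennreal"
begin

text \<open>What is retained of membership in the algebra: an expansion, its finite \<beta>-norm,
  and finiteness of the weighted sum of plain coefficient sums, which serve as the Laurent
  majorant.\<close>

definition ap_op :: "int bop \<Rightarrow> bool" where
  "ap_op A \<longleftrightarrow> (\<exists>c. expands A c \<and> coeff_norm c < Orderings.top \<and> wnorm (\<lambda>n. esum (\<lambda>\<xi>. ennreal (cmod (c n \<xi>)))) < Orderings.top)"

text \<open>Multiplying coefficients by numbers of modulus 1 does not change their moduli, so one
  majorant serves \<open>A\<close> and all the operators \<open>U_tau\<close>.\<close>

lemma ap_op_ldom: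
  assumes "ap_op A"
  shows "\<exists>\<mu>. wnorm \<mu> < Orderings.top \<and> ldom \<mu> A \<and> (\<forall>\<tau>\<in>Hom_T \<Xi>. ldom \<mu> (U_tau \<Xi> \<beta> \<tau> A))"
proof -
  obtain c where c: "expands A c" "coeff_norm c < Orderings.top" "wnorm (\<lambda>n. esum (\<lambda>\<xi>. ennreal (cmod (c n \<xi>)))) < Orderings.top"
    using assms by (auto simp: ap_op_def)
  have "ldom (\<lambda>n. esum (\<lambda>\<xi>. ennreal (cmod (c n \<xi>)))) A"
    unfolding ldom_def expandsD(2)[OF c(1)]
    by (intro allI order_trans[OF esum_infsum_norm_le]) (simp add: norm_mult)
  moreover have "ldom (\<lambda>n. esum (\<lambda>\<xi>. ennreal (cmod (c n \<xi>)))) (U_tau \<Xi> \<beta> \<tau> A)" if "\<tau> \<in> Hom_T \<Xi>" for \<tau>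
  proof -
    have t1: "cmod (\<tau> \<xi>) = 1" if "\<xi> \<in> \<Xi>" for \<xi> using \<open>\<tau> \<in> Hom_T \<Xi>\<close> that by (simp add: Hom_T_def)
    have "ennreal (cmod (c n \<xi> * \<tau> \<xi> * echar \<xi> j)) = ennreal (cmod (c n \<xi>))" for n \<xi> j
      by (cases "\<xi> \<in> \<Xi>") (auto simp: norm_mult t1 expandsD(1)[OF c(1)])
    moreover have "entry (U_tau \<Xi> \<beta> \<tau> A) j k = (\<Sum>\<^sub>\<infinity>\<xi>. c (j - k) \<xi> * \<tau> \<xi> * echar \<xi> j)" for j k
      by (rule entry_U_tau[OF c(1,2)]) (rule t1)
    ultimately show ?thesis
      unfolding ldom_def
      by (auto intro!: order_trans[OF esum_infsum_norm_le])
  qed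
  ultimately show ?thesis using c(3) by blast
qed

lemma ap_op_tame: "ap_op A \<Longrightarrow> tame (\<lambda>_::unit. A)" "ap_op A \<Longrightarrow> \<tau> \<in> Hom_T \<Xi> \<Longrightarrow> tame (\<lambda>_::unit. U_tau \<Xi> \<beta> \<tau> A)"
  using ap_op_ldom unfolding tame_def by blast+

lemma ap_op_Conv:
  assumes A: "ap_op A" and \<tau>: "\<tau> \<in> Hom_T \<Xi>" "fractal \<Xi> h \<tau>"
  shows "\<exists>c. Conv (\<lambda>i. case i of None \<Rightarrow> U_tau \<Xi> \<beta> \<tau> A | Some n \<Rightarrow> translate (h n) A) c"
proof -
  obtain \<mu> where \<mu>: "wnorm \<mu> < Orderings.top" "ldom \<mu> A" "ldom \<mu> (U_tau \<Xi> \<beta> \<tau> A)"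
    using ap_op_ldom[OF A] \<tau>(1) by blast
  obtain c where c: "expands A c" "coeff_norm c < Orderings.top" using A by (auto simp: ap_op_def)
  show ?thesis
    by (rule ConvI[OF _ \<mu>(1)]) (use \<mu>(2,3) translate_tendsto[OF c \<tau>] in \<open>auto simp: ldom_translate split: option.split\<close>)
qed

text \<open>
  \<open>U\<^sup>\<tau>\<close> commutes with products of exponentials because it is a limit of translations.
\<close>

lemma U_tau_exp_prod_aux:
  assumes \<tau>: "\<tau> \<in> Hom_T \<Xi>" "fractal \<Xi> h \<tau>"
    and C: "\<And>B. B \<in> set Bs \<Longrightarrow> \<exists>c. Conv (\<lambda>i. case i of None \<Rightarrow> V B | Some n \<Rightarrow> translate (h n) B) c"
    and E: "\<And>B. B \<in> set Bs \<Longrightarrow> \<exists>c. expands B c \<and> coeff_norm c < Orderings.top"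
  shows "U_tau \<Xi> \<beta> \<tau> (exp_prod Bs) = exp_prod (map V Bs)"
proof -
  let ?Fs = "map (\<lambda>B (_::unit). B) Bs"
  have "\<exists>C. APR B C" if B: "B \<in> set ?Fs" for B
  proof -
    obtain b where b: "b \<in> set Bs" "B = (\<lambda>_. b)" using B by auto
    obtain c where "expands b c" "coeff_norm c < Orderings.top" using E[OF b(1)] by blast
    then have "APR B (enn2real (coeff_norm c))" unfolding APR_def b(2) by auto
    then show ?thesis by blast
  qed
  from gauge.exp_prod[OF gauge_APR, of ?Fs, OF this]
  obtain C where C0: "APR (\<lambda>_::unit. exp_prod Bs) C" by (auto simp: o_def)
  then obtain f where f: "expands (exp_prod Bs) f" "coeff_norm f \<le> ennreal C" by (auto simp: APR_def)
  have f2: "coeff_norm f < Orderings.top" using f(2) by (rule le_less_trans) simp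
  let ?Cs = "map (\<lambda>B i. case i of None \<Rightarrow> V B | Some n \<Rightarrow> translate (h n) B) Bs"
  have "\<exists>c. Conv (\<lambda>i. exp_prod (map (\<lambda>B. B i) ?Cs)) c"
    by (rule Conv_exp_prod') (use C in auto)
  then obtain c where c: "Conv (\<lambda>i. exp_prod (map (\<lambda>B. B i) ?Cs)) c" by blast
  show ?thesis
  proof (rule bop_eqI)
    fix i j
    have "(\<lambda>n. entry (translate (h n) (exp_prod Bs)) i j) \<longlonglongrightarrow> entry (exp_prod (map V Bs)) i j"
      using ConvD[OF c, of i j] by (simp add: o_def translate_exp_prod)
    with translate_tendsto[OF f(1) f2 \<tau>, of i j]
    show "entry (U_tau \<Xi> \<beta> \<tau> (exp_prod Bs)) i j = entry (exp_prod (map V Bs)) i j" by (rule LIMSEQ_unique)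
  qed
qed

lemma U_tau_exp_prod:
  assumes A: "\<And>A. A \<in> set As \<Longrightarrow> ap_op A" and \<tau>: "\<tau> \<in> Hom_T \<Xi>" "fractal \<Xi> h \<tau>"
  shows "U_tau \<Xi> \<beta> \<tau> (exp_prod As) = exp_prod (map (U_tau \<Xi> \<beta> \<tau>) As)"
    and "U_tau \<Xi> \<beta> \<tau> (exp_prod (map uminus (rev As))) = exp_prod (map uminus (rev (map (U_tau \<Xi> \<beta> \<tau>) As)))"
proof -
  show "U_tau \<Xi> \<beta> \<tau> (exp_prod As) = exp_prod (map (U_tau \<Xi> \<beta> \<tau>) As)"
    by (rule U_tau_exp_prod_aux[OF \<tau>]) (use A ap_op_Conv[OF _ \<tau>] in \<open>auto simp: ap_op_def\<close>)
  \<comment> \<open>For B = -A' the limit of the translates is the negative of the limit for A'. As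
    -B = A', it is the function of B written here.\<close>
  have "U_tau \<Xi> \<beta> \<tau> (exp_prod (map uminus (rev As))) = exp_prod (map (\<lambda>B. - U_tau \<Xi> \<beta> \<tau> (- B)) (map uminus (rev As)))"
  proof (rule U_tau_exp_prod_aux[OF \<tau>])
    fix B assume "B \<in> set (map uminus (rev As))"
    then obtain A' where A': "A' \<in> set As" "B = - A'" by auto
    have "\<exists>c. Conv (\<lambda>i. - (case i of None \<Rightarrow> U_tau \<Xi> \<beta> \<tau> A' | Some n \<Rightarrow> translate (h n) A')) c"
      by (rule Conv_uminus'[OF ap_op_Conv[OF A[OF A'(1)] \<tau>]])
    moreover have "(\<lambda>i. - (case i of None \<Rightarrow> U_tau \<Xi> \<beta> \<tau> A' | Some n \<Rightarrow> translate (h n) A'))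
        = (\<lambda>i. case i of None \<Rightarrow> - U_tau \<Xi> \<beta> \<tau> (- B) | Some n \<Rightarrow> translate (h n) B)"
      by (auto simp: A'(2) translate_uminus split: option.split)
    ultimately show "\<exists>c. Conv (\<lambda>i. case i of None \<Rightarrow> - U_tau \<Xi> \<beta> \<tau> (- B) | Some n \<Rightarrow> translate (h n) B) c" by simp
    obtain c where c: "expands A' c" "coeff_norm c < Orderings.top" using A[OF A'(1)] by (auto simp: ap_op_def)
    have "expands B (\<lambda>n \<xi>. - c n \<xi>)"
      using c(1) by (simp add: expands_def A'(2) entry_uminus infsum_uminus)
    moreover have "coeff_norm (\<lambda>n \<xi>. - c n \<xi>) = coeff_norm c" by (simp add: coeff_norm_def)
    ultimately show "\<exists>c. expands B c \<and> coeff_norm c < Orderings.top" using c(2) by metis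
  qed
  then show "U_tau \<Xi> \<beta> \<tau> (exp_prod (map uminus (rev As))) = exp_prod (map uminus (rev (map (U_tau \<Xi> \<beta> \<tau>) As)))"
    by (simp add: o_def rev_map)
qed

text \<open>The quotient is a corner determinant times the exponential of the trace minus its mean
  part, which converges to the prefactors. As \<open>U_tau\<close> respects products of
  exponentials, the limiting corners are those under the determinants of \<Theta>1 and, by Jacobi's
  identity, of \<Theta>2.\<close>

lemma section_limit:
  assumes A: "\<And>A. A \<in> set As \<Longrightarrow> ap_op A"
    and \<tau>1: "\<tau>1 \<in> Hom_T \<Xi>" "fractal \<Xi> h1 \<tau>1" and \<tau>2: "\<tau>2 \<in> Hom_T \<Xi>" "fractal \<Xi> h2 \<tau>2"
    and h: "\<And>n. h2 n - h1 n > 0" "filterlim (\<lambda>n. h2 n - h1 n) at_top sequentially"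
  shows "(\<lambda>n. Determinant.det (finite_section (h1 n) (h2 n) (exp_prod As)) /
            exp (mean_value (diagonal 0 (sum_list As))) ^ nat (h2 n - h1 n))
         \<longlonglongrightarrow> Theta1 \<Xi> \<beta> As \<tau>1 * Theta2 \<Xi> \<beta> As \<tau>2"
proof -
  let ?U1 = "U_tau \<Xi> \<beta> \<tau>1" and ?U2 = "U_tau \<Xi> \<beta> \<tau>2" and ?a = "diagonal 0 (sum_list As)"
  have "\<exists>c. apw_expansion \<Xi> \<beta> (diagonal 0 A) c" if "A \<in> set As" for A
    using A[OF that] expands_diagonal unfolding ap_op_def by blast
  then obtain c where c: "apw_expansion \<Xi> \<beta> ?a c" using apw_expansion_diagonal_sum_list by blast
  define S1 where "S1 = (\<Sum>\<^sub>\<infinity>\<xi>\<in>\<Xi> - {0}. c \<xi> * (\<tau>1 \<xi> / (1 - echar \<xi> 1)))"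
  define S2 where "S2 = (\<Sum>\<^sub>\<infinity>\<xi>\<in>\<Xi> - {0}. c \<xi> * (- \<tau>2 \<xi> / (1 - echar \<xi> 1)))"
  have m: "mean_value ?a = c 0" by (rule mean_value_eq[OF c])
  have quot: "Determinant.det (finite_section (h1 n) (h2 n) (exp_prod As)) / exp (mean_value ?a) ^ nat (h2 n - h1 n)
     = kernel_det (cornerL {h1 n..<h2 n} As) * exp ((\<Sum>i\<in>{h1 n..<h2 n}. ?a i) - of_int (h2 n - h1 n) * c 0)" for n
  proof -
    have "exp (c 0) ^ nat (h2 n - h1 n) = exp (of_nat (nat (h2 n - h1 n)) * c 0)"
      by (rule exp_of_nat_mult[symmetric])
    also have "of_nat (nat (h2 n - h1 n)) = (of_int (h2 n - h1 n) :: complex)"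
      using h(1)[of n] by (simp add: of_nat_nat)
    finally have e: "exp (c 0) ^ nat (h2 n - h1 n) = exp (of_int (h2 n - h1 n) * c 0)" .
    have "(\<Sum>i\<in>{h1 n..<h2 n}. entry (sum_list As) i i) = (\<Sum>i\<in>{h1 n..<h2 n}. ?a i)"
      by (simp add: diagonal_def)
    then show ?thesis unfolding det_finite_section m e by (simp add: exp_diff)
  qed
  have tr: "(\<lambda>n. (\<Sum>i\<in>{h1 n..<h2 n}. ?a i) - of_int (h2 n - h1 n) * c 0) \<longlonglongrightarrow> S1 + S2"
    unfolding S1_def S2_def by (rule trace_limit[OF c _ \<tau>1(2) \<tau>2(2)]) (use h(1) less_imp_le in \<open>simp add: less_imp_le\<close>)
  have kernel_det: "(\<lambda>n. kernel_det (cornerL {h1 n..<h2 n} As)) \<longlonglongrightarrow> kernel_det (cornerL {0..} (map ?U1 As)) * kernel_det (cornerL {..<0} (map ?U2 As))"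
    by (rule kernel_det_cornerL_limit[OF h(2) ap_op_tame(1)[OF A] ap_op_Conv[OF A \<tau>1] ap_op_Conv[OF A \<tau>2]])
  have t1: "B \<in> set (map ?U1 As) \<Longrightarrow> tame (\<lambda>_::unit. B)" and t2: "B \<in> set (map ?U2 As) \<Longrightarrow> tame (\<lambda>_::unit. B)" for B
    using ap_op_tame(2)[OF A] \<tau>1(1) \<tau>2(1) by auto
  have U1: "U_tau \<Xi> \<beta> \<tau>1 (exp_prod As) = exp_prod (map ?U1 As)"
    by (rule U_tau_exp_prod(1)[OF A \<tau>1])
  have U2: "U_tau \<Xi> \<beta> \<tau>2 (exp_prod (map uminus (rev As))) = exp_prod (map uminus (rev (map ?U2 As)))"
    by (rule U_tau_exp_prod(2)[OF A \<tau>2])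
  have J: "kernel_det (cornerL {..<0} (map ?U2 As)) = kernel_det (cornerR {0..} (map ?U2 As))"
    by (rule Jacobi) (rule t2)
  have T1: "Theta1 \<Xi> \<beta> As \<tau>1 = exp S1 * kernel_det (cornerL {0..} (map ?U1 As))"
    unfolding Theta1_def apw_coeff_eq[OF c] S1_def[symmetric] U1
    using fredholm_det_corners(1)[of "map ?U1 As", OF t1] by (simp add: rev_map o_def)
  have inv: "bop_inverse (exp_prod As) = exp_prod (map uminus (rev As))"
    by (rule bop_inverse_eq[OF exp_prod_inverse exp_prod_inverse'])
  have T2: "Theta2 \<Xi> \<beta> As \<tau>2 = exp S2 * kernel_det (cornerL {..<0} (map ?U2 As))"
    unfolding Theta2_def apw_coeff_eq[OF c] S2_def[symmetric] inv U2 J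
    using fredholm_det_corners(2)[of "map ?U2 As", OF t2] by (simp add: o_def)
  show ?thesis
    unfolding quot T1 T2
    using tendsto_mult[OF kernel_det tendsto_exp[OF tr]] by (simp add: exp_add mult_ac)
qed

end

text \<open>Since \<beta> >= 1 on \<Xi>, the plain coefficient sums are at most the norms of the
  diagonals, whose weighted sum is finite for members of the algebra.\<close>

lemma (in apw_weight) wiener_ap_op:
  assumes w: "\<And>n. w n = ennreal (alpha_weight \<alpha>1 \<alpha>2 n)" and A: "A \<in> wiener_APW \<alpha>1 \<alpha>2 \<Xi> \<beta>"
  shows "ap_op A"
proof -
  define c where "c n = apw_coeff \<Xi> \<beta> (diagonal n A)" for n
  have ex: "apw_expansion \<Xi> \<beta> (diagonal n A) (c n)" for n
  proof -
    have "\<exists>c. apw_expansion \<Xi> \<beta> (diagonal n A) c" using A by (auto simp: wiener_APW_def APW_def)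
    then show ?thesis unfolding c_def using apw_coeff_eq by auto
  qed
  have c0: "c n \<xi> = 0" if "\<xi> \<notin> \<Xi>" for n \<xi> using ex[of n] that by (simp add: apw_expansion_def)
  have "entry A j k = (\<Sum>\<^sub>\<infinity>\<xi>. c (j - k) \<xi> * echar \<xi> j)" for j k
  proof -
    have "entry A j k = diagonal (j - k) A j" by (simp add: diagonal_def)
    also have "\<dots> = (\<Sum>\<^sub>\<infinity>\<xi>\<in>\<Xi>. c (j - k) \<xi> * echar \<xi> j)"
      using ex[of "j - k"] by (intro infsumI[symmetric]) (simp add: apw_expansion_def)
    finally show ?thesis by (simp add: infsum_restrict c0)
  qed
  then have e: "expands A c" by (simp add: expands_def c0)
  let ?N = "\<lambda>n. apw_norm \<Xi> \<beta> (diagonal n A)"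
  have N0: "0 \<le> ?N n" for n
    unfolding apw_norm_def using beta_ge_1 by (intro infsum_nonneg mult_nonneg_nonneg) (auto intro: order_trans[OF zero_le_one])
  have a0: "0 \<le> alpha_weight \<alpha>1 \<alpha>2 n" for n by (simp add: alpha_weight_def)
  have "esum (\<lambda>n. w n * ennreal (?N n)) = esum (\<lambda>n. ennreal (alpha_weight \<alpha>1 \<alpha>2 n * ?N n))"
    using N0 a0 by (simp add: w ennreal_mult)
  also have "\<dots> = ennreal (\<Sum>\<^sub>\<infinity>n. alpha_weight \<alpha>1 \<alpha>2 n * ?N n)"
    using A N0 a0 by (intro esum_ennreal) (auto simp: wiener_APW_def)
  also have "\<dots> < Orderings.top" by simp
  finally have wN: "wnorm (\<lambda>n. ennreal (?N n)) < Orderings.top" by (simp add: wnorm_def)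
  have "coeff_norm c = esum (\<lambda>n. ennreal (?N n))" unfolding coeff_norm_def esum_expansion[OF ex] ..
  then have 1: "coeff_norm c < Orderings.top" using le_less_trans[OF esum_le_wnorm wN] by simp
  have "wnorm (\<lambda>n. esum (\<lambda>\<xi>. ennreal (cmod (c n \<xi>)))) \<le> wnorm (\<lambda>n. ennreal (?N n))"
    unfolding wnorm_def esum_expansion[OF ex, symmetric]
    by (intro esum_mono mult_left_mono coeff_le_coeff_norm c0) auto
  then have 2: "wnorm (\<lambda>n. esum (\<lambda>\<xi>. ennreal (cmod (c n \<xi>)))) < Orderings.top" using wN by (rule le_less_trans)
  show ?thesis unfolding ap_op_def using e 1 2 by blast
qed

theorem theorem5p4:
  fixes \<Xi> :: "rmodz set" and \<beta> :: "rmodz \<Rightarrow> real"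
    and \<alpha>1 \<alpha>2 :: real
    and h1 h2 :: "nat \<Rightarrow> int"
    and \<tau>1 \<tau>2 :: "rmodz \<Rightarrow> complex"
    and As :: "int bop list"
  assumes "add_subgroup \<Xi>"
    and "admissible \<Xi> \<beta>" and "compatible \<Xi> \<beta>"
    and "\<alpha>1 \<ge> 0" and "\<alpha>2 \<ge> 0" and "\<alpha>1 + \<alpha>2 = 1"
    and "\<tau>1 \<in> Hom_T \<Xi>" and "fractal \<Xi> h1 \<tau>1"
    and "\<tau>2 \<in> Hom_T \<Xi>" and "fractal \<Xi> h2 \<tau>2"
    and "\<And>n. h2 n - h1 n > 0"
    and "filterlim (\<lambda>n. h2 n - h1 n) at_top sequentially"
    and "As \<noteq> []" and "set As \<subseteq> wiener_APW \<alpha>1 \<alpha>2 \<Xi> \<beta>"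
  shows "(\<lambda>n. Determinant.det (finite_section (h1 n) (h2 n) (exp_prod As)) /
            exp (mean_value (diagonal 0 (sum_list As))) ^ nat (h2 n - h1 n))
         \<longlonglongrightarrow> Theta1 \<Xi> \<beta> As \<tau>1 * Theta2 \<Xi> \<beta> As \<tau>2"
proof -
  interpret weight "\<lambda>n. ennreal (alpha_weight \<alpha>1 \<alpha>2 n)"
    by (rule weight_alpha) (use assms in auto)
  interpret apw_weight \<Xi> \<beta> "\<lambda>n. ennreal (alpha_weight \<alpha>1 \<alpha>2 n)"
    by unfold_locales (use assms in auto)
  show ?thesis
  proof (rule section_limit)
    show "ap_op A" if "A \<in> set As" for A
      by (rule wiener_ap_op[OF refl]) (use assms that in auto)
  qed (use assms in auto)
qed

end
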